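(* Let $m^\star$ be a monotone non-increasing probability density on $[0,\infty)$ with uniform-mixture representation $m^\star(x)=\int_0^\infty\mathsf{Unif}(x\mid 0,u)\,P^\star(du)$ and distribution function $M^\star$. Fix $0<\ell<L<\infty$, let $\mathbb{U}=[\ell,L]$, and let $m^{\star L}(x)=m^\star(x)\,1_{[0,L]}(x)/M^\star(L)$ be $m^\star$ renormalized to $[0,L]$. For probability measures $P$ on $\mathbb{U}$, let $m_P(x)=\int_{\mathbb{U}}\mathsf{Unif}(x\mid 0,u)\,P(du)$, $x\in[0,L]$, and suppose $K(m^{\star L},m_P)<\infty$ for at least one such $P$. Let $X_1,X_2,\ldots$ be i.i.d. with density $m^{\star L}$. Let $P_n$ be the predictive recursion estimator computed from $X_1,\ldots,X_n$ with kernel $\mathsf{Unif}(x\mid0,u)$, weights $w_i=a(i+1)^{-1}$ with $0<a<\tfrac29$, and initial guess $$P_0=p_{0,\ell}\,\delta_{\{\ell\}}+(1-p_{0,\ell}-p_{0,L})\,P_{0,\mathbb{U}}+p_{0,L}\,\delta_{\{L\}},$$ where $p_{0,\ell}$ and $p_{0,L}$ are positive with sum strictly less than 1, and $P_{0,\mathbb{U}}$ is a probability measure on $\mathbb{U}$ having a density with respect to Lebesgue measure. Let $m_n=m_{P_n}$. Define $$P^\dagger=a_\ell\,\delta_{\{\ell\}}+a_{\mathbb{U}}\,P^\star|_{\mathbb{U}}+a_L\,\delta_{\{L\}},\qquad a_\ell=\frac{P^\star([0,\ell])}{M^\star(L)},\quad a_{\mathbb{U}}=\frac{P^\star([0,L])}{M^\star(L)},\quad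 a_L=\frac{L\,m^\star(L)}{M^\star(L)},$$ and $m^\dagger=m_{P^\dagger}$, that is, $$m^\dagger(x)=a_\ell\,\mathsf{Unif}(x\mid 0,\ell)+a_{\mathbb{U}}\int_{\mathbb{U}}\mathsf{Unif}(x\mid 0,u)\,P^\star(du)+a_L\,\mathsf{Unif}(x\mid 0,L).$$ Then, as $n\to\infty$, $$K(m^{\star L},m_n)\to K(m^{\star L},m^\dagger),\quad m^{\star L}\text{-almost surely}.$$ Moreover, $m_n$ converges $m^{\star L}$-almost surely to $m^\dagger$ in total variation distance, and the mixing distribution estimates $P_n$ converge weakly, $m^{\star L}$-almost surely, to $P^\dagger$.
   Context: $\mathsf{Unif}(x\mid 0,u)=u^{-1}1_{[0,u]}(x)$ is the uniform kernel density. Every monotone non-increasing density $m^\star$ on $[0,\infty)$ can be written as $m^\star(x)=\int_0^\infty\mathsf{Unif}(x\mid0,u)\,P^\star(du)$ for some probability measure $P^\star$ on $[0,\infty)$. $\delta_{\{t\}}$ is the Dirac point mass at $t$ and $P^\star|_{\mathbb{U}}$ is $P^\star$ restricted to $\mathbb{U}=[\ell,L]$. The pair $(P^\dagger,m^\dagger)$ is the Kullback--Leibler minimizer of $P\mapsto K(m^{\star L},m_P)$ over probability measures on $\mathbb{U}$, as characterized in the paper. The Kullback--Leibler divergence is $K(f,g)=\int\log\{f(x)/g(x)\}\,f(x)\,dx$. Predictive recursion (PR): given a kernel $k(x\mid u)$, an initial guess $P_0$ (a probability measure on $\mathbb{U}$), weights $w_i\in(0,1)$ and data $X_1,X_2,\ldots$,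 define recursively for $i\ge1$ $$P_i(du)=(1-w_i)\,P_{i-1}(du)+w_i\,\frac{k(X_i\mid u)\,P_{i-1}(du)}{\int_{\mathbb{U}}k(X_i\mid v)\,P_{i-1}(dv)}.$$ "$m^{\star L}$-almost surely" refers to the law of the i.i.d. sequence from $m^{\star L}$.
   Formalization: P^⋆|_U is read as P^⋆ conditioned on [0,L] and restricted to the open interval (ℓ,L), so that P^† has total mass 1; and P_{0,U} is assumed to charge every open subinterval of U that P^⋆ charges, without which weak convergence fails. *)

theory Defs
  imports "HOL-Probability.Probability"
begin

section \<open>Mixtures of uniform densities\<close>

text \<open>For \<open>u = 0\<close> the kernel is identically \<open>0\<close>, since \<open>1 / 0 = 0\<close>. All densities are functions on
  the whole real line that vanish off their support.\<close>

definition unif :: "real \<Rightarrow> real \<Rightarrow> real" where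
  "unif x u = indicator {0..u} x / u"

definition mix :: "real measure \<Rightarrow> real \<Rightarrow> real" where
  "mix P x = (\<integral>u. unif x u \<partial>P)"

text \<open>A probability measure on a Borel set \<open>U\<close> of reals is represented as a Borel probability measure
  on the line that gives full mass to \<open>U\<close>, so that \<open>cdf\<close> and \<open>weak_conv_m\<close> apply to it.\<close>

definition prob_on :: "real set \<Rightarrow> real measure \<Rightarrow> bool" where
  "prob_on U P \<longleftrightarrow> prob_space P \<and> sets P = sets borel \<and> emeasure P U = 1"

text \<open>Monotonicity is only required on \<open>(0, \<infinity>)\<close>: a monotone density may be unbounded at the origin,
  i.e. have the value \<open>\<infinity>\<close> there, and a real-valued function cannot record this. The value at the
  single point \<open>0\<close> is therefore an arbitrary non-negative number.\<close>

definition monotone_density :: "(real \<Rightarrow> real) \<Rightarrow> bool" where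
  "monotone_density m \<longleftrightarrow> m \<in> borel_measurable borel \<and> (\<forall>x. 0 \<le> m x) \<and> (\<forall>x<0. m x = 0) \<and>
     antimono_on {0<..} m \<and> (\<integral>\<^sup>+x. ennreal (m x) \<partial>lborel) = 1"

definition dist_fun :: "(real \<Rightarrow> real) \<Rightarrow> real \<Rightarrow> real" where
  "dist_fun m = cdf (density lborel (\<lambda>x. ennreal (m x)))"

definition renorm :: "(real \<Rightarrow> real) \<Rightarrow> real \<Rightarrow> real \<Rightarrow> real" where
  "renorm m L x = m x * indicator {0..L} x / dist_fun m L"


section \<open>Kullback--Leibler divergence and total variation distance\<close>

text \<open>The divergence is extended-valued: it is the integral of the positive part minus the integral of
  the negative part of \<open>f log (f / g)\<close>, with the conventions \<open>0 log (0 / y) = 0\<close> and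
  \<open>x log (x / 0) = \<infinity>\<close> for \<open>x > 0\<close>. For probability densities the negative part has integral at
  most \<open>1\<close>, so the difference is never of the form \<open>\<infinity> - \<infinity>\<close>.\<close>

definition KL_integrand :: "real \<Rightarrow> real \<Rightarrow> ereal" where
  "KL_integrand a b = (if a = 0 then 0 else if b = 0 then \<infinity> else ereal (a * ln (a / b)))"

definition KL :: "(real \<Rightarrow> real) \<Rightarrow> (real \<Rightarrow> real) \<Rightarrow> ereal" where
  "KL f g = enn2ereal (\<integral>\<^sup>+x. e2ennreal (KL_integrand (f x) (g x)) \<partial>lborel)
          - enn2ereal (\<integral>\<^sup>+x. e2ennreal (- KL_integrand (f x) (g x)) \<partial>lborel)"

definition tv_dist :: "(real \<Rightarrow> real) \<Rightarrow> (real \<Rightarrow> real) \<Rightarrow> real" where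
  "tv_dist f g = (SUP A\<in>sets borel. \<bar>measure (density lborel (\<lambda>x. ennreal (f x))) A
                                   - measure (density lborel (\<lambda>x. ennreal (g x))) A\<bar>)"

lemma KL_eq_integral:
  assumes "integrable lborel (\<lambda>x. f x * ln (f x / g x))"
    and "\<And>x. g x = 0 \<Longrightarrow> f x = 0"
  shows "KL f g = ereal (\<integral>x. f x * ln (f x / g x) \<partial>lborel)"
proof -
  let ?h = "\<lambda>x. f x * ln (f x / g x)"
  have *: "KL_integrand (f x) (g x) = ereal (?h x)" for x
    using assms(2)[of x] by (auto simp: KL_integrand_def zero_ereal_def)
  have a: "(\<integral>\<^sup>+x. ennreal (?h x) \<partial>lborel) < \<infinity>" "(\<integral>\<^sup>+x. ennreal (- ?h x) \<partial>lborel) < \<infinity>"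
    using assms(1) unfolding real_integrable_def by (auto simp: less_top)
  obtain p where p: "0 \<le> p" "(\<integral>\<^sup>+x. ennreal (?h x) \<partial>lborel) = ennreal p"
    using a(1) by (cases "\<integral>\<^sup>+x. ennreal (?h x) \<partial>lborel") auto
  obtain q where q: "0 \<le> q" "(\<integral>\<^sup>+x. ennreal (- ?h x) \<partial>lborel) = ennreal q"
    using a(2) by (cases "\<integral>\<^sup>+x. ennreal (- ?h x) \<partial>lborel") auto
  show ?thesis
    unfolding KL_def real_lebesgue_integral_def[OF assms(1)] * uminus_ereal.simps e2ennreal_ereal
    using p q by simp
qed


section \<open>Predictive recursion\<close>

text \<open>The observations are \<open>x 1, x 2, \<dots>\<close>; neither \<open>x 0\<close> nor \<open>w 0\<close> is used.\<close>

primrec PR :: "(real \<Rightarrow> 'u \<Rightarrow> real) \<Rightarrow> (nat \<Rightarrow> real) \<Rightarrow> 'u measure \<Rightarrow> (nat \<Rightarrow> real) \<Rightarrow> nat \<Rightarrow> 'u measure"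
where
  "PR k w P0 x 0 = P0"
| "PR k w P0 x (Suc n) =
     density (PR k w P0 x n)
       (\<lambda>u. ennreal ((1 - w (Suc n)) +
              w (Suc n) * k (x (Suc n)) u / (\<integral>v. k (x (Suc n)) v \<partial>PR k w P0 x n)))"


section \<open>Sums of measures\<close>

definition add_measure :: "'a measure \<Rightarrow> 'a measure \<Rightarrow> 'a measure" where
  "add_measure M N = measure_of (space M) (sets M) (\<lambda>A. emeasure M A + emeasure N A)"

lemma space_add_measure [simp]: "space (add_measure M N) = space M"
  by (simp add: add_measure_def)

lemma sets_add_measure [simp, measurable_cong]: "sets (add_measure M N) = sets M"
  by (simp add: add_measure_def)

lemma emeasure_add_measure:
  assumes "sets N = sets M" "A \<in> sets M"
  shows "emeasure (add_measure M N) A = emeasure M A + emeasure N A"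
proof (rule emeasure_measure_of_sigma[OF sets.sigma_algebra_axioms, of M "\<lambda>A. emeasure M A + emeasure N A" A,
      folded add_measure_def])
  show "positive (sets M) (\<lambda>A. emeasure M A + emeasure N A)"
    by (simp add: positive_def)
  show "countably_additive (sets M) (\<lambda>A. emeasure M A + emeasure N A)"
    unfolding countably_additive_def
  proof (intro allI impI)
    fix F :: "nat \<Rightarrow> 'a set"
    assume F: "range F \<subseteq> sets M" "disjoint_family F" "\<Union> (range F) \<in> sets M"
    have "(\<Sum>i. emeasure M (F i) + emeasure N (F i)) = (\<Sum>i. emeasure M (F i)) + (\<Sum>i. emeasure N (F i))"
      by (rule suminf_add[symmetric]) auto
    then show "(\<Sum>i. emeasure M (F i) + emeasure N (F i)) = emeasure M (\<Union> (range F)) + emeasure N (\<Union> (range F))"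
      using F assms(1) by (simp add: suminf_emeasure)
  qed
qed (fact assms(2))

definition mix3 :: "real \<Rightarrow> real measure \<Rightarrow> real \<Rightarrow> real measure \<Rightarrow> real \<Rightarrow> real measure \<Rightarrow> real measure" where
  "mix3 a M b N c R =
     add_measure (scale_measure (ennreal a) M)
       (add_measure (scale_measure (ennreal b) N) (scale_measure (ennreal c) R))"

lemma sets_mix3 [simp]: "sets (mix3 a M b N c R) = sets M"
  by (simp add: mix3_def)

lemma emeasure_mix3:
  assumes "sets N = sets M" "sets R = sets M" "A \<in> sets M"
  shows "emeasure (mix3 a M b N c R) A = ennreal a * emeasure M A + ennreal b * emeasure N A + ennreal c * emeasure R A"
  using assms by (simp add: mix3_def emeasure_add_measure add.assoc)


section \<open>The limit\<close>

text \<open>The total mass of the limit has to be \<open>1\<close>, which fixes the meaning of the restriction of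
  \<open>Pstar\<close> in two respects. First, conditioning the density on \<open>[0, L]\<close> replaces \<open>Pstar\<close> by
  \<open>Pstar (\<cdot> | [0, L])\<close>, with weight \<open>Pstar [0, L] / Mstar L\<close>, plus an atom at \<open>L\<close>; it is this
  conditional measure that is restricted. Second, the atoms that \<open>Pstar\<close> may have at \<open>l\<close> and \<open>L\<close>
  are already part of \<open>Pstar [0, l]\<close> and of \<open>L * mstar L\<close>, so the restriction is to the open
  interval. Lemma \<open>restr_closed\<close> shows that this is the restriction to \<open>[l, L]\<close> if there are no such
  atoms, and \<open>prob_on_P_dagger\<close> that the total mass is \<open>1\<close> in all cases.\<close>

definition restr :: "real measure \<Rightarrow> real \<Rightarrow> real \<Rightarrow> real measure" where
  "restr Pstar l L = density (uniform_measure Pstar {0..L}) (indicator {l<..<L})"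

definition P_dagger :: "real measure \<Rightarrow> (real \<Rightarrow> real) \<Rightarrow> real \<Rightarrow> real \<Rightarrow> real measure" where
  "P_dagger Pstar mstar l L =
     mix3 (measure Pstar {0..l} / dist_fun mstar L) (return borel l)
          (measure Pstar {0..L} / dist_fun mstar L) (restr Pstar l L)
          (L * mstar L / dist_fun mstar L) (return borel L)"


lemma sets_P_dagger [simp]: "sets (P_dagger Pstar mstar l L) = sets borel"
  by (simp add: P_dagger_def)

lemma restr_closed:
  assumes "prob_on {0..} Pstar" "emeasure Pstar {l} = 0" "emeasure Pstar {L} = 0"
  shows "restr Pstar l L = density (uniform_measure Pstar {0..L}) (indicator {l..L})"
proof -
  have [measurable_cong, simp]: "sets Pstar = sets borel" using assms by (simp add: prob_on_def)
  have n: "emeasure (uniform_measure Pstar {0..L}) {x} = 0" if "emeasure Pstar {x} = 0" for x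
  proof -
    have "emeasure Pstar ({0..L} \<inter> {x}) \<le> emeasure Pstar {x}"
      by (rule emeasure_mono) auto
    then have z: "emeasure Pstar ({0..L} \<inter> {x}) = 0" unfolding that by (simp only: le_zero_eq)
    have "emeasure (uniform_measure Pstar {0..L}) {x} = emeasure Pstar ({0..L} \<inter> {x}) / emeasure Pstar {0..L}"
      by (rule emeasure_uniform_measure) auto
    also have "\<dots> = 0" by (simp only: z ennreal_zero_divide)
    finally show ?thesis .
  qed
  have "AE u in uniform_measure Pstar {0..L}. u \<noteq> x" if "emeasure Pstar {x} = 0" for x
    by (rule AE_I[of _ _ "{x}"]) (simp_all only: n[OF that], auto)
  from this[OF assms(2)] this[OF assms(3)] show ?thesis
    unfolding restr_def
  proof (intro density_cong)
    assume a: "AE u in uniform_measure Pstar {0..L}. u \<noteq> l" "AE u in uniform_measure Pstar {0..L}. u \<noteq> L"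
    then show "AE u in uniform_measure Pstar {0..L}. (indicator {l<..<L} u :: ennreal) = indicator {l..L} u"
      by eventually_elim (auto split: split_indicator)
  qed auto
qed

lemma emeasure_restr:
  assumes "prob_on {0..} Pstar" "0 < l" "A \<in> sets borel"
  shows "ennreal (measure Pstar {0..L}) * emeasure (restr Pstar l L) A = emeasure Pstar (A \<inter> {l<..<L})"
proof -
  interpret prob_space Pstar using assms by (simp add: prob_on_def)
  have [measurable_cong, simp]: "sets Pstar = sets borel" using assms by (simp add: prob_on_def)
  note [measurable] = assms(3)
  have sub: "{0..L} \<inter> (A \<inter> {l<..<L}) = A \<inter> {l<..<L}" using assms(2) by auto
  have "emeasure (restr Pstar l L) A = emeasure (uniform_measure Pstar {0..L}) (A \<inter> {l<..<L})"
    unfolding restr_def by (subst emeasure_density) (auto simp: nn_integral_indicator[symmetric]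
      simp del: nn_integral_indicator intro!: nn_integral_cong split: split_indicator)
  also have "\<dots> = emeasure Pstar (A \<inter> {l<..<L}) / emeasure Pstar {0..L}"
    by (subst emeasure_uniform_measure) (auto simp: sub)
  finally have e: "emeasure (restr Pstar l L) A = emeasure Pstar (A \<inter> {l<..<L}) / emeasure Pstar {0..L}" .
  show ?thesis
  proof (cases "emeasure Pstar {0..L} = 0")
    case True
    have "emeasure Pstar (A \<inter> {l<..<L}) \<le> emeasure Pstar {0..L}"
      using assms(2) by (intro emeasure_mono) auto
    with True show ?thesis by (simp add: e emeasure_eq_measure)
  next
    case False
    then show ?thesis
      unfolding e emeasure_eq_measure[symmetric]
      using ennreal_mult_divide_eq[OF False, of "emeasure Pstar (A \<inter> {l<..<L})"]
      by (simp add: ennreal_times_divide mult.commute)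
  qed
qed

lemma nn_integral_unif:
  assumes "0 < u" "0 \<le> L"
  shows "(\<integral>\<^sup>+x. ennreal (unif x u) * indicator {..L} x \<partial>lborel) = ennreal (min u L / u)"
proof -
  have "(\<integral>\<^sup>+x. ennreal (unif x u) * indicator {..L} x \<partial>lborel)
      = (\<integral>\<^sup>+x. ennreal (1 / u) * indicator {0..min u L} x \<partial>lborel)"
    by (intro nn_integral_cong) (auto simp: unif_def split: split_indicator)
  also have "\<dots> = ennreal (1 / u) * ennreal (min u L)"
    using assms by (simp add: nn_integral_cmult)
  finally show ?thesis using assms by (simp add: ennreal_mult[symmetric])
qed

lemma dist_fun_eq:
  assumes m: "monotone_density mstar" and P: "prob_on {0..} Pstar"
    and rep: "\<forall>x>0. mstar x = mix Pstar x" and L: "0 < L"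
  shows "dist_fun mstar L = measure Pstar {0..<L} + L * mstar L" "0 < dist_fun mstar L"
proof -
  interpret prob_space Pstar using P by (simp add: prob_on_def)
  have [measurable_cong, simp]: "sets Pstar = sets borel" using P by (simp add: prob_on_def)
  have [measurable]: "mstar \<in> borel_measurable borel" using m by (simp add: monotone_density_def)
  have pos: "0 \<le> mstar x" for x using m by (simp add: monotone_density_def)
  have neg: "x < 0 \<Longrightarrow> mstar x = 0" for x using m by (simp add: monotone_density_def)
  have sp: "space Pstar = UNIV" using sets_eq_imp_space_eq[of Pstar borel] by simp
  have [measurable]: "case_prod unif \<in> borel_measurable (borel \<Otimes>\<^sub>M borel)"
  proof -
    have "case_prod unif = (\<lambda>(x, u). (if 0 \<le> x \<and> x \<le> u then 1 else 0) / u)"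
      by (auto simp: unif_def indicator_def)
    then show ?thesis by simp
  qed
  have meas [measurable]: "(\<lambda>u. unif x u) \<in> borel_measurable borel" for x by measurable
  have upos: "0 \<le> unif x u" for x u by (auto simp: unif_def split: split_indicator)
  have ub: "unif x u \<le> 1 / x" if "0 < x" for x u
    using that by (auto simp: unif_def frac_le split: split_indicator)
  have int: "integrable Pstar (\<lambda>u. unif x u)" if "0 < x" for x
    by (rule integrable_const_bound[of _ "1 / x"]) (use that ub upos in auto)
  have nn: "ennreal (mstar x) = (\<integral>\<^sup>+u. ennreal (unif x u) \<partial>Pstar)" if "0 < x" for x
    using that rep int[OF that] upos by (simp add: mix_def nn_integral_eq_integral)
  have fub: "(\<integral>\<^sup>+x. ennreal (mstar x) * indicator {..T} x \<partial>lborel)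
      = (\<integral>\<^sup>+u. ennreal (min u T / u) * indicator {0<..} u \<partial>Pstar)" if "0 < T" for T
  proof -
    interpret pair_sigma_finite lborel Pstar ..
    have "(\<integral>\<^sup>+x. ennreal (mstar x) * indicator {..T} x \<partial>lborel)
        = (\<integral>\<^sup>+x. (\<integral>\<^sup>+u. ennreal (unif x u) * indicator {..T} x \<partial>Pstar) \<partial>lborel)"
    proof (rule nn_integral_cong_AE, rule AE_I[of _ _ "{0}"])
      show "{x \<in> space lborel. ennreal (mstar x) * indicator {..T} x \<noteq>
              (\<integral>\<^sup>+u. ennreal (unif x u) * indicator {..T} x \<partial>Pstar)} \<subseteq> {0}"
      proof clarsimp
        fix x assume *: "ennreal (mstar x) * indicator {..T} x \<noteq> (\<integral>\<^sup>+u. ennreal (unif x u) * indicator {..T} x \<partial>Pstar)"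
        have "\<not> 0 < x" using * nn[of x] by (auto simp: nn_integral_multc)
        moreover have "\<not> x < 0" using * neg[of x] by (auto simp: unif_def)
        ultimately show "x = 0" by simp
      qed
    qed auto
    also have "\<dots> = (\<integral>\<^sup>+u. (\<integral>\<^sup>+x. ennreal (unif x u) * indicator {..T} x \<partial>lborel) \<partial>Pstar)"
      by (rule Fubini'[symmetric]) measurable
    also have "\<dots> = (\<integral>\<^sup>+u. ennreal (min u T / u) * indicator {0<..} u \<partial>Pstar)"
    proof (rule nn_integral_cong)
      fix u
      show "(\<integral>\<^sup>+x. ennreal (unif x u) * indicator {..T} x \<partial>lborel) = ennreal (min u T / u) * indicator {0<..} u"
      proof (cases "0 < u")
        case True then show ?thesis using that by (simp add: nn_integral_unif)
      next
        case False
        then have "unif x u = 0" for x by (auto simp: unif_def split: split_indicator)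
        then show ?thesis using False by simp
      qed
    qed
    finally show ?thesis .
  qed
  have split: "ennreal (min u L / u) * indicator {0<..} u
      = indicator {0<..<L} u + ennreal L * ennreal (unif L u)" for u
    using L by (auto simp: unif_def ennreal_mult[symmetric] min_def split: split_indicator)
  have le1: "(\<integral>\<^sup>+x. ennreal (mstar x) * indicator {..T} x \<partial>lborel) \<le> emeasure Pstar {0<..}" if "0 < T" for T
  proof -
    have "(\<integral>\<^sup>+u. ennreal (min u T / u) * indicator {0<..} u \<partial>Pstar) \<le> (\<integral>\<^sup>+u. indicator {0<..} u \<partial>Pstar)"
      using that by (intro nn_integral_mono) (auto split: split_indicator)
    then show ?thesis using that by (simp add: fub)
  qed
  have "1 = (\<integral>\<^sup>+x. (SUP n. ennreal (mstar x) * indicator {..real (Suc n)} x) \<partial>lborel)"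
  proof -
    have "(SUP n. ennreal (mstar x) * indicator {..real (Suc n)} x) = ennreal (mstar x)" for x
    proof (rule antisym)
      obtain n where "x \<le> real (Suc n)" using real_arch_simple[of x] by (metis le_SucI of_nat_mono order_trans order_refl)
      then show "ennreal (mstar x) \<le> (SUP n. ennreal (mstar x) * indicator {..real (Suc n)} x)"
        by (intro SUP_upper2[of n]) auto
    qed (auto intro!: SUP_least split: split_indicator)
    then show ?thesis using m by (simp add: monotone_density_def)
  qed
  also have "\<dots> = (SUP n. (\<integral>\<^sup>+x. ennreal (mstar x) * indicator {..real (Suc n)} x \<partial>lborel))"
    by (rule nn_integral_monotone_convergence_SUP)
       (auto simp: incseq_def le_fun_def split: split_indicator)
  also have "\<dots> \<le> emeasure Pstar {0<..}"
    by (rule SUP_least, rule le1) simp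
  finally have one: "prob {0<..} = 1" using prob_le_1[of "{0<..}"] by (simp add: emeasure_eq_measure)
  have "emeasure (density lborel (\<lambda>x. ennreal (mstar x))) {..L}
      = (\<integral>\<^sup>+u. indicator {0<..<L} u + ennreal L * ennreal (unif L u) \<partial>Pstar)"
    by (subst emeasure_density) (auto simp: fub[OF L] split)
  also have "\<dots> = emeasure Pstar {0<..<L} + ennreal L * ennreal (mstar L)"
    by (subst nn_integral_add) (auto simp: nn_integral_cmult nn[OF L])
  also have "\<dots> = ennreal (prob {0<..<L} + L * mstar L)"
    using L pos by (simp add: emeasure_eq_measure ennreal_mult[symmetric])
  finally have E: "dist_fun mstar L = prob {0<..<L} + L * mstar L"
    using L pos measure_nonneg[of Pstar "{0<..<L}"]
    unfolding dist_fun_def cdf_def measure_def[of "density _ _"]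
    by (simp del: ennreal_plus)
  have z: "prob {u. \<not> u > 0} = 0"
    using prob_compl[of "{0<..}"] one by (simp add: sp Compl_eq_Diff_UNIV[symmetric] Collect_neg_eq greaterThan_def)
  have "prob {0..<L} \<le> prob ({0<..<L} \<union> {u. \<not> u > 0})"
    by (intro finite_measure_mono) auto
  also have "\<dots> \<le> prob {0<..<L} + prob {u. \<not> u > 0}"
    by (intro measure_Un_le) auto
  finally have "prob {0..<L} = prob {0<..<L}"
    using z finite_measure_mono[of "{0<..<L}" "{0..<L}"] by (auto simp: subset_eq)
  with E show eq: "dist_fun mstar L = prob {0..<L} + L * mstar L" by simp
  show "0 < dist_fun mstar L"
  proof (rule ccontr)
    assume "\<not> 0 < dist_fun mstar L"
    then have a: "prob {0<..<L} + L * mstar L \<le> 0" using E by simp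
    have "0 \<le> L * mstar L" using L pos[of L] by simp
    with a have "prob {0<..<L} = 0" "L * mstar L = 0"
      using measure_nonneg[of Pstar "{0<..<L}"] by linarith+
    with L have 0: "prob {0<..<L} = 0" "mstar L = 0" by simp_all
    have "AE u in Pstar. unif L u = 0"
      using 0(2) rep L int[OF L] upos by (simp add: mix_def integral_nonneg_eq_0_iff_AE)
    moreover have "AE u in Pstar. u \<notin> {0<..<L}"
      by (rule AE_I[of _ _ "{0<..<L}"]) (auto simp: 0 emeasure_eq_measure)
    moreover have "AE u in Pstar. u > 0"
      by (rule AE_I[of _ _ "{u. \<not> u > 0}"]) (auto simp: z emeasure_eq_measure)
    ultimately have "AE u in Pstar. False"
    proof eventually_elim
      case (elim u)
      then show False using L by (auto simp: unif_def)
    qed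
    then show False by simp
  qed
qed

lemma emeasure_P_dagger:
  assumes "monotone_density mstar" "prob_on {0..} Pstar" "\<forall>x>0. mstar x = mix Pstar x"
    and "0 < l" "l < L" "A \<in> sets borel"
  shows "emeasure (P_dagger Pstar mstar l L) A =
    ennreal ((measure Pstar {0..l} * indicator A l + measure Pstar (A \<inter> {l<..<L}) + L * mstar L * indicator A L)
              / dist_fun mstar L)"
proof -
  interpret prob_space Pstar using assms by (simp add: prob_on_def)
  have s: "sets Pstar = sets borel" using assms by (simp add: prob_on_def)
  have sr: "sets (restr Pstar l L) = sets borel" by (simp add: restr_def s)
  have d: "0 < dist_fun mstar L" using dist_fun_eq(2)[OF assms(1-3)] assms(4,5) by simp
  have pos: "0 \<le> mstar L" using assms(1) by (simp add: monotone_density_def)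
  have "ennreal (prob {0..L} / dist_fun mstar L) * emeasure (restr Pstar l L) A
      = ennreal (1 / dist_fun mstar L) * (ennreal (prob {0..L}) * emeasure (restr Pstar l L) A)"
    using d by (simp add: mult.assoc[symmetric] ennreal_mult[symmetric])
  also have "\<dots> = ennreal (prob (A \<inter> {l<..<L}) / dist_fun mstar L)"
    using d assms by (simp add: emeasure_restr emeasure_eq_measure ennreal_mult[symmetric])
  finally show ?thesis
    using d pos assms(4-6) unfolding P_dagger_def
    by (subst emeasure_mix3)
       (auto simp: sr add_divide_distrib ennreal_plus[symmetric] simp del: ennreal_plus split: split_indicator)
qed

lemma prob_on_P_dagger:
  assumes "monotone_density mstar" "prob_on {0..} Pstar" "\<forall>x>0. mstar x = mix Pstar x"
    and "0 < l" "l < L"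
  shows "prob_on {l..L} (P_dagger Pstar mstar l L)"
proof -
  interpret prob_space Pstar using assms by (simp add: prob_on_def)
  have s: "sets Pstar = sets borel" using assms by (simp add: prob_on_def)
  have d: "0 < dist_fun mstar L" "dist_fun mstar L = prob {0..<L} + L * mstar L"
    using dist_fun_eq[OF assms(1-3), of L] assms(4,5) by simp_all
  have "{0..<L} = {0..l} \<union> {l<..<L}" using assms(4,5) by auto
  then have "prob {0..<L} = prob {0..l} + prob {l<..<L}"
    by (simp add: finite_measure_Union s ivl_disj_int)
  then have *: "emeasure (P_dagger Pstar mstar l L) A = 1" if "A \<in> sets borel" "{l..L} \<subseteq> A" for A
  proof -
    have "A \<inter> {l<..<L} = {l<..<L}" "l \<in> A" "L \<in> A" using that(2) assms(5) by auto
    then show ?thesis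
      using d \<open>prob {0..<L} = _\<close> by (simp add: emeasure_P_dagger[OF assms that(1)])
  qed
  have "space (P_dagger Pstar mstar l L) = UNIV"
    using sets_eq_imp_space_eq[of "P_dagger Pstar mstar l L" borel] by simp
  then show ?thesis unfolding prob_on_def by (auto intro!: prob_spaceI *)
qed

end

theory Submission
  imports Defs
begin

text \<open>Every mixture over \<open>{l..L}\<close> is constant on \<open>{0..l}\<close>, and there \<open>m_dagger\<close> only redistributes the
  mass of \<open>mstarL\<close>; elsewhere the two agree. Replacing the observations by their maximum with \<open>l\<close>
  therefore changes nothing in the recursion and makes the model well specified: the target is
  \<open>m_dagger\<close> itself, and \<open>K_n = KL m_dagger m_n\<close> has to tend to \<open>0\<close>.

  One step of the recursion changes \<open>K_n\<close> by at most a non-positive mean, a centred term and an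
  error \<open>O(n powr (2 * a - 2))\<close>, because the atom at \<open>L\<close> keeps \<open>m_n\<close> above a multiple of
  \<open>n powr - a\<close>. The centred terms are orthogonal and their series converges almost surely, so
  \<open>K_n\<close> converges. Let \<open>r = (\<Sum>j. q j * c j)\<close> with weights \<open>q j\<close> and \<open>c j\<close> below the kernel on a
  set \<open>A j\<close> charged by \<open>P\<^sub>0\<close>. The potential \<open>\<Sum>j. q j * ln (P_n (A j))\<close> is non-positive, but up to
  convergent series it grows at least like \<open>\<Sum>n. w n * (K_n - KL m_dagger r)\<close>; hence
  \<open>lim K_n \<le> KL m_dagger r\<close>. Discretising \<open>P_dagger\<close> on overlapping cells makes \<open>KL m_dagger r\<close>
  as small as we like. Total variation follows from a Hellinger-type bound, and weak
  convergence because test functions integrate against \<open>P\<close> as linear functionals of \<open>mix P\<close>.\<close>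


section \<open>Orthogonal series\<close>

text \<open>The recursion only reweights \<open>P\<^sub>0\<close>, so \<open>P_n\<close> has a
  density with respect to \<open>P\<^sub>0\<close>, whereas \<open>P_dagger\<close> may have atoms
  or singular parts where \<open>P\<^sub>0\<close> has none. The divergence of
  \<open>P_dagger\<close> from \<open>P_n\<close>, the natural potential, can therefore be infinite
  for every \<open>n\<close>. Logarithms of masses of whole sets stay finite; the price is that the
  kernel is replaced on each set by a lower bound, and \<open>KLd r\<close> measures the loss. Two
  arguments have to meet. Monotonicity up to summable terms yields a limit of \<open>K_n\<close> but
  not its value, since a nonnegative mean drift does not exclude a stop above 0. The potential on
  its own controls only the lower limit, because all it says is that a harmonically weighted sum of
  \<open>K_n - KLd r\<close> is bounded above. The way back from \<open>K_n\<close> is a Pythagorean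
  identity: \<open>ln (m_dagger / m_n)\<close> is constant on \<open>{0..l}\<close>, hence has the
  same mean under \<open>mstarL\<close> and under \<open>m_dagger\<close>, and
  \<open>KL mstarL m_n\<close> is \<open>KL mstarL m_dagger\<close> plus \<open>K_n\<close>.\<close>

lemma ln_one_plus_ge:
  fixes t :: real
  assumes "- (1 / 2) \<le> t"
  shows "t - 2 * t\<^sup>2 \<le> ln (1 + t)"
proof -
  consider "t < 0" | "0 \<le> t" "t \<le> 1" | "1 < t" by linarith
  then show ?thesis
  proof cases
    case 1
    then show ?thesis using ln_one_minus_pos_lower_bound[of "- t"] assms by simp
  next
    case 2
    have "t - 2 * t\<^sup>2 \<le> t - t\<^sup>2" by simp
    with ln_one_plus_pos_lower_bound[OF 2] show ?thesis by linarith
  next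
    case 3
    then have "t * 1 \<le> t * t" by (intro mult_left_mono) auto
    moreover have "0 \<le> ln (1 + t)" using 3 by simp
    ultimately show ?thesis using 3 unfolding power2_eq_square by linarith
  qed
qed

text \<open>Young's inequality with second factor 1, that is, Bernoulli's inequality for exponents
  at most 1. At \<open>t = (n + 1) / (n + 2)\<close> it compares the shrinking factor of one update
  with the ratio of consecutive powers.\<close>

lemma powr_le_affine:
  fixes t a :: real
  assumes "0 \<le> a" "a \<le> 1" "0 < t"
  shows "t powr a \<le> 1 + a * (t - 1)"
proof -
  have "t powr a * 1 powr (1 - a) \<le> a * t + (1 - a) * 1"
    using assms by (intro Youngs_inequality_0) auto
  then show ?thesis by (simp add: algebra_simps)
qed

lemma summable_powr_Suc:
  assumes "s < -1"
  shows "summable (\<lambda>n. real (n + 1) powr s)"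
  using assms summable_Suc_iff[of "\<lambda>n. real n powr s"] by (simp add: summable_real_powr_iff)

text \<open>Subtracting the partial sums of \<open>D + c\<close> leaves a decreasing sequence,
  bounded below because convergent partial sums are bounded. This is a pathwise substitute for
  almost-supermartingale convergence: the terms may have any sign, as long as their series
  converges.\<close>

lemma almost_decreasing_convergent:
  fixes K D c :: "nat \<Rightarrow> real"
  assumes "\<And>n. K (Suc n) \<le> K n + D n + c n" "\<And>n. 0 \<le> K n" "summable D" "summable c"
  shows "convergent K"
proof -
  define S where "S n = (\<Sum>i<n. D i + c i)" for n
  have "summable (\<lambda>i. D i + c i)" using assms by (intro summable_add)
  then have S: "convergent S" unfolding S_def by (simp add: summable_iff_convergent)
  then obtain b where b: "\<And>n. \<bar>S n\<bar> \<le> b" using convergent_imp_Bseq[OF S] by (auto simp: Bseq_def)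
  have "decseq (\<lambda>n. K n - S n)"
  proof (rule decseq_SucI)
    fix n show "K (Suc n) - S (Suc n) \<le> K n - S n" using assms(1)[of n] by (simp add: S_def)
  qed
  moreover have "- b \<le> K n - S n" for n using assms(2)[of n] b[of n] by linarith
  ultimately obtain z where "(\<lambda>n. K n - S n) \<longlonglongrightarrow> z" using decseq_convergent by blast
  then have "convergent (\<lambda>n. K n - S n)" by (rule convergentI)
  from convergent_add[OF this S] show ?thesis by simp
qed

lemma (in prob_space) orthogonal_sum_square:
  fixes D :: "nat \<Rightarrow> 'a \<Rightarrow> real"
  assumes [measurable]: "\<And>i. D i \<in> borel_measurable M"
    and bd: "\<And>i \<omega>. \<bar>D i \<omega>\<bar> \<le> B i"
    and orth: "\<And>i j. i < j \<Longrightarrow> expectation (\<lambda>\<omega>. D i \<omega> * D j \<omega>) = 0"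
    and F: "finite F"
  shows "expectation (\<lambda>\<omega>. (\<Sum>i\<in>F. D i \<omega>)\<^sup>2) \<le> (\<Sum>i\<in>F. (B i)\<^sup>2)"
proof -
  have B0: "0 \<le> B i" for i using bd[of i] by (meson abs_ge_zero order_trans)
  have int: "integrable M (\<lambda>\<omega>. D i \<omega> * D j \<omega>)" for i j
    by (rule integrable_const_bound[of _ "B i * B j"])
       (auto simp: abs_mult intro!: AE_I2 mult_mono bd B0)
  have *: "expectation (\<lambda>\<omega>. D i \<omega> * D j \<omega>) \<le> (if j = i then (B i)\<^sup>2 else 0)" for i j
  proof -
    consider "i < j" | "j < i" | "i = j" by linarith
    then show ?thesis
    proof cases
      case 2
      then show ?thesis using orth[of j i] by (simp add: mult.commute)
    next
      case 3
      have "expectation (\<lambda>\<omega>. D i \<omega> * D i \<omega>) \<le> expectation (\<lambda>\<omega>. (B i)\<^sup>2)"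
        using bd[of i]
        by (intro integral_mono int integrable_const)
           (auto simp: power2_eq_square[symmetric] abs_le_square_iff[symmetric] B0)
      then show ?thesis using 3 by (simp add: prob_space)
    qed (simp add: orth)
  qed
  have "expectation (\<lambda>\<omega>. (\<Sum>i\<in>F. D i \<omega>)\<^sup>2) = (\<Sum>i\<in>F. \<Sum>j\<in>F. expectation (\<lambda>\<omega>. D i \<omega> * D j \<omega>))"
    by (simp add: power2_eq_square sum_product int integrable_sum)
  also have "\<dots> \<le> (\<Sum>i\<in>F. \<Sum>j\<in>F. if j = i then (B i)\<^sup>2 else 0)"
    by (intro sum_mono *)
  finally show ?thesis using F by simp
qed

text \<open>The terms are so small that no maximal inequality is needed: the partial sums converge along
  the squares, and between two consecutive squares they move by \<open>O(j powr (2 * a - 1))\<close>.\<close>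

lemma (in prob_space) orthogonal_series_summable:
  fixes D :: "nat \<Rightarrow> 'a \<Rightarrow> real"
  assumes [measurable]: "\<And>i. D i \<in> borel_measurable M"
    and bd: "\<And>i \<omega>. \<bar>D i \<omega>\<bar> \<le> C * real (i + 1) powr (a - 1)"
    and orth: "\<And>i j. i < j \<Longrightarrow> expectation (\<lambda>\<omega>. D i \<omega> * D j \<omega>) = 0"
    and a: "0 < a" "a < 1 / 4"
  shows "AE \<omega> in M. summable (\<lambda>i. D i \<omega>)"
proof -
  define S where "S n \<omega> = (\<Sum>i<n. D i \<omega>)" for n \<omega>
  \<comment> \<open>A block has \<open>2 * j + 1\<close> terms, at most \<open>3 * j\<close> once
    \<open>j \<ge> 1\<close>, so its mean square is of order \<open>j\<close> times
    \<open>j powr (4 * a - 4)\<close>.\<close>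
  define blk where "blk j = {j\<^sup>2..<(Suc j)\<^sup>2}" for j :: nat
  define \<Delta> where "\<Delta> j \<omega> = (\<Sum>i\<in>blk j. D i \<omega>)" for j \<omega>
  have C0: "0 \<le> C" using bd[of 0 undefined] by simp
  have [measurable]: "S n \<in> borel_measurable M" "\<Delta> n \<in> borel_measurable M" for n
    unfolding S_def \<Delta>_def by measurable
  have cardblk: "card (blk j) \<le> 3 * j" if "1 \<le> j" for j
    using that by (simp add: blk_def power2_eq_square)
  have small: "real (i + 1) powr (a - 1) \<le> real j powr (2 * (a - 1))" if "1 \<le> j" "j\<^sup>2 \<le> i" for i j
  proof -
    have "real (i + 1) powr (a - 1) \<le> real (j\<^sup>2) powr (a - 1)"
    proof (rule powr_mono2')
      have "real (j\<^sup>2) \<le> real i" using that by (simp only: of_nat_le_iff)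
      then show "real (j\<^sup>2) \<le> real (i + 1)" unfolding of_nat_add by linarith
    qed (use that a in auto)
    also have "real (j\<^sup>2) = real j powr 2" using that by (simp add: powr_numeral)
    also have "(real j powr 2) powr (a - 1) = real j powr (2 * (a - 1))" by (rule powr_powr)
    finally show ?thesis .
  qed
  have sq: "expectation (\<lambda>\<omega>. (\<Delta> j \<omega>)\<^sup>2) \<le> 3 * C\<^sup>2 * real j powr (4 * a - 3)" if j: "1 \<le> j" for j
  proof -
    have "expectation (\<lambda>\<omega>. (\<Delta> j \<omega>)\<^sup>2) \<le> (\<Sum>i\<in>blk j. (C * real (i + 1) powr (a - 1))\<^sup>2)"
      unfolding \<Delta>_def by (rule orthogonal_sum_square) (auto simp: blk_def intro!: bd[simplified] orth)
    also have "\<dots> \<le> (\<Sum>i\<in>blk j. (C * real j powr (2 * (a - 1)))\<^sup>2)"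
      using C0 j by (intro sum_mono power_mono mult_left_mono small) (auto simp: blk_def)
    also have "\<dots> = real (card (blk j)) * (C * real j powr (2 * (a - 1)))\<^sup>2"
      by simp
    also have "\<dots> \<le> real (3 * j) * (C * real j powr (2 * (a - 1)))\<^sup>2"
      using cardblk[OF j] by (intro mult_right_mono) (auto simp only: of_nat_le_iff zero_le_power2)
    also have "\<dots> = 3 * C\<^sup>2 * (real j powr 1 * (real j powr (2 * (a - 1)) * real j powr (2 * (a - 1))))"
      using j by (simp add: power2_eq_square)
    also have "real j powr 1 * (real j powr (2 * (a - 1)) * real j powr (2 * (a - 1))) = real j powr (4 * a - 3)"
      by (simp only: powr_add[symmetric]) (simp add: algebra_simps)
    finally show ?thesis .
  qed
  \<comment> \<open>The square root of \<open>j powr (4 * a - 3)\<close>, hence the order of the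
    root mean square of \<open>\<Delta> j\<close>. With this choice the bound by
    \<open>\<Delta>\<^sup>2 / (2 * e) + e / 2\<close> turns second moments into first moments of the
    same order, and summability, \<open>2 * a - 3 / 2 < -1\<close>, is the condition
    \<open>a < 1 / 4\<close>.\<close>
  define e where "e j = real j powr (2 * a - 3 / 2)" for j
  have bdS: "\<bar>\<Delta> j \<omega>\<bar> \<le> (\<Sum>i\<in>blk j. C * real (i + 1) powr (a - 1))" for j \<omega>
    unfolding \<Delta>_def by (rule order_trans[OF sum_abs]) (intro sum_mono bd)
  have intD: "integrable M (\<lambda>\<omega>. \<bar>\<Delta> j \<omega>\<bar>)" for j
    by (rule integrable_const_bound) (auto intro!: AE_I2 bdS)
  have intD2: "integrable M (\<lambda>\<omega>. (\<Delta> j \<omega>)\<^sup>2)" for j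
    by (rule integrable_const_bound[of _ "(\<Sum>i\<in>blk j. C * real (i + 1) powr (a - 1))\<^sup>2"])
       (auto intro!: AE_I2 simp: abs_le_square_iff[symmetric] intro: order_trans[OF bdS] abs_ge_self)
  have abs1: "expectation (\<lambda>\<omega>. \<bar>\<Delta> j \<omega>\<bar>) \<le> (3 * C\<^sup>2 + 1) / 2 * e j" if j: "1 \<le> j" for j
  proof -
    have e0: "0 < e j" using j by (simp add: e_def)
    have "\<bar>\<Delta> j \<omega>\<bar> \<le> (\<Delta> j \<omega>)\<^sup>2 * (1 / (2 * e j)) + e j / 2" for \<omega>
    proof -
      have "0 \<le> (\<bar>\<Delta> j \<omega>\<bar> - e j)\<^sup>2" by simp
      then have "\<bar>\<Delta> j \<omega>\<bar> * (2 * e j) \<le> (\<Delta> j \<omega>)\<^sup>2 + (e j)\<^sup>2"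
        by (simp add: power2_eq_square algebra_simps)
      then show ?thesis using e0 by (simp add: field_simps power2_eq_square)
    qed
    then have "expectation (\<lambda>\<omega>. \<bar>\<Delta> j \<omega>\<bar>) \<le> expectation (\<lambda>\<omega>. (\<Delta> j \<omega>)\<^sup>2 * (1 / (2 * e j)) + e j / 2)"
      using intD intD2 by (intro integral_mono Bochner_Integration.integrable_add integrable_mult_left) auto
    also have "\<dots> = expectation (\<lambda>\<omega>. (\<Delta> j \<omega>)\<^sup>2) * (1 / (2 * e j)) + e j / 2"
      using intD2 by (simp add: prob_space)
    also have "\<dots> \<le> 3 * C\<^sup>2 * real j powr (4 * a - 3) * (1 / (2 * e j)) + e j / 2"
      using e0 by (intro add_right_mono mult_right_mono sq j) auto
    also have "real j powr (4 * a - 3) = e j * e j"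
      unfolding e_def by (simp add: powr_add[symmetric])
    finally show ?thesis using e0 by (simp add: field_simps)
  qed
  have "(\<integral>\<^sup>+\<omega>. (\<Sum>j. ennreal \<bar>\<Delta> (Suc j) \<omega>\<bar>) \<partial>M) = (\<Sum>j. \<integral>\<^sup>+\<omega>. ennreal \<bar>\<Delta> (Suc j) \<omega>\<bar> \<partial>M)"
    by (rule nn_integral_suminf) measurable
  also have "\<dots> = (\<Sum>j. ennreal (expectation (\<lambda>\<omega>. \<bar>\<Delta> (Suc j) \<omega>\<bar>)))"
    using intD by (simp add: nn_integral_eq_integral)
  also have "\<dots> \<le> (\<Sum>j. ennreal ((3 * C\<^sup>2 + 1) / 2 * e (Suc j)))"
    by (intro suminf_le ennreal_leI abs1) auto
  also have "\<dots> < \<infinity>"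
  proof -
    have "summable (\<lambda>j. (3 * C\<^sup>2 + 1) / 2 * e (Suc j))"
      using summable_powr_Suc[of "2 * a - 3 / 2"] a unfolding e_def by (intro summable_mult) auto
    then have "(\<Sum>j. ennreal ((3 * C\<^sup>2 + 1) / 2 * e (Suc j))) \<noteq> top"
      by (intro ennreal_suminf_neq_top) (auto simp: e_def)
    then show ?thesis by (simp add: less_top)
  qed
  finally have "AE \<omega> in M. (\<Sum>j. ennreal \<bar>\<Delta> (Suc j) \<omega>\<bar>) \<noteq> \<infinity>"
    by (intro nn_integral_PInf_AE) auto
  then show ?thesis
  proof eventually_elim
    case (elim \<omega>)
    then have "summable (\<lambda>j. \<bar>\<Delta> (Suc j) \<omega>\<bar>)" by (intro summable_suminf_not_top) auto
    then have "summable (\<lambda>j. \<Delta> (Suc j) \<omega>)" by (rule summable_rabs_cancel)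
    then have "summable (\<lambda>j. \<Delta> j \<omega>)" using summable_Suc_iff by blast
    moreover have Ssq: "(\<Sum>j<n. \<Delta> j \<omega>) = S (n\<^sup>2) \<omega>" for n
    proof (induction n)
      case (Suc n)
      have "n\<^sup>2 \<le> (Suc n)\<^sup>2" by (rule power_mono) auto
      then have "{..<(Suc n)\<^sup>2} = {..<n\<^sup>2} \<union> blk n" unfolding blk_def by (simp add: lessThan_atLeast0 ivl_disj_un)
      moreover have "{..<n\<^sup>2} \<inter> blk n = {}" by (auto simp: blk_def)
      ultimately have "S ((Suc n)\<^sup>2) \<omega> = S (n\<^sup>2) \<omega> + \<Delta> n \<omega>"
        unfolding S_def \<Delta>_def by (simp add: sum.union_disjoint blk_def del: power_Suc)
      then show ?case using Suc by simp
    qed (simp add: S_def)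
    ultimately obtain s where s: "(\<lambda>n. S (n\<^sup>2) \<omega>) \<longlonglongrightarrow> s"
      by (auto simp: summable_def sums_def)
    define q where "q n = nat \<lfloor>sqrt (real n)\<rfloor>" for n
    have q1: "(q n)\<^sup>2 \<le> n" "n < (Suc (q n))\<^sup>2" for n
    proof -
      have "real (q n) \<le> sqrt (real n)" unfolding q_def by simp
      then have "(real (q n))\<^sup>2 \<le> (sqrt (real n))\<^sup>2" by (intro power_mono) auto
      then have "real ((q n)\<^sup>2) \<le> real n" by simp
      then show "(q n)\<^sup>2 \<le> n" by (simp only: of_nat_le_iff)
      have "sqrt (real n) < real (Suc (q n))" unfolding q_def using real_sqrt_ge_zero[of "real n"] by linarith
      then have "(sqrt (real n))\<^sup>2 < (real (Suc (q n)))\<^sup>2" by (intro power_strict_mono) auto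
      then have "real n < real ((Suc (q n))\<^sup>2)" by simp
      then show "n < (Suc (q n))\<^sup>2" by (simp only: of_nat_less_iff)
    qed
    have qlim: "filterlim q at_top sequentially"
      unfolding filterlim_at_top
    proof
      fix Z
      show "\<forall>\<^sub>F n in sequentially. Z \<le> q n"
        using eventually_ge_at_top[of "Z\<^sup>2"]
      proof eventually_elim
        case (elim n)
        then have "Z\<^sup>2 < (Suc (q n))\<^sup>2" using q1(2)[of n] by linarith
        then show ?case using power2_less_imp_less[of Z "Suc (q n)"] by simp
      qed
    qed
    have dist: "\<bar>S n \<omega> - S ((q n)\<^sup>2) \<omega>\<bar> \<le> 3 * C * real (q n) powr (2 * a - 1)" if n: "1 \<le> q n" for n
    proof -
      have "{..<n} = {..<(q n)\<^sup>2} \<union> {(q n)\<^sup>2..<n}" using q1(1)[of n] by (simp add: lessThan_atLeast0 ivl_disj_un)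
      then have "S n \<omega> - S ((q n)\<^sup>2) \<omega> = (\<Sum>i\<in>{(q n)\<^sup>2..<n}. D i \<omega>)"
        unfolding S_def by (simp add: sum.union_disjoint ivl_disj_int)
      also have "\<bar>\<dots>\<bar> \<le> (\<Sum>i\<in>{(q n)\<^sup>2..<n}. C * real (q n) powr (2 * (a - 1)))"
      proof (rule order_trans[OF sum_abs], rule sum_mono)
        fix i assume i: "i \<in> {(q n)\<^sup>2..<n}"
        show "\<bar>D i \<omega>\<bar> \<le> C * real (q n) powr (2 * (a - 1))"
          by (rule order_trans[OF bd]) (use i n C0 in \<open>auto intro!: mult_left_mono small[simplified]\<close>)
      qed
      also have "\<dots> = real (n - (q n)\<^sup>2) * (C * real (q n) powr (2 * (a - 1)))" by simp
      also have "\<dots> \<le> real (3 * q n) * (C * real (q n) powr (2 * (a - 1)))"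
      proof (intro mult_right_mono)
        have "n - (q n)\<^sup>2 \<le> 3 * q n" using q1(2)[of n] n by (simp add: power2_eq_square)
        then show "real (n - (q n)\<^sup>2) \<le> real (3 * q n)" by (simp only: of_nat_le_iff)
      qed (use C0 in auto)
      also have "\<dots> = 3 * C * (real (q n) powr 1 * real (q n) powr (2 * (a - 1)))" by simp
      also have "real (q n) powr 1 * real (q n) powr (2 * (a - 1)) = real (q n) powr (2 * a - 1)"
        by (simp only: powr_add[symmetric]) (simp add: algebra_simps)
      finally show ?thesis .
    qed
    have gap: "(\<lambda>n. S n \<omega> - S ((q n)\<^sup>2) \<omega>) \<longlonglongrightarrow> 0"
    proof (rule Lim_null_comparison)
      show "\<forall>\<^sub>F n in sequentially. norm (S n \<omega> - S ((q n)\<^sup>2) \<omega>) \<le> 3 * C * real (q n) powr (2 * a - 1)"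
        using filterlim_at_top[THEN iffD1, OF qlim, rule_format, of 1]
        by eventually_elim (simp add: dist)
      have "(\<lambda>n. real (q n) powr (2 * a - 1)) \<longlonglongrightarrow> 0"
        using a by (intro tendsto_neg_powr filterlim_compose[OF filterlim_real_sequentially qlim]) auto
      from tendsto_mult_right_zero[OF this, of "3 * C"]
      show "(\<lambda>n. 3 * C * real (q n) powr (2 * a - 1)) \<longlonglongrightarrow> 0" by simp
    qed
    have "(\<lambda>n. S n \<omega>) \<longlonglongrightarrow> s"
      using tendsto_add[OF gap filterlim_compose[OF s qlim]] by simp
    then show ?case by (auto simp: S_def summable_def sums_def)
  qed
qed


section \<open>One step of the recursion\<close>

text \<open>Both are \<open>ln y \<le> y - 1\<close>, at \<open>t / s\<close> and at
  \<open>s / t\<close>. The first controls negative parts and makes divergences nonnegative; the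
  second bounds the integrand above when \<open>t\<close> stays away from 0.\<close>

lemma gibbs_pointwise:
  fixes s t :: real
  assumes "0 \<le> s" "0 < t"
  shows "s - t \<le> s * ln (s / t)" "s * ln (s / t) \<le> s * (s / t - 1)"
proof -
  show "s - t \<le> s * ln (s / t)"
  proof (cases "s = 0")
    case False
    then have "ln (t / s) \<le> t / s - 1" using assms by (intro ln_le_minus_one) auto
    then have "1 - t / s \<le> ln (s / t)" using False assms by (simp add: ln_div)
    then have "s * (1 - t / s) \<le> s * ln (s / t)" using assms by (intro mult_left_mono) auto
    then show ?thesis using False by (simp add: algebra_simps)
  qed (use assms in auto)
  show "s * ln (s / t) \<le> s * (s / t - 1)"
    using assms by (cases "s = 0") (auto intro!: mult_left_mono ln_le_minus_one)
qed

lemma Fubini_bounded: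
  fixes f :: "'a \<Rightarrow> 'b \<Rightarrow> real"
  assumes "finite_measure A" "finite_measure B"
    and [measurable]: "case_prod f \<in> borel_measurable (A \<Otimes>\<^sub>M B)"
    and bd: "\<And>x y. \<bar>f x y\<bar> \<le> C"
  shows "(\<integral>x. (\<integral>y. f x y \<partial>B) \<partial>A) = (\<integral>y. (\<integral>x. f x y \<partial>A) \<partial>B)"
proof -
  interpret A: finite_measure A by fact
  interpret B: finite_measure B by fact
  interpret pair_sigma_finite A B ..
  interpret P: finite_measure "A \<Otimes>\<^sub>M B" by (rule finite_measure_pair_measure) fact+
  show ?thesis
    by (rule Fubini_integral[symmetric], rule P.integrable_const_bound[of _ C]) (auto simp: bd)
qed

text \<open>What the argument takes from the model: a bounded kernel of densities with respect to a
  finite measure, and one point \<open>u\<^sub>0\<close> charged by \<open>P\<^sub>0\<close> at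
  which the kernel is bounded below uniformly in \<open>x\<close>. The target \<open>md\<close> is
  any bounded density; that mixtures come close to it enters only as the hypothesis of
  \<open>AE_KLd_tendsto_0\<close>. All bounds hold on the whole line, which avoids almost-everywhere
  side conditions.\<close>

locale pr_kernel =
  fixes k :: "real \<Rightarrow> real \<Rightarrow> real" and lam P\<^sub>0 :: "real measure" and md :: "real \<Rightarrow> real"
    and \<kappa> \<eta> u\<^sub>0 :: real
  assumes k_meas: "case_prod k \<in> borel_measurable (borel \<Otimes>\<^sub>M borel)"
    and k_nonneg: "0 \<le> k x u" and k_le: "k x u \<le> \<kappa>"
    and lam: "finite_measure lam" "sets lam = sets borel"
    and k_norm: "(\<integral>x. k x u \<partial>lam) = 1"
    and P0: "prob_space P\<^sub>0" "sets P\<^sub>0 = sets borel"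
    and atom: "0 < measure P\<^sub>0 {u\<^sub>0}" "0 < \<eta>" "\<eta> \<le> k x u\<^sub>0"
    and md_meas: "md \<in> borel_measurable borel"
    and md_nonneg: "0 \<le> md x" and md_le: "md x \<le> \<kappa>"
    and md_norm: "(\<integral>x. md x \<partial>lam) = 1"
begin

sublocale lam: finite_measure lam by (rule lam)
sublocale P0: prob_space P\<^sub>0 by (rule P0)

lemma sets_lam [measurable_cong, simp]: "sets lam = sets borel" by (rule lam)
lemma sets_P0 [measurable_cong, simp]: "sets P\<^sub>0 = sets borel" by (rule P0)
lemma space_P0 [simp]: "space P\<^sub>0 = UNIV" using sets_eq_imp_space_eq[OF P0(2)] by simp

lemma k_measurable [measurable (raw)]:
  "f \<in> borel_measurable N \<Longrightarrow> g \<in> borel_measurable N \<Longrightarrow> (\<lambda>x. k (f x) (g x)) \<in> borel_measurable N"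
  using measurable_compose[OF measurable_Pair k_meas, of f N g] by simp

declare md_meas [measurable]

lemma kappa_pos: "0 < \<kappa>"
  using atom(2) atom(3)[of 0] k_le[of 0 u\<^sub>0] by linarith

lemma integrable_lam: "f \<in> borel_measurable borel \<Longrightarrow> (\<And>x. \<bar>f x\<bar> \<le> B) \<Longrightarrow> integrable lam f"
  for f :: "real \<Rightarrow> real" by (rule lam.integrable_const_bound[of _ B]) auto

lemma integrable_md: "integrable lam md"
  by (rule integrable_lam[of _ \<kappa>]) (auto simp: md_nonneg md_le)

text \<open>A mixing distribution is represented by its density \<open>d\<close> with respect to
  \<open>P\<^sub>0\<close>; the recursion never leaves this class.\<close>

definition mixt :: "(real \<Rightarrow> real) \<Rightarrow> real \<Rightarrow> real" where
  "mixt d x = (\<integral>u. k x u * d u \<partial>P\<^sub>0)"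

definition step :: "real \<Rightarrow> real \<Rightarrow> (real \<Rightarrow> real) \<Rightarrow> real \<Rightarrow> real" where
  "step v z d u = d u * (1 - v + v * k z u / mixt d z)"

definition ratio :: "(real \<Rightarrow> real) \<Rightarrow> real \<Rightarrow> real \<Rightarrow> real" where
  "ratio d z x = (\<integral>u. k x u * k z u * d u \<partial>P\<^sub>0) / (mixt d x * mixt d z)"

text \<open>Minus the derivative at \<open>v = 0\<close> of \<open>KLd (mixt (step v z d))\<close>,
  as \<open>mixt_step\<close> shows.\<close>

definition drift :: "(real \<Rightarrow> real) \<Rightarrow> real \<Rightarrow> real" where
  "drift d z = (\<integral>x. md x * ratio d z x \<partial>lam) - 1"

definition KLd :: "(real \<Rightarrow> real) \<Rightarrow> real" where
  "KLd g = (\<integral>x. md x * ln (md x / g x) \<partial>lam)"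

definition mass :: "real set \<Rightarrow> (real \<Rightarrow> real) \<Rightarrow> real" where
  "mass A d = (\<integral>u. indicator A u * d u \<partial>P\<^sub>0)"

definition low :: "real \<Rightarrow> real" where
  "low b = \<eta> * measure P\<^sub>0 {u\<^sub>0} * b"

text \<open>The lower bound \<open>b\<close> is tracked because \<open>low b\<close>, the
  contribution of the atom \<open>u\<^sub>0\<close> alone, bounds the mixture from below. The upper
  bound serves integrability and Fubini, so its size is not recorded.\<close>

definition dens :: "real \<Rightarrow> (real \<Rightarrow> real) \<Rightarrow> bool" where
  "dens b d \<longleftrightarrow> d \<in> borel_measurable borel \<and> 0 < b \<and> (\<forall>u. b \<le> d u) \<and> (\<exists>B. \<forall>u. d u \<le> B) \<and>
     (\<integral>u. d u \<partial>P\<^sub>0) = 1"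

section \<open>Bounds for a single mixing density and its update\<close>

context
  fixes b d assumes d: "dens b d"
begin

lemma d_meas [measurable]: "d \<in> borel_measurable borel" using d by (simp add: dens_def)
lemma d_ge: "b \<le> d u" and b_pos: "0 < b" and d_norm: "(\<integral>u. d u \<partial>P\<^sub>0) = 1" using d by (simp_all add: dens_def)
lemma d_nonneg: "0 \<le> d u" using d_ge[of u] b_pos by linarith

lemma integrable_d: "integrable P\<^sub>0 d"
  using d_norm not_integrable_integral_eq[of P\<^sub>0 d] by auto

lemma d_bounded: "\<exists>B. \<forall>u. d u \<le> B" using d by (simp add: dens_def)

lemma low_pos: "0 < low b"
  using atom b_pos by (simp add: low_def)

lemma integrable_mult_d:
  assumes [measurable]: "f \<in> borel_measurable borel" and "\<And>u. \<bar>f u\<bar> \<le> C"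
  shows "integrable P\<^sub>0 (\<lambda>u. f u * d u)"
  by (rule Bochner_Integration.integrable_bound[OF integrable_mult_right[OF integrable_d, of C]])
     (auto simp: abs_mult d_nonneg intro!: mult_mono order_trans[OF assms(2)])

lemma integrable_kd: "integrable P\<^sub>0 (\<lambda>u. k x u * d u)"
  by (rule integrable_mult_d[of _ \<kappa>]) (auto simp: k_nonneg k_le)

lemma integrable_kkd: "integrable P\<^sub>0 (\<lambda>u. k x u * k z u * d u)"
  by (rule integrable_mult_d[of _ "\<kappa> * \<kappa>"])
     (auto simp: abs_mult k_nonneg k_le kappa_pos less_imp_le intro!: mult_mono)

lemma mixt_ge: "low b \<le> mixt d x"
proof -
  have "low b = (\<integral>u. (\<eta> * b) * indicator {u\<^sub>0} u \<partial>P\<^sub>0)" by (simp add: low_def)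
  also have "\<dots> \<le> mixt d x"
    unfolding mixt_def
  proof (rule integral_mono[OF _ integrable_kd])
    show "\<eta> * b * indicator {u\<^sub>0} u \<le> k x u * d u" for u
      using atom(2,3) d_ge[of u] b_pos k_nonneg[of x u] d_nonneg[of u]
      by (auto simp: indicator_def intro!: mult_mono)
  qed (auto intro!: integrable_mult_right P0.integrable_const_bound[of _ 1])
  finally show ?thesis .
qed

lemma mixt_pos: "0 < mixt d x" using mixt_ge[of x] low_pos by linarith

lemma mixt_le: "mixt d x \<le> \<kappa>"
proof -
  have "mixt d x \<le> (\<integral>u. \<kappa> * d u \<partial>P\<^sub>0)" unfolding mixt_def
    by (intro integral_mono integrable_kd integrable_mult_right integrable_d mult_right_mono k_le d_nonneg)
  then show ?thesis using d_norm by simp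
qed

lemma mixt_meas [measurable]: "mixt d \<in> borel_measurable borel"
  unfolding mixt_def[abs_def] by measurable

lemma ratio_nonneg: "0 \<le> ratio d z x"
  unfolding ratio_def using mixt_pos[of x] mixt_pos[of z]
  by (intro divide_nonneg_pos Bochner_Integration.integral_nonneg mult_nonneg_nonneg k_nonneg d_nonneg) auto

text \<open>Only \<open>k x u\<close> is bounded by \<open>\<kappa>\<close>, so that
  \<open>mixt d z\<close> cancels. One factor \<open>1 / low b\<close> remains instead of two, which
  keeps the ratio at order \<open>n powr a\<close> along the recursion.\<close>

lemma ratio_le: "ratio d z x \<le> \<kappa> / low b"
proof -
  have "(\<integral>u. k x u * k z u * d u \<partial>P\<^sub>0) \<le> (\<integral>u. \<kappa> * (k z u * d u) \<partial>P\<^sub>0)"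
    using integrable_kd integrable_kkd
    by (intro integral_mono) (auto simp: mult.assoc intro!: mult_right_mono k_le mult_nonneg_nonneg k_nonneg d_nonneg)
  also have "\<dots> = \<kappa> * mixt d z" by (simp add: mixt_def)
  finally have "ratio d z x \<le> \<kappa> * mixt d z / (mixt d x * mixt d z)"
    unfolding ratio_def using mixt_pos[of x] mixt_pos[of z] by (intro divide_right_mono) auto
  also have "\<dots> = \<kappa> / mixt d x" using mixt_pos[of z] by simp
  also have "\<dots> \<le> \<kappa> / low b"
    using mixt_ge[of x] mixt_pos[of x] low_pos kappa_pos by (intro divide_left_mono) auto
  finally show ?thesis .
qed

lemma ratio_meas [measurable]: "case_prod (ratio d) \<in> borel_measurable (borel \<Otimes>\<^sub>M borel)"
proof -
  have [measurable]: "(\<lambda>x. mixt d (fst x)) \<in> borel_measurable (borel \<Otimes>\<^sub>M borel)"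
    "(\<lambda>x. mixt d (snd x)) \<in> borel_measurable (borel \<Otimes>\<^sub>M borel)"
    using measurable_compose[OF measurable_fst mixt_meas] measurable_compose[OF measurable_snd mixt_meas] by auto
  show ?thesis unfolding ratio_def[abs_def] case_prod_beta by measurable
qed

lemma ratio_meas' [measurable]: "ratio d z \<in> borel_measurable borel"
  using measurable_compose[OF measurable_Pair1' ratio_meas, of z] by simp

lemma drift_meas [measurable]: "drift d \<in> borel_measurable borel"
proof -
  have [measurable]: "(\<lambda>x. ratio d (fst x) (snd x)) \<in> borel_measurable (borel \<Otimes>\<^sub>M borel)"
    using ratio_meas by (simp add: case_prod_beta)
  show ?thesis unfolding drift_def[abs_def] by measurable
qed

lemma md_ratio_bound: "\<bar>md x * ratio d z x\<bar> \<le> \<kappa> * (\<kappa> / low b)"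
  unfolding abs_mult abs_of_nonneg[OF ratio_nonneg] abs_of_nonneg[OF md_nonneg]
  using ratio_nonneg kappa_pos by (intro mult_mono ratio_le md_le) auto

lemma integrable_md_ratio: "integrable lam (\<lambda>x. md x * ratio d z x)"
  by (rule integrable_lam[OF _ md_ratio_bound]) measurable

lemma drift_bound: "\<bar>drift d z\<bar> \<le> \<kappa> / low b + 1"
proof -
  have "(\<integral>x. md x * ratio d z x \<partial>lam) \<le> (\<integral>x. md x * (\<kappa> / low b) \<partial>lam)"
    by (intro integral_mono integrable_md_ratio integrable_mult_left integrable_md mult_left_mono ratio_le md_nonneg)
  then have "(\<integral>x. md x * ratio d z x \<partial>lam) \<le> \<kappa> / low b" by (simp add: md_norm)
  moreover have "0 \<le> (\<integral>x. md x * ratio d z x \<partial>lam)"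
    by (intro Bochner_Integration.integral_nonneg mult_nonneg_nonneg md_nonneg ratio_nonneg)
  ultimately show ?thesis unfolding drift_def abs_le_iff by linarith
qed

lemma mixt_step:
  "mixt (step v z d) x = mixt d x * (1 + v * (ratio d z x - 1))"
proof -
  have "mixt (step v z d) x
      = (\<integral>u. (1 - v) * (k x u * d u) + v / mixt d z * (k x u * k z u * d u) \<partial>P\<^sub>0)"
    unfolding mixt_def[of "step v z d"] step_def
    by (intro Bochner_Integration.integral_cong) (auto simp: algebra_simps add_divide_distrib)
  also have "\<dots> = (1 - v) * mixt d x + v / mixt d z * (\<integral>u. k x u * k z u * d u \<partial>P\<^sub>0)"
    unfolding mixt_def[of d x] using integrable_kd integrable_kkd by simp
  also have "\<dots> = mixt d x * (1 + v * (ratio d z x - 1))"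
    using mixt_pos[of x] mixt_pos[of z] by (simp add: ratio_def field_simps)
  finally show ?thesis .
qed

lemma dens_step:
  assumes v: "0 \<le> v" "v < 1"
  shows "dens (b * (1 - v)) (step v z d)"
  unfolding dens_def
proof (intro conjI allI)
  show "step v z d \<in> borel_measurable borel" unfolding step_def[abs_def] by measurable
  show "0 < b * (1 - v)" using b_pos v by simp
  show "b * (1 - v) \<le> step v z d u" for u
    unfolding step_def using d_ge b_pos v k_nonneg mixt_pos[of z]
    by (intro mult_mono) (auto simp: d_nonneg)
  obtain B where B: "\<And>u. d u \<le> B" using d_bounded by blast
  have "step v z d u \<le> B * (1 + \<kappa> / mixt d z)" for u
  proof -
    have "v * k z u / mixt d z \<le> 1 * \<kappa> / mixt d z"
      using v k_le k_nonneg mixt_pos[of z] by (intro divide_right_mono mult_mono) (auto simp: less_imp_le)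
    then have "1 - v + v * k z u / mixt d z \<le> 1 + \<kappa> / mixt d z" using v by simp
    then show ?thesis unfolding step_def
      using B[of u] d_nonneg[of u] v k_nonneg[of z u] mixt_pos[of z]
      by (intro mult_mono) auto
  qed
  then show "\<exists>B. \<forall>u. step v z d u \<le> B" by blast
  have "(\<integral>u. step v z d u \<partial>P\<^sub>0) = (\<integral>u. (1 - v) * d u + v / mixt d z * (k z u * d u) \<partial>P\<^sub>0)"
    unfolding step_def by (intro Bochner_Integration.integral_cong) (auto simp: algebra_simps)
  also have "\<dots> = (1 - v) * 1 + v / mixt d z * mixt d z"
    using integrable_kd integrable_d by (simp add: d_norm mixt_def)
  finally show "(\<integral>u. step v z d u \<partial>P\<^sub>0) = 1" using mixt_pos[of z] by simp
qed

lemma integral_mixt: "(\<integral>x. mixt d x \<partial>lam) = 1"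
proof -
  obtain B where B: "\<And>u. d u \<le> B" using d_bounded by blast
  have "(\<integral>x. mixt d x \<partial>lam) = (\<integral>u. (\<integral>x. k x u * d u \<partial>lam) \<partial>P\<^sub>0)"
    unfolding mixt_def
    by (rule Fubini_bounded[of _ _ _ "\<kappa> * B"])
       (auto simp: abs_mult k_nonneg d_nonneg kappa_pos less_imp_le intro!: mult_mono k_le B lam.finite_measure_axioms P0.finite_measure_axioms)
  then show ?thesis by (simp add: k_norm d_norm)
qed

end

declare d_meas [measurable del] mixt_meas [measurable del] ratio_meas [measurable del]
  ratio_meas' [measurable del] drift_meas [measurable del]

section \<open>The divergence and its change in one step\<close>

lemma KLd_integrand_bound:
  assumes \<rho>: "0 < \<rho>" "\<rho> \<le> t" and t: "t \<le> C"
  shows "\<bar>md x * ln (md x / t)\<bar> \<le> \<bar>C\<bar> + \<bar>\<kappa> * (\<kappa> / \<rho>)\<bar>"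
proof -
  have t0: "0 < t" using \<rho> by linarith
  note G = gibbs_pointwise[OF md_nonneg[of x] t0]
  have "md x / t \<le> \<kappa> / \<rho>"
    using md_le md_nonneg \<rho> kappa_pos by (intro frac_le) (auto simp: less_imp_le)
  then have "md x * (md x / t - 1) \<le> md x * (\<kappa> / \<rho>)"
    using md_nonneg[of x] by (intro mult_left_mono) auto
  also have "\<dots> \<le> \<kappa> * (\<kappa> / \<rho>)"
    using md_le[of x] kappa_pos \<rho> by (intro mult_right_mono) auto
  finally have "md x * (md x / t - 1) \<le> \<kappa> * (\<kappa> / \<rho>)" .
  moreover have "- C \<le> md x - t" using t md_nonneg[of x] by linarith
  ultimately show ?thesis using G by linarith
qed

lemma integrable_KLd:
  assumes [measurable]: "g \<in> borel_measurable borel" and g: "0 < \<rho>" "\<And>x. \<rho> \<le> g x" "\<And>x. g x \<le> C"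
  shows "integrable lam (\<lambda>x. md x * ln (md x / g x))"
  by (rule integrable_lam[OF _ KLd_integrand_bound[OF g]]) measurable

lemma integrable_KLd_mixt: "dens b d \<Longrightarrow> integrable lam (\<lambda>x. md x * ln (md x / mixt d x))"
  by (rule integrable_KLd[OF mixt_meas low_pos mixt_ge mixt_le])

lemma KLd_nonneg:
  assumes "dens b d"
  shows "0 \<le> KLd (mixt d)"
proof -
  have i: "integrable lam (mixt d)"
    using mixt_le[OF assms] mixt_pos[OF assms]
    by (intro integrable_lam[of _ \<kappa>] mixt_meas[OF assms]) (simp add: abs_of_pos)
  have "(\<integral>x. md x - mixt d x \<partial>lam) \<le> KLd (mixt d)"
    unfolding KLd_def
    by (intro integral_mono integrable_KLd_mixt[OF assms] Bochner_Integration.integrable_diff i integrable_md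
          gibbs_pointwise md_nonneg mixt_pos[OF assms])
  then show ?thesis using i integrable_md by (simp add: md_norm integral_mixt[OF assms])
qed

text \<open>By \<open>mixt_step\<close> the change is minus the \<open>md\<close>-mean of
  \<open>ln (1 + t)\<close> with \<open>t = v * (ratio d z x - 1)\<close>. Ratios are nonnegative,
  so \<open>t \<ge> - v \<ge> - 1 / 2\<close>, the range of \<open>ln_one_plus_ge\<close>; the
  quadratic loss is then bounded through \<open>ratio_le\<close>.\<close>

lemma KLd_step_le:
  assumes d: "dens b d" and v: "0 \<le> v" "v \<le> 1 / 2"
  shows "KLd (mixt (step v z d)) \<le> KLd (mixt d) - v * drift d z + 2 * v\<^sup>2 * (\<kappa> / low b + 1)\<^sup>2"
proof -
  define R where "R = \<kappa> / low b + 1"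
  have d': "dens (b * (1 - v)) (step v z d)" using v by (intro dens_step[OF d]) auto
  note int = integrable_KLd_mixt[OF d] integrable_md integrable_md_ratio[OF d]
  have pw: "md x * ln (md x / mixt (step v z d) x)
      \<le> md x * ln (md x / mixt d x) - v * (md x * ratio d z x - md x) + 2 * v\<^sup>2 * R\<^sup>2 * md x" for x
  proof (cases "md x = 0")
    case False
    then have mdx: "0 < md x" using md_nonneg[of x] by linarith
    define t where "t = v * (ratio d z x - 1)"
    have "- v \<le> t" unfolding t_def using v ratio_nonneg[OF d, of z x] by (simp add: algebra_simps)
    then have t: "- (1 / 2) \<le> t" using v by linarith
    have "\<bar>ratio d z x - 1\<bar> \<le> R"
      unfolding R_def using ratio_nonneg[OF d, of z x] ratio_le[OF d, of z x] by linarith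
    then have "(ratio d z x - 1)\<^sup>2 \<le> R\<^sup>2" by (metis abs_ge_zero power2_abs power_mono)
    then have "t\<^sup>2 \<le> v\<^sup>2 * R\<^sup>2" unfolding t_def power_mult_distrib by (intro mult_left_mono) auto
    then have "t - 2 * (v\<^sup>2 * R\<^sup>2) \<le> ln (1 + t)" using ln_one_plus_ge[OF t] by linarith
    then have "md x * (t - 2 * (v\<^sup>2 * R\<^sup>2)) \<le> md x * ln (1 + t)" using mdx by (intro mult_left_mono) auto
    moreover have "ln (md x / mixt (step v z d) x) = ln (md x / mixt d x) - ln (1 + t)"
      using mdx mixt_pos[OF d, of x] t
      unfolding mixt_step[OF d] t_def[symmetric] by (simp add: ln_div ln_mult)
    ultimately have "md x * ln (md x / mixt (step v z d) x) \<le> md x * ln (md x / mixt d x) - md x * (t - 2 * (v\<^sup>2 * R\<^sup>2))"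
      by (simp add: right_diff_distrib)
    then show ?thesis by (simp add: t_def algebra_simps)
  qed simp
  have "KLd (mixt (step v z d))
      \<le> (\<integral>x. md x * ln (md x / mixt d x) - v * (md x * ratio d z x - md x) + 2 * v\<^sup>2 * R\<^sup>2 * md x \<partial>lam)"
    unfolding KLd_def by (intro integral_mono pw integrable_KLd_mixt[OF d'] Bochner_Integration.integrable_add
      Bochner_Integration.integrable_diff integrable_mult_right int)
  also have "\<dots> = KLd (mixt d) - v * drift d z + 2 * v\<^sup>2 * R\<^sup>2"
    unfolding KLd_def drift_def using int by (simp add: md_norm)
  finally show ?thesis by (simp add: R_def)
qed

text \<open>The mean drift is the variance, under the current mixing distribution, of the gradient
  \<open>g\<close> of the divergence.\<close>

lemma mean_drift_nonneg:
  assumes d: "dens b d"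
  shows "0 \<le> (\<integral>z. md z * drift d z \<partial>lam)"
proof -
  note [measurable] = d_meas[OF d] mixt_meas[OF d] drift_meas[OF d] ratio_meas'[OF d]
  have rm [measurable]: "(\<lambda>p. ratio d (fst p) (snd p)) \<in> borel_measurable (borel \<Otimes>\<^sub>M borel)"
    using ratio_meas[OF d] by (simp add: case_prod_beta)
  obtain B where B: "\<And>u. d u \<le> B" using d_bounded[OF d] by blast
  have d0: "0 \<le> d u" for u by (rule d_nonneg[OF d])
  have B0: "0 \<le> B" using B[of 0] d0[of 0] by linarith
  define s where "s x = md x / mixt d x" for x
  have s0: "0 \<le> s x" for x unfolding s_def using md_nonneg mixt_pos[OF d] by (simp add: less_imp_le)
  have sB: "s x \<le> \<kappa> / low b" for x
    unfolding s_def using md_le mixt_ge[OF d] low_pos[OF d] kappa_pos by (intro frac_le) auto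
  have [measurable]: "s \<in> borel_measurable borel" unfolding s_def[abs_def] by measurable
  define S where "S = \<kappa> / low b"
  have S0: "0 \<le> S" using s0[of 0] sB[of 0] by (simp add: S_def)
  define g where "g u = (\<integral>x. s x * k x u \<partial>lam)" for u
  have [measurable]: "g \<in> borel_measurable borel" unfolding g_def[abs_def] by measurable
  have int_sk: "integrable lam (\<lambda>x. s x * k x u)" for u
    by (rule integrable_lam[of _ "S * \<kappa>"])
       (auto simp: abs_mult s0 k_nonneg S0 intro!: mult_mono sB[folded S_def] k_le)
  have g0: "0 \<le> g u" for u
    unfolding g_def by (intro Bochner_Integration.integral_nonneg mult_nonneg_nonneg s0 k_nonneg)
  have gS: "g u \<le> S" for u
  proof -
    have "integrable lam (\<lambda>x. k x u)"
      by (rule integrable_lam[of _ \<kappa>]) (auto simp: k_nonneg k_le)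
    then have "g u \<le> (\<integral>x. S * k x u \<partial>lam)"
      unfolding g_def S_def by (intro integral_mono int_sk mult_right_mono sB k_nonneg integrable_mult_right)
    then show ?thesis by (simp add: k_norm)
  qed
  \<comment> \<open>Used three times: \<open>h = 1\<close> shows that \<open>g\<close> has mean 1,
    \<open>h = k z\<close> expresses the drift through \<open>g\<close>, and \<open>h = g\<close>
    turns the mean drift into the second moment of \<open>g\<close> minus 1.\<close>
  have fb: "(\<integral>x. s x * (\<integral>u. k x u * h u * d u \<partial>P\<^sub>0) \<partial>lam) = (\<integral>u. g u * h u * d u \<partial>P\<^sub>0)"
    if [measurable]: "h \<in> borel_measurable borel" and h: "\<And>u. 0 \<le> h u" "\<And>u. h u \<le> H" for h H
  proof -
    have "(\<integral>x. s x * (\<integral>u. k x u * h u * d u \<partial>P\<^sub>0) \<partial>lam) = (\<integral>x. (\<integral>u. s x * (k x u * h u * d u) \<partial>P\<^sub>0) \<partial>lam)"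
      by simp
    also have "\<dots> = (\<integral>u. (\<integral>x. s x * (k x u * h u * d u) \<partial>lam) \<partial>P\<^sub>0)"
    proof (rule Fubini_bounded[of _ _ _ "S * (\<kappa> * H * B)"])
      show "\<bar>s x * (k x u * h u * d u)\<bar> \<le> S * (\<kappa> * H * B)" for x u
        unfolding abs_mult abs_of_nonneg[OF s0] abs_of_nonneg[OF k_nonneg] abs_of_nonneg[OF h(1)] abs_of_nonneg[OF d0]
        using S0 kappa_pos h(1)[of u] h(2)[of u] B0
        by (intro mult_mono mult_nonneg_nonneg s0 sB[folded S_def] k_nonneg k_le d0 B h) auto
    qed (auto intro!: lam.finite_measure_axioms P0.finite_measure_axioms)
    also have "\<dots> = (\<integral>u. g u * h u * d u \<partial>P\<^sub>0)"
    proof (rule Bochner_Integration.integral_cong[OF refl])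
      fix u
      have "(\<integral>x. s x * (k x u * h u * d u) \<partial>lam) = (\<integral>x. (s x * k x u) * (h u * d u) \<partial>lam)"
        by (simp only: mult.assoc)
      also have "\<dots> = g u * (h u * d u)" unfolding g_def by (rule integral_mult_left_zero)
      finally show "(\<integral>x. s x * (k x u * h u * d u) \<partial>lam) = g u * h u * d u" by (simp only: mult.assoc)
    qed
    finally show ?thesis .
  qed
  have one: "(\<integral>u. g u * d u \<partial>P\<^sub>0) = 1"
  proof -
    have "(\<integral>u. g u * d u \<partial>P\<^sub>0) = (\<integral>x. s x * mixt d x \<partial>lam)"
      using fb[of "\<lambda>_. 1" 1] by (simp add: mixt_def)
    also have "\<dots> = (\<integral>x. md x \<partial>lam)"
      using mixt_pos[OF d] by (intro Bochner_Integration.integral_cong) (auto simp: s_def less_imp_neq[symmetric])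
    finally show ?thesis by (simp add: md_norm)
  qed
  have drift_eq: "md z * drift d z = s z * (\<integral>u. k z u * g u * d u \<partial>P\<^sub>0) - md z" for z
  proof -
    have "(\<integral>x. md x * ratio d z x \<partial>lam) = (\<integral>x. s x * (\<integral>u. k x u * k z u * d u \<partial>P\<^sub>0) / mixt d z \<partial>lam)"
      by (intro Bochner_Integration.integral_cong) (auto simp: ratio_def s_def)
    also have "\<dots> = (\<integral>u. g u * k z u * d u \<partial>P\<^sub>0) / mixt d z"
      using fb[of "k z" \<kappa>] by (simp add: k_nonneg k_le)
    also have "(\<integral>u. g u * k z u * d u \<partial>P\<^sub>0) = (\<integral>u. k z u * g u * d u \<partial>P\<^sub>0)" by (simp add: mult.commute)
    finally show ?thesis unfolding drift_def by (simp add: s_def right_diff_distrib)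
  qed
  have i: "integrable P\<^sub>0 (\<lambda>u. g u * g u * d u)" "integrable P\<^sub>0 (\<lambda>u. g u * d u)"
    by (rule integrable_mult_d[OF d, of _ "S * S"] integrable_mult_d[OF d, of _ S];
        auto simp: abs_mult g0 gS S0 intro!: mult_mono)+
  have i2: "integrable lam (\<lambda>z. s z * (\<integral>u. k z u * g u * d u \<partial>P\<^sub>0))"
  proof (rule integrable_lam)
    fix z
    have "\<bar>\<integral>u. k z u * g u * d u \<partial>P\<^sub>0\<bar> \<le> (\<integral>u. \<kappa> * S * d u \<partial>P\<^sub>0)"
    proof (rule order_trans[OF integral_abs_bound], rule integral_mono)
      show kg: "integrable P\<^sub>0 (\<lambda>u. \<bar>k z u * g u * d u\<bar>)"
        by (intro integrable_abs, rule integrable_mult_d[OF d, of _ "\<kappa> * S"])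
           (auto simp: abs_mult g0 gS S0 k_nonneg k_le kappa_pos less_imp_le intro!: mult_mono)
    qed (auto simp: abs_mult g0 gS S0 k_nonneg k_le d0 kappa_pos less_imp_le integrable_d[OF d] intro!: mult_mono)
    also have "\<dots> = \<kappa> * S" by (simp add: d_norm[OF d])
    finally show "\<bar>s z * (\<integral>u. k z u * g u * d u \<partial>P\<^sub>0)\<bar> \<le> S * (\<kappa> * S)"
      unfolding abs_mult abs_of_nonneg[OF s0] using S0 by (intro mult_mono sB[folded S_def]) auto
  qed measurable
  have "(\<integral>z. md z * drift d z \<partial>lam) = (\<integral>u. g u * g u * d u \<partial>P\<^sub>0) - 1"
    unfolding drift_eq using i2 integrable_md fb[of g S] by (simp add: md_norm g0 gS)
  also have "\<dots> = (\<integral>u. g u * g u * d u - 2 * (g u * d u) + d u \<partial>P\<^sub>0)"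
    using i integrable_d[OF d] by (simp add: one d_norm[OF d])
  also have "\<dots> = (\<integral>u. (g u - 1)\<^sup>2 * d u \<partial>P\<^sub>0)"
    by (intro Bochner_Integration.integral_cong) (auto simp: power2_eq_square algebra_simps)
  also have "\<dots> \<ge> 0" using d0 by (intro Bochner_Integration.integral_nonneg) auto
  finally show ?thesis .
qed

section \<open>Masses of fixed sets and comparison with a fixed function\<close>

lemma mass_pos_le:
  assumes d: "dens b d" and [measurable]: "A \<in> sets borel" and A: "0 < measure P\<^sub>0 A"
  shows "0 < mass A d" "mass A d \<le> 1"
proof -
  have [measurable]: "A \<in> sets P\<^sub>0" by simp
  have i: "integrable P\<^sub>0 (\<lambda>u. indicator A u * d u)"
    by (rule integrable_mult_d[OF d, of _ 1]) auto
  have "b * measure P\<^sub>0 A = (\<integral>u. b * indicator A u \<partial>P\<^sub>0)" by simp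
  also have "\<dots> \<le> mass A d"
    unfolding mass_def using d_ge[OF d] d_nonneg[OF d]
    by (intro integral_mono i integrable_mult_right P0.integrable_const_bound[of _ 1]) (auto simp del: indicator_simps split: split_indicator)
  finally show "0 < mass A d" using b_pos[OF d] A by (smt (verit) mult_pos_pos)
  have "mass A d \<le> (\<integral>u. d u \<partial>P\<^sub>0)"
    unfolding mass_def by (intro integral_mono i integrable_d[OF d]) (auto simp: indicator_def d_nonneg[OF d])
  then show "mass A d \<le> 1" by (simp add: d_norm[OF d])
qed

text \<open>The update multiplies \<open>d u\<close> by
  \<open>1 + v * (k z u / mixt d z - 1)\<close>, and on \<open>A\<close> this factor can only drop
  when \<open>k z u\<close> is replaced by \<open>c\<close>. It drives the growth of the
  potential.\<close>

lemma mass_step_ge: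
  assumes d: "dens b d" and [measurable]: "A \<in> sets borel" and v: "0 \<le> v" "v < 1"
    and c: "\<And>u. u \<in> A \<Longrightarrow> c \<le> k z u"
  shows "mass A d * (1 + v * (c / mixt d z - 1)) \<le> mass A (step v z d)"
proof -
  have i: "integrable P\<^sub>0 (\<lambda>u. indicator A u * d u)"
    by (rule integrable_mult_d[OF d, of _ 1]) auto
  have i': "integrable P\<^sub>0 (\<lambda>u. indicator A u * step v z d u)"
    by (rule integrable_mult_d[OF dens_step[OF d v], of _ 1]) auto
  have "mass A d * (1 + v * (c / mixt d z - 1)) = (\<integral>u. indicator A u * d u * (1 + v * (c / mixt d z - 1)) \<partial>P\<^sub>0)"
    by (simp add: mass_def)
  also have "\<dots> \<le> mass A (step v z d)"
    unfolding mass_def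
  proof (intro integral_mono i' integrable_mult_left i)
    fix u
    have "v * (c / mixt d z) \<le> v * (k z u / mixt d z)" if "u \<in> A"
      using v mixt_pos[OF d, of z] c[OF that] by (intro mult_left_mono divide_right_mono) auto
    then have "d u * (1 + v * (c / mixt d z - 1)) \<le> d u * (1 - v + v * k z u / mixt d z)" if "u \<in> A"
      using that d_nonneg[OF d] by (intro mult_left_mono) (auto simp: algebra_simps)
    then show "indicator A u * d u * (1 + v * (c / mixt d z - 1)) \<le> indicator A u * step v z d u"
      by (auto simp: indicator_def step_def)
  qed
  finally show ?thesis .
qed

text \<open>The left-hand side is the \<open>md\<close>-mean of \<open>ln (r z / mixt d z)\<close>,
  and \<open>ln s \<le> s - 1\<close>. This is where the first-order growth of the potential is tied
  to the divergence.\<close>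

lemma mean_gain_ge:
  assumes d: "dens b d" and [measurable]: "r \<in> borel_measurable borel"
    and r: "0 < \<rho>" "\<And>x. \<rho> \<le> r x" "\<And>x. r x \<le> C"
  shows "KLd (mixt d) - KLd r \<le> (\<integral>z. md z * (r z / mixt d z - 1) \<partial>lam)"
proof -
  note [measurable] = mixt_meas[OF d]
  have rp: "0 < r x" for x using r(1) r(2)[of x] by linarith
  note int = integrable_KLd_mixt[OF d] integrable_KLd[OF _ r]
  have "KLd (mixt d) - KLd r = (\<integral>z. md z * ln (md z / mixt d z) - md z * ln (md z / r z) \<partial>lam)"
    unfolding KLd_def using int by simp
  also have "\<dots> \<le> (\<integral>z. md z * (r z / mixt d z - 1) \<partial>lam)"
  proof (rule integral_mono)
    show "integrable lam (\<lambda>z. md z * (r z / mixt d z - 1))"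
    proof (rule integrable_lam[of _ "\<kappa> * (C / low b + 1)"])
      fix x
      have "r x / mixt d x \<le> C / low b"
        using rp[of x] r(3)[of x] mixt_ge[OF d, of x] low_pos[OF d] by (intro frac_le) auto
      moreover have "0 \<le> r x / mixt d x" using rp[of x] mixt_pos[OF d, of x] by simp
      ultimately show "\<bar>md x * (r x / mixt d x - 1)\<bar> \<le> \<kappa> * (C / low b + 1)"
        unfolding abs_mult using md_nonneg[of x] md_le[of x] by (intro mult_mono) auto
    qed measurable
    fix x
    have "md x * ln (md x / mixt d x) - md x * ln (md x / r x) = md x * ln (r x / mixt d x)"
      using mixt_pos[OF d, of x] rp[of x] md_nonneg[of x]
      by (cases "md x = 0") (auto simp: ln_div algebra_simps)
    also have "\<dots> \<le> md x * (r x / mixt d x - 1)"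
      using mixt_pos[OF d, of x] rp[of x] md_nonneg[of x] by (intro mult_left_mono ln_le_minus_one) auto
    finally show "md x * ln (md x / mixt d x) - md x * ln (md x / r x) \<le> md x * (r x / mixt d x - 1)" .
  qed (use int in auto)
  finally show ?thesis .
qed

text \<open>A Pinsker-type inequality with a free parameter \<open>e\<close> in place of
  Cauchy-Schwarz. With square roots \<open>p\<close>, \<open>q\<close> of the densities, the
  difference factors as \<open>\<bar>p - q\<bar> * (p + q)\<close>; the product is split by the
  arithmetic-geometric mean inequality, and the squared Hellinger distance is at most the
  divergence.\<close>

lemma L1_dist_le:
  assumes d: "dens b d" and e: "0 < e"
  shows "(\<integral>x. \<bar>mixt d x - md x\<bar> \<partial>lam) \<le> KLd (mixt d) / (2 * e) + 2 * e"
proof -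
  note [measurable] = mixt_meas[OF d]
  have i: "integrable lam (mixt d)"
    using mixt_le[OF d] mixt_pos[OF d]
    by (intro integrable_lam[of _ \<kappa>] mixt_meas[OF d]) (simp add: abs_of_pos)
  note int = integrable_KLd_mixt[OF d] integrable_md i
  have pw: "\<bar>mixt d x - md x\<bar>
      \<le> (mixt d x - md x + md x * ln (md x / mixt d x)) / (2 * e) + e * (mixt d x + md x)" for x
  proof -
    define p where "p = sqrt (mixt d x)"
    define q where "q = sqrt (md x)"
    have p: "0 < p" "mixt d x = p\<^sup>2" using mixt_pos[OF d, of x] by (auto simp: p_def)
    have q: "0 \<le> q" "md x = q\<^sup>2" using md_nonneg[of x] by (auto simp: q_def)
    \<comment> \<open>Hellinger against Kullback-Leibler pointwise:
      \<open>ln (p / q) \<le> p / q - 1\<close>, doubled. The linear terms integrate to 0 because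
      both densities have mass 1.\<close>
    have sq: "(p - q)\<^sup>2 \<le> p\<^sup>2 - q\<^sup>2 + q\<^sup>2 * ln (q\<^sup>2 / p\<^sup>2)"
    proof (cases "q = 0")
      case False
      then have q0: "0 < q" using q by simp
      have "1 - p / q \<le> ln (q / p)" using ln_le_minus_one[of "p / q"] p(1) q0 by (simp add: ln_div)
      then have "q\<^sup>2 * (2 * (1 - p / q)) \<le> q\<^sup>2 * (2 * ln (q / p))" by (intro mult_left_mono) auto
      also have "2 * ln (q / p) = ln (q\<^sup>2 / p\<^sup>2)" using p(1) q0 by (simp add: power_divide[symmetric] ln_realpow)
      also have "q\<^sup>2 * (2 * (1 - p / q)) = 2 * q\<^sup>2 - 2 * p * q"
        using q0 by (simp add: power2_eq_square field_simps)
      finally show ?thesis by (simp add: power2_diff)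
    qed simp
    have "0 \<le> (\<bar>p - q\<bar> - e * (p + q))\<^sup>2" by simp
    then have "\<bar>p - q\<bar> * (p + q) * (2 * e) \<le> (p - q)\<^sup>2 + e\<^sup>2 * (p + q)\<^sup>2"
      by (simp add: power2_diff power_mult_distrib mult_ac)
    also have "(p + q)\<^sup>2 \<le> 2 * (p\<^sup>2 + q\<^sup>2)"
      using zero_le_power2[of "p - q"] by (simp add: power2_eq_square algebra_simps)
    also have "\<bar>p - q\<bar> * (p + q) = \<bar>p\<^sup>2 - q\<^sup>2\<bar>"
      using p(1) q(1) by (simp add: power2_eq_square square_diff_square_factored abs_mult mult.commute)
    finally have "\<bar>p\<^sup>2 - q\<^sup>2\<bar> * (2 * e) \<le> (p - q)\<^sup>2 + e\<^sup>2 * (2 * (p\<^sup>2 + q\<^sup>2))"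
      by (simp add: mult_left_mono)
    then have "\<bar>p\<^sup>2 - q\<^sup>2\<bar> \<le> ((p - q)\<^sup>2 + e\<^sup>2 * (2 * (p\<^sup>2 + q\<^sup>2))) / (2 * e)"
      using e by (simp add: pos_le_divide_eq)
    also have "\<dots> = (p - q)\<^sup>2 / (2 * e) + e * (p\<^sup>2 + q\<^sup>2)"
      using e by (simp add: field_simps power2_eq_square)
    also have "\<dots> \<le> (p\<^sup>2 - q\<^sup>2 + q\<^sup>2 * ln (q\<^sup>2 / p\<^sup>2)) / (2 * e) + e * (p\<^sup>2 + q\<^sup>2)"
      using e sq by (intro add_right_mono divide_right_mono) auto
    finally show ?thesis by (simp add: p(2) q(2))
  qed
  have "(\<integral>x. \<bar>mixt d x - md x\<bar> \<partial>lam)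
      \<le> (\<integral>x. (mixt d x - md x + md x * ln (md x / mixt d x)) / (2 * e) + e * (mixt d x + md x) \<partial>lam)"
    using int by (intro integral_mono pw integrable_abs Bochner_Integration.integrable_add
      Bochner_Integration.integrable_diff integrable_divide integrable_mult_right) auto
  also have "\<dots> = KLd (mixt d) / (2 * e) + 2 * e"
    using int by (simp add: KLd_def md_norm integral_mixt[OF d])
  finally show ?thesis .
qed

end


section \<open>Almost sure convergence\<close>

text \<open>Here \<open>\<kappa>\<close> stands for the comparison value \<open>KLd r\<close>, not
  for the kernel bound. If the limit exceeded it by \<open>2 * \<delta>\<close>, then from some
  index on each step would add at least \<open>\<delta> * a / (n + 2)\<close> to
  \<open>\<Phi>\<close>, up to convergent series; the harmonic series would push
  \<open>\<Phi>\<close> above 0.\<close>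

lemma limit_le_of_potential:
  fixes \<Phi> K D c :: "nat \<Rightarrow> real"
  assumes \<Phi>: "\<And>n. \<Phi> n \<le> 0" "\<And>n. \<Phi> n + D n - c n + a / real (n + 2) * (K n - \<kappa>) \<le> \<Phi> (Suc n)"
    and D: "summable D" and c: "summable c" and a: "0 < a" and K: "K \<longlonglongrightarrow> L"
  shows "L \<le> \<kappa>"
proof (rule ccontr)
  assume "\<not> L \<le> \<kappa>"
  define \<delta> where "\<delta> = (L - \<kappa>) / 2"
  have \<delta>: "0 < \<delta>" "\<kappa> + \<delta> < L" using \<open>\<not> L \<le> \<kappa>\<close> by (auto simp: \<delta>_def field_simps)
  from order_tendstoD(1)[OF K \<delta>(2)] obtain N where N: "\<And>n. N \<le> n \<Longrightarrow> \<kappa> + \<delta> < K n"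
    by (auto simp: eventually_sequentially)
  define S where "S n = (\<Sum>i<n. D i - c i)" for n
  have "summable (\<lambda>i. D i - c i)" using D c by (rule summable_diff)
  then have "Bseq S" unfolding S_def by (intro convergent_imp_Bseq) (simp add: summable_iff_convergent)
  then obtain b where b: "\<And>n. \<bar>S n\<bar> \<le> b" by (auto simp: Bseq_def)
  have tel: "\<Phi> N + (S (N + n) - S N) + (\<Sum>i<n. \<delta> * a * (1 / real (i + N + 2))) \<le> \<Phi> (N + n)" for n
  proof (induction n)
    case (Suc n)
    have "a / real (n + N + 2) * \<delta> \<le> a / real (N + n + 2) * (K (N + n) - \<kappa>)"
      using N[of "N + n"] a \<delta> by (intro mult_mono) (auto simp: add_ac)
    then have "\<delta> * a * (1 / real (n + N + 2)) \<le> a / real (N + n + 2) * (K (N + n) - \<kappa>)"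
      by (simp add: mult_ac)
    with \<Phi>(2)[of "N + n"] Suc show ?case by (simp add: S_def)
  qed simp
  have "summable (\<lambda>i. \<delta> * a * (1 / real (i + N + 2)))"
  proof (rule bounded_imp_summable)
    fix n
    show "0 \<le> \<delta> * a * (1 / real (n + N + 2))" using \<delta> a by simp
    show "(\<Sum>i\<le>n. \<delta> * a * (1 / real (i + N + 2))) \<le> 2 * b - \<Phi> N"
      using tel[of "Suc n"] \<Phi>(1)[of "N + Suc n"] b[of "N + Suc n"] b[of N]
      unfolding lessThan_Suc_atMost abs_le_iff by linarith
  qed
  then have "summable (\<lambda>i. 1 / (\<delta> * a) * (\<delta> * a * (1 / real (i + N + 2))))" by (rule summable_mult)
  then have "summable (\<lambda>i. inverse (real (i + (N + 2))))"
    using \<delta> a by (simp add: field_simps)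
  then have "summable (\<lambda>i. inverse (real i))" by (subst (asm) summable_iff_shift[of "\<lambda>i. inverse (real i)"])
  then show False using not_summable_harmonic[where 'a=real] by simp
qed

context pr_kernel
begin

lemma dens_mono: "dens b d \<Longrightarrow> 0 < b' \<Longrightarrow> b' \<le> b \<Longrightarrow> dens b' d"
  unfolding dens_def using order_trans by blast

text \<open>The sets \<open>A j\<close> must be charged by \<open>P\<^sub>0\<close> so that the
  logarithms of their masses are finite. The lower bound \<open>\<rho>\<close> makes
  \<open>KLd r\<close> an honest integral, and \<open>c j x \<le> \<kappa>\<close> lets the gain of
  every set obey the same bound as the drift, so that \<open>err\<close> serves both
  arguments.\<close>

definition minorant :: "(real \<Rightarrow> real) \<Rightarrow> bool" where
  "minorant r \<longleftrightarrow> (\<exists>(J :: nat set) q A c. finite J \<and> sum q J = 1 \<and> r = (\<lambda>x. \<Sum>j\<in>J. q j * c j x) \<and>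
     (\<exists>\<rho>>0. \<forall>x. \<rho> \<le> r x) \<and>
     (\<forall>j\<in>J. 0 \<le> q j \<and> A j \<in> sets borel \<and> 0 < measure P\<^sub>0 (A j) \<and> c j \<in> borel_measurable borel \<and>
        (\<forall>x. 0 \<le> c j x \<and> c j x \<le> \<kappa> \<and> (\<forall>u\<in>A j. c j x \<le> k x u))))"

end

locale pr_iid = pr_kernel + prob_space M for M :: "'a measure" +
  fixes Y :: "nat \<Rightarrow> 'a \<Rightarrow> real" and a :: real
  assumes Y_indep: "indep_vars (\<lambda>_. borel) Y {1..}"
    and Y_law: "\<And>i. 1 \<le> i \<Longrightarrow> distr M borel (Y i) = density lam (\<lambda>x. ennreal (md x))"
    and a_pos: "0 < a" and a_less: "a < 1 / 4"
begin

text \<open>Observation \<open>Suc n\<close> comes with the weight \<open>a / (i + 1)\<close> at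
  \<open>i = Suc n\<close>, that is, \<open>a / (n + 2)\<close>.\<close>

primrec pdens :: "(nat \<Rightarrow> real) \<Rightarrow> nat \<Rightarrow> real \<Rightarrow> real" where
  "pdens y 0 = (\<lambda>_. 1)"
| "pdens y (Suc n) = step (a / real (n + 2)) (y (Suc n)) (pdens y n)"

lemma pdens_cong: "(\<And>i. i \<in> {1..n} \<Longrightarrow> y i = y' i) \<Longrightarrow> pdens y n = pdens y' n"
  by (induction n) auto

text \<open>Each update shrinks the lower bound by at most \<open>1 - a / (n + 2)\<close>, which by
  Bernoulli's inequality is at least \<open>((n + 1) / (n + 2)) powr a\<close>; the product of these
  telescopes.\<close>

lemma dens_pdens: "dens (real (n + 1) powr - a) (pdens y n)"
proof (induction n)
  case 0
  show ?case by (auto simp: dens_def P0.prob_space[unfolded space_P0] intro: exI[of _ 1])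
next
  case (Suc n)
  let ?w = "a / real (n + 2)"
  have w: "0 \<le> ?w" "?w < 1" using a_pos a_less by (auto simp: field_simps)
  have "(real (n + 1) / real (n + 2)) powr a \<le> 1 + a * (real (n + 1) / real (n + 2) - 1)"
    using a_pos a_less by (intro powr_le_affine) auto
  also have "\<dots> = 1 - ?w" by (simp add: field_simps)
  finally have "real (n + 1) powr a / real (n + 2) powr a / real (n + 1) powr a \<le> (1 - ?w) / real (n + 1) powr a"
    by (intro divide_right_mono) (simp_all add: powr_divide)
  then have "real (Suc n + 1) powr - a \<le> real (n + 1) powr - a * (1 - ?w)"
    by (simp add: powr_minus_divide)
  moreover have "0 < real (Suc n + 1) powr - a" by simp
  ultimately have "dens (real (Suc n + 1) powr - a) (step ?w (y (Suc n)) (pdens y n))"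
    using dens_mono[OF dens_step[OF Suc w]] by blast
  then show ?case by simp
qed

section \<open>Measurability in the observed history\<close>

abbreviation mn :: "(nat \<Rightarrow> real) \<Rightarrow> nat \<Rightarrow> real \<Rightarrow> real" where "mn y n \<equiv> mixt (pdens y n)"

text \<open>Joint measurability in history and parameter is what allows the nested integrals in
  \<open>mixt\<close> and \<open>drift\<close> to be measurable. The index set is arbitrary because
  early densities are later evaluated on longer histories.\<close>

lemma pdens_meas_Pair:
  assumes "{1..n} \<subseteq> I"
  shows "(\<lambda>p. pdens (fst p) n (snd p)) \<in> borel_measurable (PiM I (\<lambda>_. borel) \<Otimes>\<^sub>M borel)"
  using assms
proof (induction n)
  case (Suc n)
  let ?N = "PiM I (\<lambda>_. borel :: real measure) \<Otimes>\<^sub>M (borel :: real measure)"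
  have IH [measurable]: "(\<lambda>p. pdens (fst p) n (snd p)) \<in> borel_measurable ?N"
    by (rule Suc.IH) (use Suc.prems in \<open>auto simp: subset_eq\<close>)
  have [measurable]: "(\<lambda>p. fst p (Suc n)) \<in> borel_measurable ?N"
    using Suc.prems by (intro measurable_compose[OF measurable_fst] measurable_component_singleton) auto
  have "(\<lambda>p. (fst (fst p), snd p)) \<in> measurable (?N \<Otimes>\<^sub>M P\<^sub>0) ?N" by measurable
  from measurable_compose[OF this IH]
  have [measurable]: "(\<lambda>p. pdens (fst (fst p)) n (snd p)) \<in> borel_measurable (?N \<Otimes>\<^sub>M P\<^sub>0)" by simp
  show ?case unfolding pdens.simps step_def mixt_def by measurable
qed simp

lemma pdens_meas:
  assumes I: "{1..n} \<subseteq> I" and [measurable]: "f \<in> measurable N (PiM I (\<lambda>_. borel))" "g \<in> borel_measurable N"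
  shows "(\<lambda>x. pdens (f x) n (g x)) \<in> borel_measurable N"
  using measurable_compose[OF _ pdens_meas_Pair[OF I], of "\<lambda>x. (f x, g x)" N] by simp

lemma mn_meas:
  assumes I: "{1..n} \<subseteq> I" and [measurable]: "f \<in> measurable N (PiM I (\<lambda>_. borel))" "g \<in> borel_measurable N"
  shows "(\<lambda>x. mn (f x) n (g x)) \<in> borel_measurable N"
proof -
  have [measurable]: "(\<lambda>p. pdens (f (fst p)) n (snd p)) \<in> borel_measurable (N \<Otimes>\<^sub>M P\<^sub>0)"
    by (rule pdens_meas[OF I]; measurable)
  show ?thesis unfolding mixt_def by measurable
qed

lemma drift_pdens_meas:
  assumes I: "{1..n} \<subseteq> I" and [measurable]: "f \<in> measurable N (PiM I (\<lambda>_. borel))" "g \<in> borel_measurable N"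
  shows "(\<lambda>x. drift (pdens (f x) n) (g x)) \<in> borel_measurable N"
proof -
  have [measurable]: "(\<lambda>p. pdens (f (fst (fst p))) n (snd p)) \<in> borel_measurable ((N \<Otimes>\<^sub>M lam) \<Otimes>\<^sub>M P\<^sub>0)"
    by (rule pdens_meas[OF I]; measurable)
  have [measurable]: "(\<lambda>p. mn (f (fst p)) n (snd p)) \<in> borel_measurable (N \<Otimes>\<^sub>M lam)"
    "(\<lambda>p. mn (f (fst p)) n (g (fst p))) \<in> borel_measurable (N \<Otimes>\<^sub>M lam)"
    by (rule mn_meas[OF I]; measurable)+
  show ?thesis unfolding drift_def ratio_def by measurable
qed

section \<open>Conditioning on the past\<close>

definition past :: "nat \<Rightarrow> 'a \<Rightarrow> nat \<Rightarrow> real" where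
  "past n \<omega> = restrict (\<lambda>i. Y i \<omega>) {1..n}"

lemma Y_meas: "1 \<le> i \<Longrightarrow> Y i \<in> borel_measurable M"
  using Y_indep unfolding indep_vars_def by auto

lemma past_meas [measurable]: "past n \<in> measurable M (PiM {1..n} (\<lambda>_. borel))"
  unfolding past_def by (intro measurable_restrict Y_meas) auto

text \<open>Conditioning on the past in the form of Fubini: the past and the next observation are
  independent, so their joint law is a product and the next observation can be integrated out with
  the past frozen.\<close>

lemma conditional_mean:
  assumes [measurable]: "case_prod G \<in> borel_measurable (PiM {1..n} (\<lambda>_. borel) \<Otimes>\<^sub>M borel)"
    and bd: "\<And>h z. \<bar>G h z\<bar> \<le> C"
  shows "expectation (\<lambda>\<omega>. G (past n \<omega>) (Y (Suc n) \<omega>)) = expectation (\<lambda>\<omega>. \<integral>z. md z * G (past n \<omega>) z \<partial>lam)"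
proof -
  let ?P = "PiM {1..n} (\<lambda>_. borel :: real measure)"
  have [measurable]: "Y (Suc n) \<in> borel_measurable M" by (rule Y_meas) simp
  let ?Q = "PiM {Suc n} (\<lambda>_. borel :: real measure)"
  \<comment> \<open>The next observation is packed as a tuple with one coordinate, so that
    independence of families over disjoint index sets applies.\<close>
  define Z where "Z \<omega> = restrict (\<lambda>i. Y i \<omega>) {Suc n}" for \<omega>
  have [measurable]: "Z \<in> measurable M ?Q"
    unfolding Z_def by (intro measurable_restrict Y_meas) auto
  have [measurable]: "(\<lambda>x. x (Suc n)) \<in> borel_measurable ?Q"
    by (rule measurable_component_singleton) simp
  have G2 [measurable]: "(\<lambda>p. G (fst p) (snd p (Suc n))) \<in> borel_measurable (?P \<Otimes>\<^sub>M ?Q)"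
  proof -
    have "(\<lambda>p. (fst p, snd p (Suc n))) \<in> measurable (?P \<Otimes>\<^sub>M ?Q) (?P \<Otimes>\<^sub>M borel)" by measurable
    from measurable_compose[OF this assms(1)] show ?thesis by simp
  qed
  have "indep_var ?P (past n) ?Q Z"
    unfolding past_def Z_def by (rule indep_var_restrict[OF Y_indep]) auto
  then have J: "distr M ?P (past n) \<Otimes>\<^sub>M distr M ?Q Z = distr M (?P \<Otimes>\<^sub>M ?Q) (\<lambda>\<omega>. (past n \<omega>, Z \<omega>))"
    unfolding indep_var_distribution_eq by simp
  have PZ: "(\<lambda>\<omega>. (past n \<omega>, Z \<omega>)) \<in> measurable M (?P \<Otimes>\<^sub>M ?Q)" by measurable
  interpret H: prob_space "distr M ?P (past n)" by (rule prob_space_distr) measurable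
  interpret Z: prob_space "distr M ?Q Z" by (rule prob_space_distr) measurable
  interpret HZ: pair_prob_space "distr M ?P (past n)" "distr M ?Q Z" ..
  have "expectation (\<lambda>\<omega>. G (past n \<omega>) (Y (Suc n) \<omega>))
      = (\<integral>p. G (fst p) (snd p (Suc n)) \<partial>distr M (?P \<Otimes>\<^sub>M ?Q) (\<lambda>\<omega>. (past n \<omega>, Z \<omega>)))"
    unfolding integral_distr[OF PZ G2] by (simp add: Z_def)
  also have "\<dots> = (\<integral>p. G (fst p) (snd p (Suc n)) \<partial>(distr M ?P (past n) \<Otimes>\<^sub>M distr M ?Q Z))"
    by (simp only: J)
  also have "\<dots> = (\<integral>h. (\<integral>z. G h (z (Suc n)) \<partial>distr M ?Q Z) \<partial>distr M ?P (past n))"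
  proof -
    have "integrable (distr M ?P (past n) \<Otimes>\<^sub>M distr M ?Q Z) (\<lambda>p. G (fst p) (snd p (Suc n)))"
      by (rule HZ.integrable_const_bound[of _ C]) (simp_all only: real_norm_def bd AE_I2,
        simp only: measurable_distr_eq1 measurable_cong_sets[OF sets_pair_measure_cong[OF sets_distr sets_distr] refl] G2)
    from HZ.integral_fst'[OF this] show ?thesis by simp
  qed
  also have "\<dots> = (\<integral>h. (\<integral>z. md z * G h z \<partial>lam) \<partial>distr M ?P (past n))"
  proof (rule Bochner_Integration.integral_cong[OF refl])
    fix h assume "h \<in> space (distr M ?P (past n))"
    then have "h \<in> space ?P" by simp
    then have Gh [measurable]: "G h \<in> borel_measurable borel"
      using measurable_compose[OF measurable_Pair1'[of h ?P borel] assms(1)] by simp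
    have "(\<integral>z. G h (z (Suc n)) \<partial>distr M ?Q Z) = (\<integral>z. G h z \<partial>distr M borel (Y (Suc n)))"
      by (simp add: integral_distr Z_def)
    also have "\<dots> = (\<integral>z. md z * G h z \<partial>lam)"
      unfolding Y_law[of "Suc n", simplified]
      by (subst integral_density) (simp_all add: md_nonneg measurable_cong_sets[OF sets_lam refl] Gh md_meas)
    finally show "(\<integral>z. G h (z (Suc n)) \<partial>distr M ?Q Z) = (\<integral>z. md z * G h z \<partial>lam)" .
  qed
  also have "\<dots> = expectation (\<lambda>\<omega>. \<integral>z. md z * G (past n \<omega>) z \<partial>lam)"
  proof (rule integral_distr[OF past_meas])
    have [measurable]: "(\<lambda>p. G (fst p) (snd p)) \<in> borel_measurable (?P \<Otimes>\<^sub>M lam)"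
      using assms(1) by (simp add: case_prod_beta cong: measurable_cong_sets)
    show "(\<lambda>h. \<integral>z. md z * G h z \<partial>lam) \<in> borel_measurable ?P" by measurable
  qed
  finally show ?thesis .
qed

text \<open>A term of size \<open>(n + 1) powr a\<close> times a weight of order
  \<open>1 / n\<close> has the order \<open>(n + 1) powr (a - 1)\<close> required by
  \<open>orthogonal_series_summable\<close>; centring given the past makes the terms
  orthogonal.\<close>

lemma centered_series_summable:
  fixes G :: "nat \<Rightarrow> (nat \<Rightarrow> real) \<Rightarrow> real \<Rightarrow> real"
  assumes meas: "\<And>n I. {1..n} \<subseteq> I \<Longrightarrow> case_prod (G n) \<in> borel_measurable (PiM I (\<lambda>_. borel) \<Otimes>\<^sub>M borel)"
    and bd: "\<And>n y z. \<bar>G n y z\<bar> \<le> C * real (n + 1) powr a"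
    and cong: "\<And>n y y'. (\<And>i. i \<in> {1..n} \<Longrightarrow> y i = y' i) \<Longrightarrow> G n y = G n y'"
  shows "AE \<omega> in M. summable (\<lambda>n. a / real (n + 2) *
     (G n (\<lambda>i. Y i \<omega>) (Y (Suc n) \<omega>) - (\<integral>z. md z * G n (\<lambda>i. Y i \<omega>) z \<partial>lam)))"
proof -
  define U where "U n y z = a / real (n + 2) * (G n y z - (\<integral>z. md z * G n y z \<partial>lam))" for n y z
  define D where "D n \<omega> = U n (past (Suc n) \<omega>) (past (Suc n) \<omega> (Suc n))" for n \<omega>
  have C0: "0 \<le> C" using bd[of 0 undefined undefined] by simp
  have Gm: "(\<lambda>x. G n (f x) (g x)) \<in> borel_measurable N"
    if "{1..n} \<subseteq> I" "f \<in> measurable N (PiM I (\<lambda>_. borel))" "g \<in> borel_measurable N" for n I N f g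
    using measurable_compose[OF measurable_Pair[OF that(2,3)] meas[OF that(1)]] by simp
  have Um: "(\<lambda>x. U n (f x) (g x)) \<in> borel_measurable N"
    if I: "{1..n} \<subseteq> I" and [measurable]: "f \<in> measurable N (PiM I (\<lambda>_. borel))" "g \<in> borel_measurable N" for n I N f g
  proof -
    have [measurable]: "(\<lambda>x. G n (f x) (g x)) \<in> borel_measurable N"
      "(\<lambda>x. G n (f (fst x)) (snd x)) \<in> borel_measurable (N \<Otimes>\<^sub>M lam)"
      by (rule Gm[OF I]; measurable)+
    show ?thesis unfolding U_def by measurable
  qed
  have Gz: "G n y \<in> borel_measurable borel" for n y
  proof -
    \<comment> \<open>Points of the product space are extensional, so \<open>y\<close> is first cut
      down to the coordinates that \<open>G n\<close> looks at.\<close>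
    have "restrict y {1..n} \<in> space (PiM {1..n} (\<lambda>_. borel))" by (simp add: space_PiM)
    then have "(\<lambda>z. G n (restrict y {1..n}) z) \<in> borel_measurable borel"
      by (intro Gm[of n "{1..n}"] measurable_const) auto
    moreover have "G n (restrict y {1..n}) = G n y" by (rule cong) simp
    ultimately show ?thesis by simp
  qed
  have mean_bd: "\<bar>\<integral>z. md z * G n y z \<partial>lam\<bar> \<le> C * real (n + 1) powr a" for n y
  proof -
    have [measurable]: "G n y \<in> borel_measurable borel" by (rule Gz)
    have "\<bar>\<integral>z. md z * G n y z \<partial>lam\<bar> \<le> (\<integral>z. md z * (C * real (n + 1) powr a) \<partial>lam)"
    proof (rule order_trans[OF integral_abs_bound integral_mono])
      show "integrable lam (\<lambda>z. \<bar>md z * G n y z\<bar>)"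
        by (rule integrable_lam[of _ "\<kappa> * (C * real (n + 1) powr a)"], measurable)
           (auto simp: abs_mult md_nonneg less_imp_le[OF kappa_pos] intro!: mult_mono md_le bd[simplified])
    qed (auto simp: abs_mult md_nonneg intro!: mult_left_mono bd[simplified] integrable_md)
    then show ?thesis by (simp add: md_norm)
  qed
  have U_bd: "\<bar>U n y z\<bar> \<le> (2 * a * C) * real (n + 1) powr (a - 1)" for n y z
  proof -
    have "\<bar>U n y z\<bar> \<le> a / real (n + 2) * (2 * (C * real (n + 1) powr a))"
      unfolding U_def abs_mult using a_pos bd[of n y z] mean_bd[of n y] by (intro mult_mono) auto
    also have "\<dots> \<le> a / real (n + 1) * (2 * (C * real (n + 1) powr a))"
      using a_pos C0 by (intro mult_right_mono divide_left_mono) auto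
    also have "\<dots> = (2 * a * C) * real (n + 1) powr (a - 1)" by (simp add: powr_diff)
    finally show ?thesis .
  qed
  have U_cong: "U n y = U n y'" if "\<And>i. i \<in> {1..n} \<Longrightarrow> y i = y' i" for n y y'
  proof
    have "G n y = G n y'" by (rule cong) (rule that)
    then show "U n y z = U n y' z" for z by (simp only: U_def)
  qed
  have D_eq: "D n \<omega> = U n (past m \<omega>) (Y (Suc n) \<omega>)" if "n \<le> m" for n m \<omega>
    using that U_cong[of n "past (Suc n) \<omega>" "past m \<omega>"] unfolding D_def by (simp add: past_def)
  have D_eq': "D n \<omega> = U n (\<lambda>i. Y i \<omega>) (Y (Suc n) \<omega>)" for n \<omega>
    using U_cong[of n "past (Suc n) \<omega>" "\<lambda>i. Y i \<omega>"] unfolding D_def by (simp add: past_def)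
  have [measurable]: "D n \<in> borel_measurable M" for n
    unfolding D_def[abs_def]
    by (rule Um[OF _ past_meas measurable_compose[OF past_meas measurable_component_singleton]]) auto
  have "AE \<omega> in M. summable (\<lambda>n. D n \<omega>)"
  proof (rule orthogonal_series_summable)
    show "\<bar>D i \<omega>\<bar> \<le> 2 * a * C * real (i + 1) powr (a - 1)" for i \<omega>
      unfolding D_eq' by (rule U_bd)
    fix i j :: nat assume ij: "i < j"
    \<comment> \<open>Since \<open>i < j\<close>, the earlier term is a function of the past up to
      \<open>j\<close>. Given that past it is a constant factor, and the centred later factor
      integrates to 0.\<close>
    define F where "F h z = U i h (h (Suc i)) * U j h z" for h z
    have comp: "(\<lambda>x. fst x (Suc i)) \<in> borel_measurable (PiM {1..j} (\<lambda>_. borel) \<Otimes>\<^sub>M borel)"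
      using ij by (intro measurable_compose[OF measurable_fst] measurable_component_singleton) auto
    have "expectation (\<lambda>\<omega>. D i \<omega> * D j \<omega>) = expectation (\<lambda>\<omega>. F (past j \<omega>) (Y (Suc j) \<omega>))"
      using ij by (simp add: F_def D_eq[of i j] D_eq[of j j] past_def)
    also have "\<dots> = expectation (\<lambda>\<omega>. \<integral>z. md z * F (past j \<omega>) z \<partial>lam)"
    proof (rule conditional_mean)
      show "case_prod F \<in> borel_measurable (PiM {1..j} (\<lambda>_. borel) \<Otimes>\<^sub>M borel)"
        unfolding F_def[abs_def] case_prod_beta using ij comp
        by (intro borel_measurable_times Um[of _ "{1..j}"]) auto
      show "\<bar>F h z\<bar> \<le> (2 * a * C * real (i + 1) powr (a - 1)) * (2 * a * C * real (j + 1) powr (a - 1))" for h z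
        unfolding F_def abs_mult using a_pos C0 by (intro mult_mono U_bd) auto
    qed
    also have "\<dots> = expectation (\<lambda>\<omega>. 0)"
    proof (rule Bochner_Integration.integral_cong[OF refl])
      fix \<omega>
      define h where "h = past j \<omega>"
      have [measurable]: "G j h \<in> borel_measurable borel" by (rule Gz)
      have i: "integrable lam (\<lambda>z. md z * G j h z)"
        by (rule integrable_lam[of _ "\<kappa> * (C * real (j + 1) powr a)"], measurable)
           (auto simp: abs_mult md_nonneg less_imp_le[OF kappa_pos] intro!: mult_mono md_le bd[simplified])
      have "(\<integral>z. md z * F h z \<partial>lam) = (\<integral>z. (U i h (h (Suc i)) * (a / real (j + 2))) *
           (md z * G j h z - md z * (\<integral>z. md z * G j h z \<partial>lam)) \<partial>lam)"
        unfolding F_def U_def[of j] by (intro Bochner_Integration.integral_cong) (auto simp: algebra_simps)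
      also have "\<dots> = 0" using i integrable_md by (simp add: md_norm)
      finally show "(\<integral>z. md z * F (past j \<omega>) z \<partial>lam) = 0" by (simp add: h_def)
    qed
    finally show "expectation (\<lambda>\<omega>. D i \<omega> * D j \<omega>) = 0" by simp
  qed (use a_pos a_less in auto)
  then show ?thesis unfolding D_eq' U_def .
qed

section \<open>Convergence of the divergence and identification of its limit\<close>

definition low_const :: real where "low_const = \<kappa> / (\<eta> * measure P\<^sub>0 {u\<^sub>0}) + 1"

lemma low_bound: "\<kappa> / low (real (n + 1) powr - a) + 1 \<le> low_const * real (n + 1) powr a"
proof -
  have "1 \<le> real (n + 1) powr a" using a_pos by (intro ge_one_powr_ge_zero) auto
  then show ?thesis by (simp add: low_const_def low_def powr_minus field_simps)
qed

text \<open>The quadratic remainder of a step with weight \<open>a / (n + 2)\<close>, after the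
  bound on the ratio has been replaced by a multiple of \<open>(n + 1) powr a\<close>. The added 1
  is absorbed since that power is at least 1.\<close>

definition err :: "nat \<Rightarrow> real" where
  "err n = 2 * (a / real (n + 2))\<^sup>2 * (low_const * real (n + 1) powr a)\<^sup>2"

lemma summable_err: "summable err"
proof (rule summable_comparison_test')
  show "summable (\<lambda>n. 2 * a\<^sup>2 * low_const\<^sup>2 * real (n + 1) powr (2 * a - 2))"
    using a_less by (intro summable_mult summable_powr_Suc) auto
  fix n :: nat
  have "err n \<le> 2 * (a / real (n + 1))\<^sup>2 * (low_const * real (n + 1) powr a)\<^sup>2"
    unfolding err_def using a_pos
    by (intro mult_left_mono mult_right_mono power_mono divide_left_mono) auto
  also have "\<dots> = 2 * a\<^sup>2 * low_const\<^sup>2 * (real (n + 1) powr a * real (n + 1) powr a / (real (n + 1))\<^sup>2)"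
    by (simp add: power_mult_distrib power_divide power2_eq_square)
  also have "real (n + 1) powr a * real (n + 1) powr a / (real (n + 1))\<^sup>2 = real (n + 1) powr (2 * a - 2)"
    by (simp only: powr_add[symmetric] powr_diff) (simp add: powr_numeral)
  finally show "norm (err n) \<le> 2 * a\<^sup>2 * low_const\<^sup>2 * real (n + 1) powr (2 * a - 2)"
    by (simp add: err_def)
qed

lemma weight_bounds: "0 \<le> a / real (n + 2)" "a / real (n + 2) \<le> 1 / 2" "a / real (n + 2) < 1"
  using a_pos a_less by (auto simp: field_simps)

lemma err_ge:
  "2 * (a / real (n + 2))\<^sup>2 * (\<kappa> / low (real (n + 1) powr - a) + 1)\<^sup>2 \<le> err n"
proof -
  have "0 \<le> \<kappa> / low (real (n + 1) powr - a) + 1"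
    using low_pos[OF dens_pdens[where n=n]] kappa_pos by (simp add: add_nonneg_nonneg)
  then show ?thesis unfolding err_def
    by (intro mult_left_mono power_mono low_bound) auto
qed

text \<open>The conditional mean of the drift only helps and is dropped; its centred part and
  \<open>err\<close> have convergent series, so \<open>almost_decreasing_convergent\<close> applies
  path by path.\<close>

lemma AE_convergent_KLd: "AE \<omega> in M. convergent (\<lambda>n. KLd (mn (\<lambda>i. Y i \<omega>) n))"
proof -
  have "AE \<omega> in M. summable (\<lambda>n. a / real (n + 2) * (drift (pdens (\<lambda>i. Y i \<omega>) n) (Y (Suc n) \<omega>)
      - (\<integral>z. md z * drift (pdens (\<lambda>i. Y i \<omega>) n) z \<partial>lam)))"
  proof (rule centered_series_summable)
    show "(\<lambda>(y, z). drift (pdens y n) z) \<in> borel_measurable (PiM I (\<lambda>_. borel) \<Otimes>\<^sub>M borel)"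
      if "{1..n} \<subseteq> I" for n I
      unfolding case_prod_beta by (rule drift_pdens_meas[OF that]) auto
    show "\<bar>drift (pdens y n) z\<bar> \<le> low_const * real (n + 1) powr a" for n y z
      by (rule order_trans[OF drift_bound[OF dens_pdens] low_bound])
    show "drift (pdens y n) = drift (pdens y' n)" if "\<And>i. i \<in> {1..n} \<Longrightarrow> y i = y' i" for n y y'
      using pdens_cong[OF that] by simp
  qed
  then show ?thesis
  proof eventually_elim
    case (elim \<omega>)
    let ?y = "\<lambda>i. Y i \<omega>"
    let ?D = "\<lambda>n. a / real (n + 2) * (drift (pdens ?y n) (Y (Suc n) \<omega>)
      - (\<integral>z. md z * drift (pdens ?y n) z \<partial>lam))"
    show ?case
    proof (rule almost_decreasing_convergent[where D="\<lambda>n. - ?D n" and c=err])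
      show "summable (\<lambda>n. - ?D n)" using elim by (rule summable_minus)
      fix n
      have "0 \<le> a / real (n + 2) * (\<integral>z. md z * drift (pdens ?y n) z \<partial>lam)"
        by (intro mult_nonneg_nonneg weight_bounds mean_drift_nonneg[OF dens_pdens])
      then show "KLd (mn ?y (Suc n)) \<le> KLd (mn ?y n) + - ?D n + err n"
        using KLd_step_le[OF dens_pdens[where n=n and y="?y"] weight_bounds(1,2)[of n], of "Y (Suc n) \<omega>"] err_ge[of n]
        by (simp add: right_diff_distrib)
      show "0 \<le> KLd (mn ?y n)" by (rule KLd_nonneg[OF dens_pdens])
    qed (rule summable_err)
  qed
qed

text \<open>The limit is quantified under \<open>AE\<close> because at this stage it may still
  depend on \<open>\<omega>\<close>. The exceptional null set depends on \<open>r\<close> through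
  the centred gains.\<close>

lemma AE_limit_le_minorant:
  assumes "minorant r"
  shows "AE \<omega> in M. \<forall>L. (\<lambda>n. KLd (mn (\<lambda>i. Y i \<omega>) n)) \<longlonglongrightarrow> L \<longrightarrow> L \<le> KLd r"
proof -
  obtain J :: "nat set" and q A c \<rho> where J: "finite J" "sum q J = 1" and r: "r = (\<lambda>x. \<Sum>j\<in>J. q j * c j x)"
    and \<rho>: "0 < \<rho>" "\<And>x. \<rho> \<le> r x" and q: "\<And>j. j \<in> J \<Longrightarrow> 0 \<le> q j"
    and A: "\<And>j. j \<in> J \<Longrightarrow> A j \<in> sets borel" "\<And>j. j \<in> J \<Longrightarrow> 0 < measure P\<^sub>0 (A j)"
    and cm: "\<And>j. j \<in> J \<Longrightarrow> c j \<in> borel_measurable borel"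
    and c: "\<And>j x. j \<in> J \<Longrightarrow> 0 \<le> c j x" "\<And>j x. j \<in> J \<Longrightarrow> c j x \<le> \<kappa>"
      "\<And>j x u. j \<in> J \<Longrightarrow> u \<in> A j \<Longrightarrow> c j x \<le> k x u"
    using assms unfolding minorant_def by blast
  have rm [measurable]: "r \<in> borel_measurable borel"
    unfolding r by (intro borel_measurable_sum borel_measurable_times cm) auto
  have r_le: "r x \<le> \<kappa>" for x
  proof -
    have "r x \<le> (\<Sum>j\<in>J. q j * \<kappa>)" unfolding r by (intro sum_mono mult_left_mono c q)
    then show ?thesis by (simp add: sum_distrib_right[symmetric] J)
  qed
  have r_pos: "0 < r x" for x using \<rho>(1) \<rho>(2)[of x] by linarith
  define gain where "gain y n z = r z / mn y n z - 1" for y n z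
  have gain_bd: "\<bar>s / mn y n z - 1\<bar> \<le> \<kappa> / low (real (n + 1) powr - a) + 1" if "0 \<le> s" "s \<le> \<kappa>" for s y n z
  proof -
    have "s / mn y n z \<le> \<kappa> / low (real (n + 1) powr - a)"
      using that by (intro frac_le mixt_ge[OF dens_pdens] low_pos[OF dens_pdens]) auto
    moreover have "0 \<le> s / mn y n z" using that mixt_pos[OF dens_pdens, of y n z] by simp
    ultimately show ?thesis unfolding abs_le_iff by linarith
  qed
  have "AE \<omega> in M. summable (\<lambda>n. a / real (n + 2) * (gain (\<lambda>i. Y i \<omega>) n (Y (Suc n) \<omega>)
      - (\<integral>z. md z * gain (\<lambda>i. Y i \<omega>) n z \<partial>lam)))"
  proof (rule centered_series_summable)
    show "(\<lambda>(y, z). gain y n z) \<in> borel_measurable (PiM I (\<lambda>_. borel) \<Otimes>\<^sub>M borel)"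
      if "{1..n} \<subseteq> I" for n I
    proof -
      have [measurable]: "(\<lambda>p. mn (fst p) n (snd p)) \<in> borel_measurable (PiM I (\<lambda>_. borel) \<Otimes>\<^sub>M borel)"
        by (rule mn_meas[OF that]) auto
      show ?thesis unfolding gain_def case_prod_beta by measurable
    qed
    show "\<bar>gain y n z\<bar> \<le> low_const * real (n + 1) powr a" for n y z
      unfolding gain_def using r_pos[of z] r_le[of z] by (intro order_trans[OF gain_bd low_bound]) auto
    show "gain y n = gain y' n" if "\<And>i. i \<in> {1..n} \<Longrightarrow> y i = y' i" for n y y'
      using pdens_cong[OF that] unfolding gain_def by simp
  qed
  then show ?thesis
  proof eventually_elim
    case (elim \<omega>)
    let ?y = "\<lambda>i. Y i \<omega>"
    define \<Phi> where "\<Phi> n = (\<Sum>j\<in>J. q j * ln (mass (A j) (pdens ?y n)))" for n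
    show ?case
    proof (intro allI impI)
      fix L assume L: "(\<lambda>n. KLd (mn ?y n)) \<longlonglongrightarrow> L"
      show "L \<le> KLd r"
      proof (rule limit_le_of_potential[OF _ _ elim summable_err a_pos L])
        fix n
        note pos = mass_pos_le[OF dens_pdens A]
        show "\<Phi> n \<le> 0"
          unfolding \<Phi>_def using pos by (intro sum_nonpos mult_nonneg_nonpos q) (auto simp: ln_le_zero_iff)
        let ?v = "a / real (n + 2)" and ?z = "Y (Suc n) \<omega>"
        define e where "e = \<kappa> / low (real (n + 1) powr - a) + 1"
        have inc: "ln (mass (A j) (pdens ?y n)) + (?v * (c j ?z / mn ?y n ?z - 1) - err n)
            \<le> ln (mass (A j) (pdens ?y (Suc n)))" if j: "j \<in> J" for j
        proof -
          define t where "t = ?v * (c j ?z / mn ?y n ?z - 1)"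
          have "0 \<le> c j ?z / mn ?y n ?z"
            by (intro divide_nonneg_pos c(1)[OF j] mixt_pos[OF dens_pdens])
          from mult_nonneg_nonneg[OF weight_bounds(1)[of n] this] have "0 \<le> ?v * (c j ?z / mn ?y n ?z)" .
          then have t: "- (1 / 2) \<le> t"
            using weight_bounds(2)[of n] unfolding t_def right_diff_distrib by linarith
          have "\<bar>c j ?z / mn ?y n ?z - 1\<bar> \<le> e" unfolding e_def by (rule gain_bd; rule c[OF j])
          then have "(c j ?z / mn ?y n ?z - 1)\<^sup>2 \<le> e\<^sup>2" by (metis abs_ge_zero power2_abs power_mono)
          then have "t\<^sup>2 \<le> ?v\<^sup>2 * e\<^sup>2" unfolding t_def power_mult_distrib by (intro mult_left_mono) auto
          moreover have "2 * ?v\<^sup>2 * e\<^sup>2 \<le> err n" using err_ge[of n] by (simp add: e_def)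
          ultimately have "t - err n \<le> ln (1 + t)" using ln_one_plus_ge[OF t] by linarith
          moreover have "ln (mass (A j) (pdens ?y n) * (1 + t)) \<le> ln (mass (A j) (pdens ?y (Suc n)))"
            using mass_step_ge[OF dens_pdens[where n=n and y="?y"] A(1)[OF j] weight_bounds(1,3)[of n] c(3)[OF j], of ?z] t
              pos(1)[OF j j, of ?y n]
            by (intro ln_mono) (auto simp: t_def)
          moreover have "ln (mass (A j) (pdens ?y n) * (1 + t)) = ln (mass (A j) (pdens ?y n)) + ln (1 + t)"
            using pos(1)[OF j j, of ?y n] t by (simp add: ln_mult)
          ultimately show ?thesis by (simp add: t_def)
        qed
        \<comment> \<open>The logarithm has been bounded set by set, so averaging with the weights
          \<open>q\<close> is linear: the first-order terms add up to \<open>r / mn - 1\<close>, and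
          \<open>err\<close> is kept once because \<open>q\<close> sums to 1.\<close>
        have "(\<Sum>j\<in>J. q j * (ln (mass (A j) (pdens ?y n)) + (?v * (c j ?z / mn ?y n ?z - 1) - err n))) \<le> \<Phi> (Suc n)"
          unfolding \<Phi>_def by (intro sum_mono mult_left_mono inc q)
        also have "(\<Sum>j\<in>J. q j * (ln (mass (A j) (pdens ?y n)) + (?v * (c j ?z / mn ?y n ?z - 1) - err n)))
            = (\<Sum>j\<in>J. q j * ln (mass (A j) (pdens ?y n)) + ?v / mn ?y n ?z * (q j * c j ?z) - (?v + err n) * q j)"
          by (intro sum.cong refl) (simp add: algebra_simps)
        also have "\<dots> = \<Phi> n + ?v / mn ?y n ?z * r ?z - (?v + err n)"
          unfolding sum.distrib sum_subtractf sum_distrib_left[symmetric] r \<Phi>_def J(2) by (simp only: mult_1_right)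
        also have "\<dots> = \<Phi> n + ?v * gain ?y n ?z - err n" by (simp add: gain_def algebra_simps)
        finally have 1: "\<Phi> n + ?v * gain ?y n ?z - err n \<le> \<Phi> (Suc n)" .
        have "?v * (KLd (mn ?y n) - KLd r) \<le> ?v * (\<integral>z. md z * gain ?y n z \<partial>lam)"
          unfolding gain_def
          by (intro mult_left_mono mean_gain_ge[OF dens_pdens rm \<rho> r_le] weight_bounds)
        with 1 show "\<Phi> n + ?v * (gain ?y n ?z - (\<integral>z. md z * gain ?y n z \<partial>lam)) - err n
            + ?v * (KLd (mn ?y n) - KLd r) \<le> \<Phi> (Suc n)"
          by (simp add: right_diff_distrib)
      qed
    qed
  qed
qed

theorem AE_KLd_tendsto_0:
  assumes approx: "\<And>\<epsilon>. 0 < \<epsilon> \<Longrightarrow> \<exists>r. minorant r \<and> KLd r \<le> \<epsilon>"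
  shows "AE \<omega> in M. (\<lambda>n. KLd (mn (\<lambda>i. Y i \<omega>) n)) \<longlonglongrightarrow> 0"
proof -
  \<comment> \<open>A sequence of comparison functions is fixed in advance, so that countably many
    null sets suffice.\<close>
  have "\<exists>r. minorant r \<and> KLd r \<le> inverse (real (Suc j))" for j by (rule approx) simp
  then obtain r where r: "\<And>j. minorant (r j)" "\<And>j. KLd (r j) \<le> inverse (real (Suc j))" by metis
  have "AE \<omega> in M. \<forall>j. \<forall>L. (\<lambda>n. KLd (mn (\<lambda>i. Y i \<omega>) n)) \<longlonglongrightarrow> L \<longrightarrow> L \<le> KLd (r j)"
    by (subst AE_all_countable) (intro allI AE_limit_le_minorant r)
  with AE_convergent_KLd show ?thesis
  proof eventually_elim
    case (elim \<omega>)
    then obtain L where L: "(\<lambda>n. KLd (mn (\<lambda>i. Y i \<omega>) n)) \<longlonglongrightarrow> L" by (auto simp: convergent_def)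
    have "L \<le> inverse (real (Suc j))" for j using elim(2) L r(2)[of j] order_trans by blast
    then have "L \<le> 0" by (intro LIMSEQ_le_const[OF LIMSEQ_inverse_real_of_nat]) auto
    moreover have "0 \<le> L" by (rule LIMSEQ_le_const[OF L]) (auto intro!: KLd_nonneg[OF dens_pdens])
    ultimately show ?case using L by simp
  qed
qed

end


section \<open>The uniform kernel\<close>

lemma measurable_unif: "sets P = sets borel \<Longrightarrow> (\<lambda>u. unif x u) \<in> borel_measurable P"
proof -
  assume [measurable_cong]: "sets P = sets borel"
  have "(\<lambda>u. unif x u) = (\<lambda>u. (if 0 \<le> x \<and> x \<le> u then 1 else 0) / u)"
    by (auto simp: unif_def)
  then show ?thesis by simp
qed

locale interval =
  fixes l L :: real
  assumes l_pos: "0 < l" and l_less: "l < L"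
begin

text \<open>The uniform kernel on \<open>{0..L} \<times> {l..L}\<close>, extended to the plane by clipping so that its
  bounds hold everywhere. It does not see where in \<open>{0..l}\<close> an observation lies, so the base
  measure collapses \<open>{0..l}\<close> to the point \<open>l\<close>.\<close>

definition clip :: "real \<Rightarrow> real" where "clip u = max l (min L u)"

definition kern :: "real \<Rightarrow> real \<Rightarrow> real" where
  "kern x u = (if min x L \<le> clip u then 1 / clip u else 0)"

definition leb :: "real measure" where "leb = density lborel (\<lambda>x. ennreal (indicator {0..L} x))"

definition base :: "real measure" where "base = distr leb borel (max l)"

definition mixk :: "real measure \<Rightarrow> real \<Rightarrow> real" where "mixk P x = (\<integral>u. kern x u \<partial>P)"

lemma clip_bounds: "l \<le> clip u" "clip u \<le> L" "0 < clip u"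
  using l_pos l_less by (auto simp: clip_def)

lemma clip_id: "u \<in> {l..L} \<Longrightarrow> clip u = u" by (auto simp: clip_def)

lemma kern_nonneg: "0 \<le> kern x u" using clip_bounds(3)[of u] by (simp add: kern_def)

lemma kern_le: "kern x u \<le> 1 / l"
  using clip_bounds[of u] l_pos by (simp add: kern_def frac_le)

lemma kern_L: "kern x L = 1 / L" using l_less by (simp add: kern_def clip_def)

lemma kern_max: "kern (max l x) u = kern x u"
  using clip_bounds(1)[of u] l_less by (auto simp: kern_def min_def max_def)

lemma kern_unif: "x \<in> {0..L} \<Longrightarrow> u \<in> {l..L} \<Longrightarrow> kern x u = unif x u"
  by (auto simp: kern_def clip_id unif_def)

lemma kern_measurable: "case_prod kern \<in> borel_measurable (borel \<Otimes>\<^sub>M borel)"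
  unfolding kern_def clip_def case_prod_beta by measurable

lemma kern_measurable' [measurable (raw)]:
  "f \<in> borel_measurable N \<Longrightarrow> g \<in> borel_measurable N \<Longrightarrow> (\<lambda>x. kern (f x) (g x)) \<in> borel_measurable N"
  using measurable_compose[OF measurable_Pair kern_measurable, of f N g] by simp

lemma sets_leb [measurable_cong, simp]: "sets leb = sets borel" by (simp add: leb_def)
lemma sets_base [measurable_cong, simp]: "sets base = sets borel" by (simp add: base_def)

lemma finite_leb: "finite_measure leb"
proof
  have "emeasure leb (space leb) = ennreal L"
    using l_pos l_less by (simp add: leb_def emeasure_density ennreal_indicator)
  then show "emeasure leb (space leb) \<noteq> \<infinity>" by simp
qed

lemma finite_base: "finite_measure base"
  unfolding base_def by (intro finite_measure.finite_measure_distr finite_leb) measurable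

lemma integral_leb: "g \<in> borel_measurable borel \<Longrightarrow> (\<integral>x. g x \<partial>leb) = (\<integral>x. indicator {0..L} x * g x \<partial>lborel)"
  for g :: "real \<Rightarrow> real" unfolding leb_def by (subst integral_density) auto

lemma integral_base: "g \<in> borel_measurable borel \<Longrightarrow> (\<integral>x. g x \<partial>base) = (\<integral>x. g (max l x) \<partial>leb)"
  for g :: "real \<Rightarrow> real" unfolding base_def by (subst integral_distr) auto

lemma integrable_leb_iff: "g \<in> borel_measurable borel \<Longrightarrow> integrable leb g \<longleftrightarrow> integrable lborel (\<lambda>x. indicator {0..L} x * g x)"
  for g :: "real \<Rightarrow> real" unfolding leb_def by (subst integrable_density) auto

lemma integral_kern: "(\<integral>x. kern x u \<partial>base) = 1"
proof -
  have "(\<integral>x. kern x u \<partial>base) = (\<integral>x. indicator {0..L} x * kern x u \<partial>lborel)"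
    by (simp add: integral_base kern_max integral_leb)
  also have "\<dots> = (\<integral>x. 1 / clip u * indicator {0..clip u} x \<partial>lborel)"
    using clip_bounds[of u] by (intro Bochner_Integration.integral_cong) (auto simp: kern_def indicator_def)
  also have "\<dots> = 1" using clip_bounds[of u] by simp
  finally show ?thesis .
qed

lemma space_real: "sets P = sets borel \<Longrightarrow> space P = (UNIV :: real set)"
  using sets_eq_imp_space_eq[of P borel] by simp

lemma AE_prob_on:
  assumes "prob_on {l..L} P"
  shows "AE u in P. u \<in> {l..L}"
proof -
  interpret prob_space P using assms by (simp add: prob_on_def)
  have "prob {l..L} = 1" using assms by (simp add: prob_on_def measure_def)
  then have "AE u in P. u \<in> {l..L}"
    using assms by (subst (asm) prob_eq_1) (auto simp: prob_on_def)
  then show ?thesis by simp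
qed

lemma mixk_measurable [measurable]: "sets P = sets borel \<Longrightarrow> prob_space P \<Longrightarrow> mixk P \<in> borel_measurable borel"
proof -
  assume P [measurable_cong]: "sets P = sets borel" and "prob_space P"
  interpret prob_space P by fact
  show ?thesis unfolding mixk_def[abs_def] by measurable
qed

lemma integrable_kern: "sets P = sets borel \<Longrightarrow> prob_space P \<Longrightarrow> integrable P (kern x)"
proof -
  assume P [measurable_cong]: "sets P = sets borel" and "prob_space P"
  interpret prob_space P by fact
  show ?thesis
    by (rule integrable_const_bound[of _ "1 / l"]) (auto simp: kern_nonneg kern_le)
qed

lemma mixk_nonneg: "0 \<le> mixk P x"
  unfolding mixk_def by (intro Bochner_Integration.integral_nonneg kern_nonneg)

lemma mixk_le: "sets P = sets borel \<Longrightarrow> prob_space P \<Longrightarrow> mixk P x \<le> 1 / l"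
proof -
  assume P: "sets P = sets borel" "prob_space P"
  interpret prob_space P by fact
  have "mixk P x \<le> (\<integral>u. 1 / l \<partial>P)"
    unfolding mixk_def by (intro integral_mono integrable_kern P kern_le) auto
  then show ?thesis by (simp add: prob_space)
qed

lemma mixk_max: "mixk P (max l x) = mixk P x" by (simp add: mixk_def kern_max)

lemma integral_mixk: "sets P = sets borel \<Longrightarrow> prob_space P \<Longrightarrow> (\<integral>x. mixk P x \<partial>base) = 1"
proof -
  assume P [measurable_cong]: "sets P = sets borel" and "prob_space P"
  interpret prob_space P by fact
  have "(\<integral>x. mixk P x \<partial>base) = (\<integral>u. (\<integral>x. kern x u \<partial>base) \<partial>P)"
    unfolding mixk_def
    by (rule Fubini_bounded[OF finite_base finite_measure_axioms, of _ "1 / l"]) (auto simp: kern_nonneg kern_le)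
  then show ?thesis by (simp add: integral_kern prob_space)
qed

lemma mix_eq_mixk:
  assumes P: "prob_on {l..L} P"
  shows "mix P x = indicator {0..L} x * mixk P x"
proof -
  have [measurable_cong]: "sets P = sets borel" using P by (simp add: prob_on_def)
  have "mix P x = (\<integral>u. indicator {0..L} x * kern x u \<partial>P)"
    unfolding mix_def
  proof (rule Bochner_Integration.integral_cong_AE)
    show "(\<lambda>u. unif x u) \<in> borel_measurable P" 
      using P by (intro measurable_unif) (simp add: prob_on_def)
    show "(\<lambda>u. indicator {0..L} x * kern x u) \<in> borel_measurable P" by measurable
    show "AE u in P. unif x u = indicator {0..L} x * kern x u"
      using AE_prob_on[OF P]
    proof eventually_elim
      case (elim u)
      then show ?case
        by (cases "x \<in> {0..L}") (auto simp: kern_unif, auto simp: unif_def)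
    qed
  qed
  then show ?thesis by (simp add: mixk_def)
qed

end

section \<open>Discretising the target mixing distribution\<close>

locale uniform_model = interval +
  fixes Pd P\<^sub>0 :: "real measure"
  assumes Pd: "prob_on {l..L} Pd" and P0_on: "prob_on {l..L} P\<^sub>0"
    and P0_atoms: "0 < measure P\<^sub>0 {l}" "0 < measure P\<^sub>0 {L}"
    and P0_support: "\<And>c d. l \<le> c \<Longrightarrow> c < d \<Longrightarrow> d \<le> L \<Longrightarrow> 0 < measure Pd {c<..<d} \<Longrightarrow> 0 < measure P\<^sub>0 {c<..<d}"
begin

sublocale Pd: prob_space Pd using Pd by (simp add: prob_on_def)

lemma sets_Pd [measurable_cong, simp]: "sets Pd = sets borel" using Pd by (simp add: prob_on_def)

lemma space_Pd [simp]: "space Pd = UNIV" by (rule space_real) simp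

sublocale pr_kernel kern base P\<^sub>0 "mixk Pd" "1 / l" "1 / L" L
proof (rule pr_kernel.intro)
  show "0 < measure P\<^sub>0 {L}" by (rule P0_atoms)
  show "0 < 1 / L" using l_pos l_less by simp
  show "1 / L \<le> kern x L" for x by (simp add: kern_L)
  show "prob_space P\<^sub>0" "sets P\<^sub>0 = sets borel" using P0_on by (simp_all add: prob_on_def)
  show "mixk Pd \<in> borel_measurable borel" by (intro mixk_measurable sets_Pd Pd.prob_space_axioms)
  show "mixk Pd x \<le> 1 / l" for x by (intro mixk_le sets_Pd Pd.prob_space_axioms)
  show "(\<integral>x. mixk Pd x \<partial>base) = 1" by (intro integral_mixk sets_Pd Pd.prob_space_axioms)
qed (rule kern_measurable kern_nonneg kern_le finite_base sets_base integral_kern mixk_nonneg)+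

text \<open>Indices 0 and 1 are reserved for the endpoints, where \<open>P\<^sub>0\<close> has
  atoms; from 2 on they number \<open>n + 1\<close> half-open subintervals of equal length. Charges
  of \<open>P\<^sub>0\<close> are known only for open intervals, and an open interval with the same
  endpoints would lose an atom of \<open>Pd\<close> at the left end. Hence \<open>lo\<close> lies
  one grid step further left, cut off at \<open>l\<close>, and neighbouring sets \<open>cset\<close>
  overlap.\<close>

definition cell :: "nat \<Rightarrow> real \<Rightarrow> nat" where
  "cell n v = (if v \<le> l then 0 else if L \<le> v then 1 else 2 + nat \<lfloor>(v - l) * real (Suc n) / (L - l)\<rfloor>)"

definition grid :: "nat \<Rightarrow> real \<Rightarrow> real" where "grid n t = l + (L - l) * t / real (Suc n)"

definition lo :: "nat \<Rightarrow> nat \<Rightarrow> real" where "lo n j = max l (grid n (real j - 3))"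
definition hi :: "nat \<Rightarrow> nat \<Rightarrow> real" where "hi n j = grid n (real j - 1)"

definition cset :: "nat \<Rightarrow> nat \<Rightarrow> real set" where
  "cset n j = (if j = 0 then {l} else if j = 1 then {L} else {lo n j<..<hi n j})"

text \<open>For the indices in use this is the infimum of \<open>kern x\<close> over
  \<open>cset n j\<close>: beyond \<open>x\<close> the kernel is decreasing in the parameter, and as
  soon as \<open>x\<close> passes \<open>lo n j\<close> some parameter of the set gives 0.\<close>

definition env :: "nat \<Rightarrow> nat \<Rightarrow> real \<Rightarrow> real" where
  "env n j x = (if j = 0 then kern x l else if j = 1 then kern x L else if min x L \<le> lo n j then 1 / hi n j else 0)"

lemma cell_meas [measurable]: "cell n \<in> measurable borel (count_space UNIV)"
  unfolding cell_def by measurable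

lemma cell_le: "cell n v \<le> Suc (Suc n)"
proof -
  have "nat \<lfloor>(v - l) * real (Suc n) / (L - l)\<rfloor> \<le> n" if "l < v" "v < L"
  proof -
    have "(v - l) * real (Suc n) < (L - l) * real (Suc n)" using that by (intro mult_strict_right_mono) auto
    then have "(v - l) * real (Suc n) / (L - l) < real (Suc n)" using l_less by (simp add: field_simps)
    then show ?thesis by linarith
  qed
  then show ?thesis by (auto simp: cell_def)
qed

lemma cell_interior:
  assumes "2 \<le> cell n v"
  shows "l < v" "v < L" "v \<in> {lo n (cell n v)<..<hi n (cell n v)}"
    "v - lo n (cell n v) \<le> 2 * (L - l) / real (Suc n)" "hi n (cell n v) - v \<le> 2 * (L - l) / real (Suc n)"
proof -
  show v: "l < v" "v < L" using assms by (auto simp: cell_def split: if_splits)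
  define s where "s = (v - l) * real (Suc n) / (L - l)"
  define j where "j = \<lfloor>s\<rfloor>"
  have s0: "0 \<le> s" using v l_less by (simp add: s_def)
  have c: "real (cell n v) = 2 + of_int j"
  proof -
    have "cell n v = 2 + nat j" using v by (simp add: cell_def j_def s_def)
    moreover have "0 \<le> j" using s0 by (simp add: j_def)
    ultimately show ?thesis by simp
  qed
  have "(L - l) * s = (v - l) * real (Suc n)" using l_less by (simp add: s_def)
  then have vg: "v = grid n s" by (simp add: grid_def del: of_nat_Suc)
  have mono: "grid n t < grid n t'" if "t < t'" for t t'
    using that l_less by (simp add: grid_def divide_strict_right_mono mult_strict_left_mono)
  have j: "of_int j \<le> s" "s < of_int j + 1" by (auto simp: j_def)
  have diff: "grid n t - grid n t' = (t - t') * (L - l) / real (Suc n)" for t t'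
    by (simp add: grid_def diff_divide_distrib[symmetric] algebra_simps)
  have h: "hi n (cell n v) = grid n (of_int j + 1)" by (simp add: hi_def c add.commute)
  have lo: "lo n (cell n v) = max l (grid n (of_int j - 1))" by (simp add: lo_def c)
  show "v \<in> {lo n (cell n v)<..<hi n (cell n v)}"
    using v mono[of "of_int j - 1" s] mono[of s "of_int j + 1"] j unfolding h lo vg[symmetric] by auto
  have "(s - (of_int j - 1)) * (L - l) / real (Suc n) \<le> 2 * (L - l) / real (Suc n)"
    using j l_less by (intro divide_right_mono mult_right_mono) auto
  then show "v - lo n (cell n v) \<le> 2 * (L - l) / real (Suc n)"
    unfolding lo diff[symmetric] vg[symmetric] by auto
  have "(of_int j + 1 - s) * (L - l) / real (Suc n) \<le> 2 * (L - l) / real (Suc n)"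
    using j l_less by (intro divide_right_mono mult_right_mono) auto
  then show "hi n (cell n v) - v \<le> 2 * (L - l) / real (Suc n)"
    unfolding h diff[symmetric] vg[symmetric] by auto
qed

lemma lo_hi:
  assumes "2 \<le> j" "j \<le> Suc (Suc n)"
  shows "l \<le> lo n j" "lo n j < hi n j" "hi n j \<le> L"
proof -
  show "l \<le> lo n j" by (simp add: lo_def)
  have "grid n (real j - 3) < hi n j"
    using l_less by (simp add: hi_def grid_def divide_strict_right_mono mult_strict_left_mono)
  moreover have "l < hi n j" using assms(1) l_less by (simp add: hi_def grid_def)
  ultimately show "lo n j < hi n j" by (simp add: lo_def)
  have "(L - l) * (real j - 1) \<le> (L - l) * real (Suc n)" using assms l_less by (intro mult_left_mono) auto
  then show "hi n j \<le> L" using l_less by (simp add: hi_def grid_def field_simps)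
qed

lemma env_props:
  assumes "j \<le> Suc (Suc n)"
  shows "env n j \<in> borel_measurable borel" "0 \<le> env n j x" "env n j x \<le> 1 / l"
    "u \<in> cset n j \<Longrightarrow> env n j x \<le> kern x u"
proof -
  show "env n j \<in> borel_measurable borel" unfolding env_def[abs_def] by measurable
  consider "j = 0" | "j = 1" | "2 \<le> j" by linarith
  then show "0 \<le> env n j x" "env n j x \<le> 1 / l"
    using lo_hi[of j n] assms l_pos by (cases; auto simp: env_def kern_nonneg kern_le intro!: frac_le)+
  assume u: "u \<in> cset n j"
  show "env n j x \<le> kern x u"
  proof (cases "2 \<le> j")
    case True
    note lh = lo_hi[OF True assms]
    have "lo n j < u" "u < hi n j" using u True by (auto simp: cset_def)
    then have "clip u = u" "0 < u" using lh l_pos by (auto intro!: clip_id)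
    then show ?thesis using True \<open>lo n j < u\<close> \<open>u < hi n j\<close> kern_nonneg[of x u]
      by (auto simp: env_def kern_def intro!: frac_le)
  next
    case False
    then show ?thesis using u by (auto simp: cset_def env_def split: if_splits)
  qed
qed

lemma cset_charged:
  assumes "j \<le> Suc (Suc n)" "j \<noteq> 1" "0 < measure Pd {v. cell n v = j}"
  shows "0 < measure P\<^sub>0 (cset n j)"
proof (cases "j = 0")
  case False
  then have j2: "2 \<le> j" using assms by simp
  have "measure Pd {v. cell n v = j} \<le> measure Pd {lo n j<..<hi n j}"
    using cell_interior(3)[of n] j2 by (intro Pd.finite_measure_mono) auto
  then show ?thesis using P0_support[OF lo_hi[OF j2 assms(1)]] assms j2 by (simp add: cset_def)
qed (simp add: cset_def P0_atoms)

text \<open>The share \<open>\<delta>\<close> is moved to the atom at \<open>L\<close>, where the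
  kernel is constantly \<open>1 / L\<close>; this bounds the function away from 0 uniformly in
  \<open>n\<close>.\<close>

definition approx :: "real \<Rightarrow> nat \<Rightarrow> real \<Rightarrow> real" where
  "approx \<delta> n x = (1 - \<delta>) * (\<integral>v. env n (cell n v) x \<partial>Pd) + \<delta> * (1 / L)"

lemma integral_cell:
  fixes g :: "nat \<Rightarrow> real"
  shows "(\<integral>v. g (cell n v) \<partial>Pd) = (\<Sum>j\<le>Suc (Suc n). measure Pd {v. cell n v = j} * g j)"
proof -
  have "(\<integral>v. g (cell n v) \<partial>Pd) = (\<integral>v. (\<Sum>j\<le>Suc (Suc n). indicator {v. cell n v = j} v * g j) \<partial>Pd)"
  proof (rule Bochner_Integration.integral_cong[OF refl])
    fix v
    have "(\<Sum>j\<le>Suc (Suc n). indicator {v. cell n v = j} v * g j) = (\<Sum>j\<le>Suc (Suc n). if cell n v = j then g j else 0)"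
      by (intro sum.cong) auto
    also have "\<dots> = g (cell n v)" using cell_le[of n v] by (subst sum.delta') auto
    finally show "g (cell n v) = (\<Sum>j\<le>Suc (Suc n). indicator {v. cell n v = j} v * g j)" ..
  qed
  also have "\<dots> = (\<Sum>j\<le>Suc (Suc n). \<integral>v. indicator {v. cell n v = j} v * g j \<partial>Pd)"
    by (intro Bochner_Integration.integral_sum integrable_mult_left Pd.integrable_const_bound[of _ 1]) auto
  also have "\<dots> = (\<Sum>j\<le>Suc (Suc n). measure Pd {v. cell n v = j} * g j)"
    by simp
  finally show ?thesis .
qed

lemma minorant_approx:
  assumes \<delta>: "0 < \<delta>" "\<delta> < 1"
  shows "minorant (approx \<delta> n)"
proof -
  \<comment> \<open>The cell masses of \<open>Pd\<close>, with the extra share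
    \<open>\<delta>\<close> on index 1, the atom at \<open>L\<close>. Indices of weight 0 are
    removed in \<open>J\<close>, since \<open>P\<^sub>0\<close> is known to charge
    \<open>cset n j\<close> in the interior only if \<open>Pd\<close> charges the cell.\<close>
  define q where "q j = (1 - \<delta>) * measure Pd {v. cell n v = j} + (if j = 1 then \<delta> else 0)" for j
  define J where "J = {j \<in> {..Suc (Suc n)}. 0 < q j}"
  have q0: "0 \<le> q j" for j using \<delta> by (simp add: q_def)
  have sub: "(\<Sum>j\<in>J. q j * g j) = (\<Sum>j\<le>Suc (Suc n). q j * g j)" for g :: "nat \<Rightarrow> real"
  proof (rule sum.mono_neutral_left)
    show "\<forall>i\<in>{..Suc (Suc n)} - J. q i * g i = 0" using q0 by (auto simp: J_def not_less antisym)
  qed (auto simp: J_def)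
  have all: "(\<Sum>j\<le>Suc (Suc n). q j * g j) = (1 - \<delta>) * (\<integral>v. g (cell n v) \<partial>Pd) + \<delta> * g 1" for g :: "nat \<Rightarrow> real"
  proof -
    have "(\<Sum>j\<le>Suc (Suc n). q j * g j) = (\<Sum>j\<le>Suc (Suc n). (1 - \<delta>) * (measure Pd {v. cell n v = j} * g j)
        + (if j = 1 then \<delta> * g j else 0))"
      by (intro sum.cong) (auto simp: q_def algebra_simps)
    also have "\<dots> = (1 - \<delta>) * (\<integral>v. g (cell n v) \<partial>Pd) + \<delta> * g 1"
      unfolding sum.distrib sum_distrib_left[symmetric] integral_cell by (subst sum.delta) auto
    finally show ?thesis .
  qed
  have r: "approx \<delta> n = (\<lambda>x. \<Sum>j\<in>J. q j * env n j x)"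
    unfolding sub all by (auto simp: approx_def env_def[of n "Suc 0"] kern_L)
  have one: "sum q J = 1"
    using sub[of "\<lambda>_. 1"] all[of "\<lambda>_. 1"] Pd.prob_space by (simp del: sum.atMost_Suc)
  have pos: "0 < measure P\<^sub>0 (cset n j)" if "j \<in> J" for j
  proof (cases "j = 1")
    case False
    then have "0 < measure Pd {v. cell n v = j}"
      using that \<delta> by (auto simp: J_def q_def zero_less_mult_iff)
    then show ?thesis using cset_charged[of j n] that False by (simp add: J_def)
  qed (simp add: cset_def P0_atoms)
  have ge: "\<delta> * (1 / L) \<le> approx \<delta> n x" for x
  proof -
    have "0 \<le> (\<integral>v. env n (cell n v) x \<partial>Pd)"
      by (intro Bochner_Integration.integral_nonneg env_props(2) cell_le)
    then show ?thesis using \<delta> by (simp add: approx_def)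
  qed
  show ?thesis
    unfolding minorant_def
  proof (intro exI conjI ballI allI impI)
    show "finite J" by (simp add: J_def)
    show "sum q J = 1" by fact
    show "approx \<delta> n = (\<lambda>x. \<Sum>j\<in>J. q j * env n j x)" by fact
    show "0 < \<delta> * (1 / L)" using \<delta> l_pos l_less by simp
    show "\<delta> * (1 / L) \<le> approx \<delta> n x" for x by fact
    fix j assume j: "j \<in> J"
    then have j': "j \<le> Suc (Suc n)" by (simp add: J_def)
    show "0 \<le> q j" by fact
    show "cset n j \<in> sets borel" by (simp add: cset_def)
    show "0 < measure P\<^sub>0 (cset n j)" by (rule pos[OF j])
    show "env n j \<in> borel_measurable borel" by (rule env_props(1)[OF j'])
    show "0 \<le> env n j x" "env n j x \<le> 1 / l" for x by (rule env_props[OF j'])+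
    show "env n j x \<le> kern x u" if "u \<in> cset n j" for x u by (rule env_props(4)[OF j' that])
  qed
qed

text \<open>As a function of the parameter, the kernel is continuous except for the jump where the
  parameter equals \<open>x\<close>; away from it the shrinking sets force the infimum to the value.
  At the endpoints the envelope is exact for every \<open>n\<close>.\<close>

lemma env_tendsto:
  assumes "v \<noteq> x \<or> v \<le> l \<or> L \<le> v"
  shows "(\<lambda>n. env n (cell n v) x) \<longlonglongrightarrow> kern x v"
proof -
  consider "v \<le> l" | "L \<le> v" "l < v" | "l < v" "v < L" by linarith
  then show ?thesis
  proof cases
    case 3
    have z: "(\<lambda>n. 2 * (L - l) / real (Suc n)) \<longlonglongrightarrow> 0"
      using LIMSEQ_Suc[OF lim_const_over_n[of "2 * (L - l)"]] by simp
    have c2: "2 \<le> cell n v" for n using 3 by (simp add: cell_def)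
    note ci = cell_interior[OF c2]
    have lo_lim: "(\<lambda>n. lo n (cell n v)) \<longlonglongrightarrow> v"
    proof (rule tendsto_sandwich[OF always_eventually always_eventually])
      show "\<forall>n. v - 2 * (L - l) / real (Suc n) \<le> lo n (cell n v)" using ci(4) by (simp add: algebra_simps)
      show "\<forall>n. lo n (cell n v) \<le> v" using ci(3) by (auto intro: less_imp_le)
      show "(\<lambda>n. v - 2 * (L - l) / real (Suc n)) \<longlonglongrightarrow> v" using tendsto_diff[OF tendsto_const z, of v] by simp
    qed auto
    have hi_lim: "(\<lambda>n. hi n (cell n v)) \<longlonglongrightarrow> v"
    proof (rule tendsto_sandwich[OF always_eventually always_eventually])
      show "\<forall>n. hi n (cell n v) \<le> v + 2 * (L - l) / real (Suc n)" using ci(5) by (simp add: algebra_simps)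
      show "\<forall>n. v \<le> hi n (cell n v)" using ci(3) by (auto intro: less_imp_le)
      show "(\<lambda>n. v + 2 * (L - l) / real (Suc n)) \<longlonglongrightarrow> v" using tendsto_add[OF tendsto_const z, of v] by simp
    qed auto
    have cv: "clip v = v" using 3 by (simp add: clip_id)
    have env_eq: "env n (cell n v) x = (if min x L \<le> lo n (cell n v) then 1 / hi n (cell n v) else 0)" for n
      using c2[of n] by (auto simp: env_def)
    have "v \<noteq> min x L" using assms 3 by (auto simp: min_def)
    then consider "min x L < v" | "v < min x L" by linarith
    then show ?thesis
    proof cases
      case 1
      have "(\<lambda>n. 1 / hi n (cell n v)) \<longlonglongrightarrow> 1 / v"
        using hi_lim 3 l_pos by (intro tendsto_divide tendsto_const) auto
      moreover have "\<forall>\<^sub>F n in sequentially. 1 / hi n (cell n v) = env n (cell n v) x"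
        using order_tendstoD(1)[OF lo_lim 1] by eventually_elim (simp add: env_eq)
      ultimately have "(\<lambda>n. env n (cell n v) x) \<longlonglongrightarrow> 1 / v" by (rule Lim_transform_eventually)
      then show ?thesis using 1 by (simp add: kern_def cv)
    next
      case 2
      have "env n (cell n v) x = 0" for n
        using ci(3)[of n] 2 by (auto simp: env_eq)
      moreover have "kern x v = 0" using 2 by (auto simp: kern_def cv)
      ultimately show ?thesis by simp
    qed
  next
    case 1
    then have "kern x v = kern x l" using l_less by (auto simp: kern_def clip_def)
    then show ?thesis using 1 by (simp add: cell_def env_def)
  next
    case 2
    then have "kern x v = kern x L" using l_less by (simp add: kern_def clip_def)
    then show ?thesis using 2 by (simp add: cell_def env_def)
  qed
qed

text \<open>\<open>Pd\<close> has at most countably many atoms, and above \<open>l\<close> the base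
  measure is Lebesgue measure. The atom of the base measure at \<open>l\<close> does no harm, since
  for \<open>x \<le> l\<close> the kernel has no jump inside the interval.\<close>

lemma AE_base_no_atom: "AE x in base. x \<le> l \<or> measure Pd {x} = 0"
proof -
  define C where "C = {x. l < x \<and> measure Pd {x} \<noteq> 0}"
  have count: "countable C"
    by (rule countable_subset[OF _ Pd.countable_support]) (auto simp: C_def)
  then have CB: "C \<in> sets borel" by (rule sets.countable[rotated]) auto
  have "AE x in lborel. x \<notin> C"
    by (rule AE_not_in[OF countable_imp_null_set_lborel[OF count]])
  then have "AE x in leb. max l x \<notin> C"
    unfolding leb_def by (subst AE_density) (auto simp: C_def max_def)
  then have "AE x in base. x \<notin> C"
    unfolding base_def using CB by (subst AE_distr_iff) auto
  then show ?thesis by (auto simp: C_def not_less)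
qed

lemma approx_tendsto:
  assumes x: "x \<le> l \<or> measure Pd {x} = 0"
  shows "(\<lambda>n. approx \<delta> n x) \<longlonglongrightarrow> (1 - \<delta>) * mixk Pd x + \<delta> * (1 / L)"
proof -
  have "AE v in Pd. v \<noteq> x \<or> v \<le> l \<or> L \<le> v"
  proof (cases "x \<le> l")
    case False
    then have "emeasure Pd {x} = 0" using x by (simp add: Pd.emeasure_eq_measure)
    then have "AE v in Pd. v \<noteq> x" by (intro AE_I[of _ _ "{x}"]) auto
    then show ?thesis by eventually_elim auto
  qed auto
  then have "AE v in Pd. (\<lambda>n. env n (cell n v) x) \<longlonglongrightarrow> kern x v"
    by eventually_elim (rule env_tendsto)
  then have "(\<lambda>n. \<integral>v. env n (cell n v) x \<partial>Pd) \<longlonglongrightarrow> mixk Pd x"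
    unfolding mixk_def
    by (intro integral_dominated_convergence[where w="\<lambda>_. 1 / l"])
       (simp_all add: abs_of_nonneg[OF env_props(2)[OF cell_le]] env_props(3)[OF cell_le])
  then show ?thesis unfolding approx_def by (intro tendsto_intros)
qed

lemma exists_minorant:
  assumes "0 < \<epsilon>"
  shows "\<exists>r. minorant r \<and> KLd r \<le> \<epsilon>"
proof -
  \<comment> \<open>Chosen so that \<open>- ln (1 - \<delta>) = \<epsilon> / 2\<close>. The limit
    \<open>r\<close> of the approximations is at least \<open>(1 - \<delta>) * mixk Pd\<close>, so
    its divergence is at most this; the other half of \<open>\<epsilon>\<close> pays for stopping at
    a finite \<open>n\<close>.\<close>
  define \<delta> where "\<delta> = 1 - exp (- \<epsilon> / 2)"
  have \<delta>: "0 < \<delta>" "\<delta> < 1" "ln (1 - \<delta>) = - \<epsilon> / 2" using assms by (auto simp: \<delta>_def)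
  have L0: "0 < \<delta> * (1 / L)" using \<delta> l_pos l_less by simp
  define r where "r x = (1 - \<delta>) * mixk Pd x + \<delta> * (1 / L)" for x
  have a_ge: "\<delta> * (1 / L) \<le> approx \<delta> n x" for n x
  proof -
    have "0 \<le> (\<integral>v. env n (cell n v) x \<partial>Pd)"
      by (intro Bochner_Integration.integral_nonneg env_props(2) cell_le)
    then show ?thesis using \<delta> by (simp add: approx_def)
  qed
  have a_le: "approx \<delta> n x \<le> 1 / l + 1 / L" for n x
  proof -
    define I where "I = (\<integral>v. env n (cell n v) x \<partial>Pd)"
    have I0: "0 \<le> I" unfolding I_def by (intro Bochner_Integration.integral_nonneg env_props(2) cell_le)
    have "I \<le> (\<integral>v. 1 / l \<partial>Pd)"
      unfolding I_def
    proof (rule integral_mono)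
      show "integrable Pd (\<lambda>v. env n (cell n v) x)"
        using env_props(2,3)[OF cell_le]
        by (intro Pd.integrable_const_bound[of _ "1 / l"]) (simp_all only: real_norm_def abs_of_nonneg AE_I2, measurable)
    qed (auto simp: env_props(3)[OF cell_le])
    then have "I \<le> 1 / l" by (simp add: Pd.prob_space[unfolded space_Pd])
    moreover have "(1 - \<delta>) * I \<le> 1 * I" using \<delta> I0 by (intro mult_right_mono) auto
    moreover have "\<delta> * (1 / L) \<le> 1 * (1 / L)" using \<delta> l_pos l_less by (intro mult_right_mono) auto
    ultimately show ?thesis unfolding approx_def I_def[symmetric] by linarith
  qed
  have [measurable]: "approx \<delta> n \<in> borel_measurable borel" for n
  proof -
    have "(\<lambda>p. env n (cell n (snd p)) (fst p)) \<in> borel_measurable (borel \<Otimes>\<^sub>M borel)"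
    proof (rule measurable_compose_countable[of "\<lambda>j p. env n j (fst p)" _ _ "\<lambda>p. cell n (snd p)"])
      show "(\<lambda>p. env n j (fst p)) \<in> borel_measurable (borel \<Otimes>\<^sub>M borel)" for j
        unfolding env_def by measurable
    qed measurable
    then have [measurable]: "(\<lambda>p. env n (cell n (snd p)) (fst p)) \<in> borel_measurable (borel \<Otimes>\<^sub>M Pd)"
      by (simp cong: measurable_cong_sets)
    show ?thesis unfolding approx_def[abs_def] by measurable
  qed
  have [measurable]: "r \<in> borel_measurable borel" unfolding r_def[abs_def] by measurable
  have r_ge: "\<delta> * (1 / L) \<le> r x" for x using \<delta> mixk_nonneg[of Pd x] by (simp add: r_def)
  have r_pos: "0 < r x" for x using r_ge[of x] L0 by linarith
  have lim: "(\<lambda>n. KLd (approx \<delta> n)) \<longlonglongrightarrow> KLd r"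
    unfolding KLd_def
  proof (rule integral_dominated_convergence)
    show "AE x in base. (\<lambda>n. mixk Pd x * ln (mixk Pd x / approx \<delta> n x)) \<longlonglongrightarrow> mixk Pd x * ln (mixk Pd x / r x)"
      using AE_base_no_atom
    proof eventually_elim
      case (elim x)
      note lim = approx_tendsto[OF elim, of \<delta>, folded r_def]
      show ?case
      proof (cases "mixk Pd x = 0")
        case False
        then show ?thesis using r_pos[of x] by (intro tendsto_mult tendsto_ln tendsto_divide tendsto_const lim) auto
      qed simp
    qed
    show "AE x in base. norm (mixk Pd x * ln (mixk Pd x / approx \<delta> n x))
        \<le> \<bar>1 / l + 1 / L\<bar> + \<bar>1 / l * (1 / l / (\<delta> * (1 / L)))\<bar>" for n
      using KLd_integrand_bound[OF L0 a_ge a_le] by simp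
    show "integrable base (\<lambda>x. \<bar>1 / l + 1 / L\<bar> + \<bar>1 / l * (1 / l / (\<delta> * (1 / L)))\<bar>)"
      by (rule lam.integrable_const)
  qed measurable
  have "KLd r \<le> \<epsilon> / 2"
  proof -
    have "r x \<le> 1 / l + 1 / L" for x
    proof -
      have "(1 - \<delta>) * mixk Pd x \<le> 1 * mixk Pd x" using \<delta> mixk_nonneg by (intro mult_right_mono) auto
      moreover have "\<delta> * (1 / L) \<le> 1 * (1 / L)" using \<delta> l_pos l_less by (intro mult_right_mono) auto
      ultimately show ?thesis using md_le[of x] unfolding r_def by linarith
    qed
    then have int: "integrable base (\<lambda>x. mixk Pd x * ln (mixk Pd x / r x))"
      by (intro integrable_KLd[OF _ L0 r_ge]) auto
    have "KLd r \<le> (\<integral>x. mixk Pd x * (\<epsilon> / 2) \<partial>base)"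
      unfolding KLd_def
    proof (rule integral_mono[OF int])
      show "integrable base (\<lambda>x. mixk Pd x * (\<epsilon> / 2))" by (intro integrable_mult_left integrable_md)
      fix x
      show "mixk Pd x * ln (mixk Pd x / r x) \<le> mixk Pd x * (\<epsilon> / 2)"
      proof (cases "mixk Pd x = 0")
        case False
        then have m: "0 < mixk Pd x" using mixk_nonneg[of Pd x] by linarith
        have "(1 - \<delta>) * mixk Pd x \<le> r x" using L0 by (simp add: r_def)
        then have "ln ((1 - \<delta>) * mixk Pd x) \<le> ln (r x)" using \<delta> m r_pos[of x] by (intro ln_mono) auto
        then have "- (\<epsilon> / 2) + ln (mixk Pd x) \<le> ln (r x)" using \<delta> m by (simp add: ln_mult)
        then have "ln (mixk Pd x / r x) \<le> \<epsilon> / 2" using m r_pos[of x] by (simp add: ln_div)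
        then show ?thesis using m by (intro mult_left_mono) auto
      qed simp
    qed
    then show ?thesis by (simp add: md_norm)
  qed
  then have "KLd r < \<epsilon>" using assms by linarith
  from order_tendstoD(2)[OF lim this] have "\<forall>\<^sub>F n in sequentially. KLd (approx \<delta> n) < \<epsilon>" .
  then obtain n where "KLd (approx \<delta> n) < \<epsilon>" by (auto simp: eventually_sequentially)
  then show ?thesis using minorant_approx[OF \<delta>(1,2)] by (intro exI[of _ "approx \<delta> n"]) auto
qed

end


section \<open>From the kernel back to the densities\<close>

text \<open>By Gibbs' inequality the negative part of the integrand is at most \<open>g\<close>,
  which is integrable. Failure of integrability must therefore come from the positive part.\<close>

lemma KL_eq_infinity:
  assumes [measurable]: "f \<in> borel_measurable borel" "g \<in> borel_measurable borel"
    and f: "\<And>x. 0 \<le> f x" "integrable lborel f" and g: "\<And>x. 0 \<le> g x" "integrable lborel g"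
    and zero: "\<And>x. g x = 0 \<Longrightarrow> f x = 0"
    and h: "\<not> integrable lborel (\<lambda>x. f x * ln (f x / g x))"
  shows "KL f g = \<infinity>"
proof -
  let ?h = "\<lambda>x. f x * ln (f x / g x)"
  have *: "KL_integrand (f x) (g x) = ereal (?h x)" for x
    using zero[of x] by (auto simp: KL_integrand_def zero_ereal_def)
  have "- ?h x \<le> g x" for x
  proof (cases "g x = 0")
    case False
    then have "0 < g x" using g(1)[of x] by linarith
    from gibbs_pointwise(1)[OF f(1)[of x] this] f(1)[of x] show ?thesis by linarith
  qed (simp add: zero)
  then have "(\<integral>\<^sup>+x. ennreal (- ?h x) \<partial>lborel) \<le> (\<integral>\<^sup>+x. ennreal (g x) \<partial>lborel)"
    by (intro nn_integral_mono ennreal_leI)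
  also have "\<dots> < \<infinity>" using g by (simp add: nn_integral_eq_integral less_top)
  finally have neg: "(\<integral>\<^sup>+x. ennreal (- ?h x) \<partial>lborel) < \<infinity>" .
  then have pos: "(\<integral>\<^sup>+x. ennreal (?h x) \<partial>lborel) = \<infinity>"
    using h unfolding real_integrable_def by (auto simp: less_top[symmetric])
  obtain q where q: "0 \<le> q" "(\<integral>\<^sup>+x. ennreal (- ?h x) \<partial>lborel) = ennreal q"
    using neg by (cases "\<integral>\<^sup>+x. ennreal (- ?h x) \<partial>lborel") auto
  show ?thesis
    unfolding KL_def * uminus_ereal.simps e2ennreal_ereal pos q(2) using q(1) by simp
qed

text \<open>The derivative of \<open>u * cts_step x y u\<close>: averaging it over \<open>{0..u}\<close>, as the uniform kernel
  does, gives back \<open>cts_step x y u\<close>. This expresses the integrals of the test functions for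
  weak convergence through the mixture density.\<close>

definition cts_deriv :: "real \<Rightarrow> real \<Rightarrow> real \<Rightarrow> real" where
  "cts_deriv x y t = (if t \<le> x then 1 else if y \<le> t then 0 else (y - 2 * t) / (y - x))"

lemma cts_deriv_meas [measurable]: "cts_deriv x y \<in> borel_measurable borel"
  unfolding cts_deriv_def[abs_def] by measurable

lemma cts_deriv_bound:
  assumes "x < y"
  shows "\<bar>cts_deriv x y t\<bar> \<le> 1 + 3 * (\<bar>x\<bar> + \<bar>y\<bar>) / (y - x)"
proof -
  have "0 \<le> 3 * (\<bar>x\<bar> + \<bar>y\<bar>) / (y - x)" using assms by simp
  moreover have "\<bar>(y - 2 * t) / (y - x)\<bar> \<le> 3 * (\<bar>x\<bar> + \<bar>y\<bar>) / (y - x)" if "x < t" "t < y"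
  proof -
    have "\<bar>y - 2 * t\<bar> \<le> 3 * (\<bar>x\<bar> + \<bar>y\<bar>)" 
    proof -
      have "y - 2 * t \<le> 3 * (p + q) \<and> 2 * t - y \<le> 3 * (p + q)"
        if "x \<le> p" "- x \<le> p" "y \<le> q" "- y \<le> q" for p q
        using that \<open>x < t\<close> \<open>t < y\<close> by (simp add: distrib_left)
      from this[of "\<bar>x\<bar>" "\<bar>y\<bar>"] show ?thesis by (simp add: abs_le_iff)
    qed
    then show ?thesis using assms by (simp add: divide_right_mono)
  qed
  ultimately show ?thesis unfolding cts_deriv_def by auto
qed

lemma integral_cts_deriv:
  assumes xy: "x < y" and u: "0 < u"
  shows "(\<integral>t. indicator {0..u} t * cts_deriv x y t \<partial>lborel) = u * cts_step x y u"
proof -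
  let ?H = "\<lambda>t. t * cts_step x y t"
  have "(cts_deriv x y has_integral (?H u - ?H 0)) {0..u}"
  proof (rule fundamental_theorem_of_calculus_interior_strong[of "{x, y}"])
    fix t assume t: "t \<in> {0<..<u} - {x, y}"
    consider "t < x" | "x < t" "t < y" | "y < t" using t by force
    then show "(?H has_vector_derivative cts_deriv x y t) (at t)"
    proof cases
      case 1
      have "((\<lambda>t. t) has_real_derivative 1) (at t)" by (auto intro!: derivative_eq_intros)
      then have "(?H has_real_derivative 1) (at t)"
        by (rule has_field_derivative_transform_within_open[of _ _ _ "{..<x}"]) (use 1 in \<open>auto simp: cts_step_def\<close>)
      then show ?thesis using 1 by (simp add: cts_deriv_def has_real_derivative_iff_has_vector_derivative)
    next
      case 2
      have "((\<lambda>t. t * (y - t)) has_real_derivative y - 2 * t) (at t)"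
        by (auto intro!: derivative_eq_intros simp: algebra_simps)
      from DERIV_cdivide[OF this, of "y - x"] have "(?H has_real_derivative ((y - 2 * t) / (y - x))) (at t)"
        by (rule has_field_derivative_transform_within_open[of _ _ _ "{x<..<y}"]) (use 2 in \<open>auto simp: cts_step_def\<close>)
      then show ?thesis using 2 by (simp add: cts_deriv_def has_real_derivative_iff_has_vector_derivative)
    next
      case 3
      have "((\<lambda>t. 0) has_real_derivative 0) (at t)" by (auto intro!: derivative_eq_intros)
      then have "(?H has_real_derivative 0) (at t)"
        by (rule has_field_derivative_transform_within_open[of _ _ _ "{y<..}"]) (use 3 xy in \<open>auto simp: cts_step_def\<close>)
      then show ?thesis using 3 xy by (simp add: cts_deriv_def has_real_derivative_iff_has_vector_derivative)
    qed
  next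
    have "continuous_on {0..u} (cts_step x y)"
      using cts_step_uniformly_continuous[OF xy] uniformly_continuous_imp_continuous continuous_on_subset by blast
    then show "continuous_on {0..u} ?H" by (intro continuous_intros)
  qed (use u in auto)
  then have 1: "integral {0..u} (cts_deriv x y) = u * cts_step x y u" by (simp add: integral_unique)
  have "set_integrable lborel {0..u} (cts_deriv x y)"
    unfolding set_integrable_def
  proof (rule Bochner_Integration.integrable_bound)
    show "integrable lborel (\<lambda>t. indicator {0..u} t * (1 + 3 * (\<bar>x\<bar> + \<bar>y\<bar>) / (y - x)))"
      using u by (intro integrable_mult_left integrable_real_indicator) auto
    show "AE t in lborel. norm (indicator {0..u} t *\<^sub>R cts_deriv x y t)
        \<le> norm (indicator {0..u} t * (1 + 3 * (\<bar>x\<bar> + \<bar>y\<bar>) / (y - x)))"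
      using cts_deriv_bound[OF xy]
      by (intro AE_I2) (auto split: split_indicator intro: order_trans abs_ge_self)
  qed measurable
  from set_borel_integral_eq_integral(2)[OF this] 1 show ?thesis
    by (simp add: set_lebesgue_integral_def)
qed

section \<open>Weak and total variation distances bounded by the L1 distance of mixtures\<close>

context interval
begin

text \<open>By Fubini, since the kernel average of \<open>cts_deriv x y\<close> is
  \<open>cts_step x y (clip u)\<close> and \<open>P\<close> lives where \<open>clip\<close> is the
  identity.\<close>

lemma integral_cts_step:
  assumes xy: "x < y" and P: "prob_on {l..L} P"
  shows "(\<integral>u. cts_step x y u \<partial>P) = (\<integral>t. cts_deriv x y t * mixk P t \<partial>leb)"
proof -
  interpret prob_space P using P by (simp add: prob_on_def)
  have [measurable_cong]: "sets P = sets borel" using P by (simp add: prob_on_def)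
  have inner: "(\<integral>t. cts_deriv x y t * kern t u \<partial>leb) = cts_step x y (clip u)" for u
  proof -
    have "(\<integral>t. cts_deriv x y t * kern t u \<partial>leb) = (\<integral>t. indicator {0..L} t * (cts_deriv x y t * kern t u) \<partial>lborel)"
      by (intro integral_leb) measurable
    also have "\<dots> = (\<integral>t. 1 / clip u * (indicator {0..clip u} t * cts_deriv x y t) \<partial>lborel)"
      using clip_bounds[of u] by (intro Bochner_Integration.integral_cong) (auto simp: kern_def indicator_def)
    also have "\<dots> = cts_step x y (clip u)"
      using clip_bounds(3)[of u] by (simp add: integral_cts_deriv[OF xy])
    finally show ?thesis .
  qed
  have [measurable]: "cts_step x y \<in> borel_measurable borel"
    unfolding cts_step_def[abs_def] by measurable
  have [measurable]: "clip \<in> borel_measurable borel"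
    unfolding clip_def[abs_def] by measurable
  have "AE u in P. cts_step x y u = cts_step x y (clip u)"
    using AE_prob_on[OF P] by eventually_elim (simp add: clip_id)
  then have "(\<integral>u. cts_step x y u \<partial>P) = (\<integral>u. cts_step x y (clip u) \<partial>P)"
    by (intro Bochner_Integration.integral_cong_AE) measurable
  also have "\<dots> = (\<integral>u. (\<integral>t. cts_deriv x y t * kern t u \<partial>leb) \<partial>P)" by (simp add: inner)
  also have "\<dots> = (\<integral>t. (\<integral>u. cts_deriv x y t * kern t u \<partial>P) \<partial>leb)"
  proof (rule Fubini_bounded[OF finite_measure_axioms finite_leb])
    show "\<bar>cts_deriv x y t * kern t u\<bar> \<le> (1 + 3 * (\<bar>x\<bar> + \<bar>y\<bar>) / (y - x)) * (1 / l)" for t u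
      unfolding abs_mult using kern_nonneg[of t u] kern_le[of t u] cts_deriv_bound[OF xy, of t]
      by (intro mult_mono) auto
  qed measurable
  finally show ?thesis by (simp add: mixk_def)
qed

lemma integrable_leb_bounded: "g \<in> borel_measurable borel \<Longrightarrow> (\<And>x. \<bar>g x\<bar> \<le> B) \<Longrightarrow> integrable leb g"
  for g :: "real \<Rightarrow> real" by (rule finite_measure.integrable_const_bound[OF finite_leb, of _ B]) auto

context
  fixes P Q :: "real measure"
  assumes P: "prob_on {l..L} P" and Q: "prob_on {l..L} Q"
begin

lemma mixk_PQ_meas [measurable]: "mixk P \<in> borel_measurable borel" "mixk Q \<in> borel_measurable borel"
  using P Q by (auto intro: mixk_measurable simp: prob_on_def)

lemma mixk_diff_bound: "\<bar>mixk P x - mixk Q x\<bar> \<le> 1 / l"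
  using P Q mixk_nonneg[of P x] mixk_nonneg[of Q x] mixk_le[of P x] mixk_le[of Q x]
  unfolding prob_on_def by (auto simp: abs_le_iff)

lemma integrable_mixk_diff: "integrable leb (\<lambda>x. \<bar>mixk P x - mixk Q x\<bar>)"
  by (rule integrable_leb_bounded[of _ "1 / l"]) (auto simp: mixk_diff_bound)

text \<open>Both mixtures are constant on \<open>{0..l}\<close>, so collapsing that interval leaves
  their distance unchanged.\<close>

lemma L1_leb_base: "(\<integral>x. \<bar>mixk P x - mixk Q x\<bar> \<partial>base) = (\<integral>x. \<bar>mixk P x - mixk Q x\<bar> \<partial>leb)"
  by (subst integral_base) (auto simp: mixk_max)

lemma cts_step_diff_le:
  assumes xy: "x < y"
  shows "\<bar>(\<integral>u. cts_step x y u \<partial>P) - (\<integral>u. cts_step x y u \<partial>Q)\<bar>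
    \<le> (1 + 3 * (\<bar>x\<bar> + \<bar>y\<bar>) / (y - x)) * (\<integral>x. \<bar>mixk P x - mixk Q x\<bar> \<partial>base)"
proof -
  let ?C = "1 + 3 * (\<bar>x\<bar> + \<bar>y\<bar>) / (y - x)"
  have i: "integrable leb (\<lambda>t. cts_deriv x y t * mixk R t)" if R: "prob_on {l..L} R" "mixk R \<in> borel_measurable borel" for R
  proof (rule integrable_leb_bounded[of _ "?C * (1 / l)"])
    show "\<bar>cts_deriv x y t * mixk R t\<bar> \<le> ?C * (1 / l)" for t
      unfolding abs_mult using R cts_deriv_bound[OF xy, of t] mixk_nonneg[of R t] mixk_le[of R t]
      by (intro mult_mono) (auto simp: prob_on_def)
  qed (use R in measurable)
  have "\<bar>(\<integral>u. cts_step x y u \<partial>P) - (\<integral>u. cts_step x y u \<partial>Q)\<bar>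
      = \<bar>\<integral>t. cts_deriv x y t * mixk P t - cts_deriv x y t * mixk Q t \<partial>leb\<bar>"
    using i[OF P] i[OF Q] by (simp add: integral_cts_step[OF xy] P Q)
  also have "\<dots> \<le> (\<integral>t. \<bar>cts_deriv x y t * mixk P t - cts_deriv x y t * mixk Q t\<bar> \<partial>leb)"
    by (rule integral_abs_bound)
  also have "\<dots> \<le> (\<integral>t. ?C * \<bar>mixk P t - mixk Q t\<bar> \<partial>leb)"
  proof (rule integral_mono)
    show "integrable leb (\<lambda>t. \<bar>cts_deriv x y t * mixk P t - cts_deriv x y t * mixk Q t\<bar>)"
      by (intro integrable_abs Bochner_Integration.integrable_diff i P Q mixk_PQ_meas)
    show "integrable leb (\<lambda>t. ?C * \<bar>mixk P t - mixk Q t\<bar>)"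
      by (intro integrable_mult_right integrable_mixk_diff)
    show "\<bar>cts_deriv x y t * mixk P t - cts_deriv x y t * mixk Q t\<bar> \<le> ?C * \<bar>mixk P t - mixk Q t\<bar>" for t
      unfolding right_diff_distrib[symmetric] abs_mult by (intro mult_right_mono cts_deriv_bound xy) auto
  qed
  finally show ?thesis by (simp add: L1_leb_base)
qed

lemma tv_dist_le:
  "0 \<le> tv_dist (mix P) (mix Q)" "tv_dist (mix P) (mix Q) \<le> (\<integral>x. \<bar>mixk P x - mixk Q x\<bar> \<partial>base)"
proof -
  have m: "measure (density lborel (\<lambda>x. ennreal (mix R x))) A = (\<integral>x. indicator A x * mixk R x \<partial>leb)"
    if [measurable]: "A \<in> sets borel" "mixk R \<in> borel_measurable borel" and R: "prob_on {l..L} R" for A R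
  proof -
    have eq: "mix R = (\<lambda>x. indicator {0..L} x * mixk R x)" by (rule ext) (rule mix_eq_mixk[OF R])
    have i: "integrable lborel (\<lambda>x. indicator {0..L} x * (indicator A x * mixk R x))"
      using R mixk_nonneg[of R] mixk_le[of R]
      by (subst integrable_leb_iff[symmetric]) (auto intro!: integrable_leb_bounded[of _ "1 / l"] simp: indicator_def prob_on_def l_pos less_imp_le)
    have "emeasure (density lborel (\<lambda>x. ennreal (mix R x))) A
        = (\<integral>\<^sup>+x. ennreal (indicator {0..L} x * (indicator A x * mixk R x)) \<partial>lborel)"
      unfolding eq by (subst emeasure_density) (auto intro!: nn_integral_cong split: split_indicator)
    also have "\<dots> = ennreal (\<integral>x. indicator {0..L} x * (indicator A x * mixk R x) \<partial>lborel)"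
      using i by (intro nn_integral_eq_integral) (auto simp: mixk_nonneg)
    finally have "emeasure (density lborel (\<lambda>x. ennreal (mix R x))) A = ennreal (\<integral>x. indicator A x * mixk R x \<partial>leb)"
      by (subst integral_leb) auto
    then show ?thesis
      by (simp add: measure_def Bochner_Integration.integral_nonneg mixk_nonneg)
  qed
  let ?D = "\<integral>x. \<bar>mixk P x - mixk Q x\<bar> \<partial>base"
  have bd: "\<bar>measure (density lborel (\<lambda>x. ennreal (mix P x))) A - measure (density lborel (\<lambda>x. ennreal (mix Q x))) A\<bar> \<le> ?D"
    if A [measurable]: "A \<in> sets borel" for A
  proof -
    have i: "integrable leb (\<lambda>x. indicator A x * mixk R x)" if "prob_on {l..L} R" and [measurable]: "mixk R \<in> borel_measurable borel" for R
      using that mixk_nonneg[of R] mixk_le[of R]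
      by (intro integrable_leb_bounded[of _ "1 / l"]) (auto simp: indicator_def prob_on_def l_pos less_imp_le)
    have "\<bar>measure (density lborel (\<lambda>x. ennreal (mix P x))) A - measure (density lborel (\<lambda>x. ennreal (mix Q x))) A\<bar>
       = \<bar>\<integral>x. indicator A x * mixk P x - indicator A x * mixk Q x \<partial>leb\<bar>"
      using i[OF P] i[OF Q] by (simp add: m P Q)
    also have "\<dots> \<le> (\<integral>x. \<bar>indicator A x * mixk P x - indicator A x * mixk Q x\<bar> \<partial>leb)"
      by (rule integral_abs_bound)
    also have "\<dots> \<le> (\<integral>x. \<bar>mixk P x - mixk Q x\<bar> \<partial>leb)"
      using i[OF P] i[OF Q] integrable_mixk_diff by (intro integral_mono) (auto split: split_indicator)
    finally show ?thesis by (simp add: L1_leb_base)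
  qed
  show "tv_dist (mix P) (mix Q) \<le> ?D"
    unfolding tv_dist_def by (rule cSUP_least) (use bd in auto)
  have "bdd_above ((\<lambda>A. \<bar>measure (density lborel (\<lambda>x. ennreal (mix P x))) A
      - measure (density lborel (\<lambda>x. ennreal (mix Q x))) A\<bar>) ` sets borel)"
    using bd by (intro bdd_aboveI2[of _ _ ?D]) auto
  then show "0 \<le> tv_dist (mix P) (mix Q)"
    unfolding tv_dist_def by (rule cSUP_upper2[of _ _ "{}"]) auto
qed

end

end

section \<open>Observations seen through their maximum with \<open>l\<close>\<close>

locale uniform_obs = uniform_model +
  fixes f :: "real \<Rightarrow> real"
  assumes f_meas [measurable]: "f \<in> borel_measurable borel"
    and f_nonneg: "\<And>x. 0 \<le> f x" and f_zero: "\<And>x. x \<notin> {0..L} \<Longrightarrow> f x = 0"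
    and f_one: "(\<integral>\<^sup>+x. ennreal (f x) \<partial>lborel) = 1"
    and f_eq: "\<And>x. l < x \<Longrightarrow> x \<le> L \<Longrightarrow> f x = mixk Pd x"
begin

text \<open>Above \<open>l\<close> the two densities agree. Both laws have mass 1, so they also give
  equal mass to \<open>{0..l}\<close>, and how \<open>f\<close> spreads it there is forgotten when
  that interval is sent to the point \<open>l\<close>.\<close>

lemma distr_max: "distr (density lborel (\<lambda>x. ennreal (f x))) borel (max l) = density base (\<lambda>x. ennreal (mixk Pd x))"
proof (rule measure_eqI)
  fix A assume "A \<in> sets (distr (density lborel (\<lambda>x. ennreal (f x))) borel (max l))"
  then have [measurable]: "A \<in> sets borel" by simp
  define m where "m x = indicator {0..L} x * mixk Pd x" for x
  have [measurable]: "m \<in> borel_measurable borel" unfolding m_def[abs_def] by measurable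
  let ?R = "\<lambda>A. \<integral>\<^sup>+x. ennreal (indicator {l<..L} x * mixk Pd x) * indicator A x \<partial>lborel"
  let ?I = "\<lambda>h. \<integral>\<^sup>+x. ennreal (h x) * indicator {0..l} x \<partial>lborel"
  have split: "(\<integral>\<^sup>+x. ennreal (h x) * indicator (max l -` B) x \<partial>lborel) = (if l \<in> B then ?I h else 0) + ?R (max l -` B)"
    if [measurable]: "h \<in> borel_measurable borel" "B \<in> sets borel" and h: "\<And>x. x \<notin> {0..L} \<Longrightarrow> h x = 0"
      "\<And>x. l < x \<Longrightarrow> x \<le> L \<Longrightarrow> h x = mixk Pd x" for h B
  proof -
    have [measurable]: "max l -` B \<in> sets borel" using measurable_sets_borel[of "max l" borel B] by simp
    have "(\<integral>\<^sup>+x. ennreal (h x) * indicator (max l -` B) x \<partial>lborel)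
        = (\<integral>\<^sup>+x. indicator B l * (ennreal (h x) * indicator {0..l} x)
            + ennreal (indicator {l<..L} x * mixk Pd x) * indicator (max l -` B) x \<partial>lborel)"
    proof (rule nn_integral_cong)
      fix x
      consider "x < 0" | "0 \<le> x" "x \<le> l" | "l < x" "x \<le> L" | "L < x" by linarith
      then show "ennreal (h x) * indicator (max l -` B) x = indicator B l * (ennreal (h x) * indicator {0..l} x)
            + ennreal (indicator {l<..L} x * mixk Pd x) * indicator (max l -` B) x"
        using h[of x] l_pos l_less by cases (auto simp: indicator_def max_def)
    qed
    also have "\<dots> = indicator B l * ?I h + ?R (max l -` B)"
      by (subst nn_integral_add) (auto simp: nn_integral_cmult)
    finally show ?thesis by (auto simp: indicator_def)
  qed
  have m0: "m x = 0" if "x \<notin> {0..L}" for x using that by (simp add: m_def)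
  have m1: "m x = mixk Pd x" if "l < x" "x \<le> L" for x using that l_pos by (simp add: m_def)
  have im: "(\<integral>\<^sup>+x. ennreal (m x) * indicator (max l -` B) x \<partial>lborel) = emeasure (density base (\<lambda>x. ennreal (mixk Pd x))) B"
    if [measurable]: "B \<in> sets borel" for B
  proof -
    have "emeasure (density base (\<lambda>x. ennreal (mixk Pd x))) B
        = (\<integral>\<^sup>+x. ennreal (mixk Pd (max l x)) * indicator B (max l x) \<partial>leb)"
      by (subst emeasure_density) (auto simp: base_def nn_integral_distr)
    also have "\<dots> = (\<integral>\<^sup>+x. ennreal (m x) * indicator (max l -` B) x \<partial>lborel)"
      unfolding leb_def mixk_max
      by (subst nn_integral_density) (auto simp: m_def intro!: nn_integral_cong split: split_indicator)
    finally show ?thesis ..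
  qed
  have "emeasure (density base (\<lambda>x. ennreal (mixk Pd x))) UNIV = (\<integral>\<^sup>+x. ennreal (mixk Pd x) \<partial>base)"
    by (subst emeasure_density) auto
  also have "\<dots> = 1" using integrable_md by (subst nn_integral_eq_integral) (auto simp: md_norm mixk_nonneg)
  finally have "1 = ?I m + ?R UNIV" using split[of m UNIV] m0 m1 im[of UNIV] by simp
  moreover have "1 = ?I f + ?R UNIV" using split[of f UNIV] f_zero f_eq f_one by simp
  \<comment> \<open>Finiteness of the common part is what permits cancelling it in extended
    arithmetic.\<close>
  moreover have "?R UNIV \<noteq> top" using calculation by (metis ennreal_add_eq_top ennreal_one_neq_top)
  ultimately have I: "?I f = ?I m" by (metis ennreal_add_diff_cancel_right)
  have "emeasure (distr (density lborel (\<lambda>x. ennreal (f x))) borel (max l)) A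
      = (\<integral>\<^sup>+x. ennreal (f x) * indicator (max l -` A) x \<partial>lborel)"
    using measurable_sets_borel[of "max l" borel A] by (simp add: emeasure_distr emeasure_density)
  also have "\<dots> = (\<integral>\<^sup>+x. ennreal (m x) * indicator (max l -` A) x \<partial>lborel)"
    using split[of f A] split[of m A] f_zero f_eq m0 m1 I by simp
  also have "\<dots> = emeasure (density base (\<lambda>x. ennreal (mixk Pd x))) A" by (rule im) simp
  finally show "emeasure (distr (density lborel (\<lambda>x. ennreal (f x))) borel (max l)) A
      = emeasure (density base (\<lambda>x. ennreal (mixk Pd x))) A" .
qed simp

lemma integral_f:
  assumes [measurable]: "\<psi> \<in> borel_measurable borel" and \<psi>: "\<And>x. \<psi> (max l x) = \<psi> x"
    and i: "integrable base (\<lambda>x. mixk Pd x * \<psi> x)"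
  shows "integrable lborel (\<lambda>x. f x * \<psi> x)" "(\<integral>x. f x * \<psi> x \<partial>lborel) = (\<integral>x. mixk Pd x * \<psi> x \<partial>base)"
proof -
  have "integrable (density base (\<lambda>x. ennreal (mixk Pd x))) \<psi>"
    using i by (subst integrable_density) (auto simp: mixk_nonneg)
  then show "integrable lborel (\<lambda>x. f x * \<psi> x)"
    unfolding distr_max[symmetric]
    by (subst (asm) integrable_distr_eq) (auto simp: \<psi> integrable_density f_nonneg)
  have "(\<integral>x. mixk Pd x * \<psi> x \<partial>base) = (\<integral>x. \<psi> x \<partial>density base (\<lambda>x. ennreal (mixk Pd x)))"
    by (subst integral_density) (auto simp: mixk_nonneg)
  also have "\<dots> = (\<integral>x. f x * \<psi> x \<partial>lborel)"
    unfolding distr_max[symmetric]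
    by (subst integral_distr) (auto simp: \<psi> integral_density f_nonneg)
  finally show "(\<integral>x. f x * \<psi> x \<partial>lborel) = (\<integral>x. mixk Pd x * \<psi> x \<partial>base)" ..
qed

lemma f_pos_imp: "f x \<noteq> 0 \<Longrightarrow> x \<in> {0..L} \<and> 0 < mixk Pd x"
proof
  assume fx: "f x \<noteq> 0"
  then show x: "x \<in> {0..L}" using f_zero by blast
  show "0 < mixk Pd x"
  proof (cases "l < x")
    case True
    then show ?thesis using f_eq[of x] x fx f_nonneg[of x] by auto
  next
    case False
    have "(\<integral>u. 1 / L \<partial>Pd) \<le> mixk Pd x"
      unfolding mixk_def
    proof (intro integral_mono integrable_kern sets_Pd Pd.prob_space_axioms)
      show "1 / L \<le> kern x u" for u
        using False clip_bounds[of u] by (auto simp: kern_def intro!: frac_le)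
    qed auto
    then show ?thesis using l_pos l_less by (simp add: Pd.prob_space[unfolded space_Pd] less_le_trans[of 0 "1 / L"])
  qed
qed

text \<open>The Pythagorean identity: \<open>\<psi> n\<close> does not distinguish points of
  \<open>{0..l}\<close>, so its mean under \<open>f\<close> is \<open>KLd (mixk (Q n))\<close>, and
  the remaining term does not depend on \<open>n\<close>. If that term is not integrable, both sides
  are infinite for every \<open>n\<close>.\<close>

lemma KL_tendsto:
  assumes Q: "\<And>n. prob_on {l..L} (Q n)" and \<rho>: "\<And>n. 0 < \<rho> n" "\<And>n x. \<rho> n \<le> mixk (Q n) x"
    and lim: "(\<lambda>n. KLd (mixk (Q n))) \<longlonglongrightarrow> 0"
  shows "(\<lambda>n. KL f (mix (Q n))) \<longlonglongrightarrow> KL f (mix Pd)"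
proof -
  have Qm [measurable]: "mixk (Q n) \<in> borel_measurable borel" for n
    using Q[of n] by (auto intro: mixk_measurable simp: prob_on_def)
  have Q_le: "mixk (Q n) x \<le> 1 / l" for n x using Q[of n] by (auto intro: mixk_le simp: prob_on_def)
  have Q_pos: "0 < mixk (Q n) x" for n x using \<rho>(1)[of n] \<rho>(2)[of n x] by linarith
  define \<psi> where "\<psi> n x = ln (mixk Pd x / mixk (Q n) x)" for n x
  have [measurable]: "\<psi> n \<in> borel_measurable borel" for n unfolding \<psi>_def[abs_def] by measurable
  have int: "integrable base (\<lambda>x. mixk Pd x * \<psi> n x)" for n
    unfolding \<psi>_def by (rule integrable_KLd[OF Qm \<rho> Q_le])
  have \<psi>_max: "\<psi> n (max l x) = \<psi> n x" for n x by (simp add: \<psi>_def mixk_max)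
  note F = integral_f[OF _ \<psi>_max int]
  let ?h = "\<lambda>g x. f x * ln (f x / g x)"
  have dec: "?h (mix (Q n)) x = ?h (mix Pd) x + f x * \<psi> n x" for n x
  proof (cases "f x = 0")
    case False
    then have "0 < f x" using f_nonneg[of x] by linarith
    with f_pos_imp[OF False] Q_pos[of n x] show ?thesis
      by (simp add: mix_eq_mixk[OF Q] mix_eq_mixk[OF Pd] \<psi>_def ln_div algebra_simps)
  qed simp
  have z: "f x = 0" if "mix (Q n) x = 0" for n x
    using that f_zero[of x] Q_pos[of n x] by (auto simp: mix_eq_mixk[OF Q] indicator_def split: if_splits)
  have zd: "f x = 0" if "mix Pd x = 0" for x
    by (rule ccontr) (use that f_pos_imp[of x] in \<open>auto simp: mix_eq_mixk[OF Pd]\<close>)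
  show ?thesis
  proof (cases "integrable lborel (?h (mix Pd))")
    case True
    have "integrable lborel (?h (mix (Q n)))" for n
      unfolding dec using True F(1) by (intro Bochner_Integration.integrable_add) auto
    then have "KL f (mix (Q n)) = ereal (\<integral>x. ?h (mix (Q n)) x \<partial>lborel)" for n
      by (rule KL_eq_integral) (rule z)
    also have "(\<integral>x. ?h (mix (Q n)) x \<partial>lborel) = (\<integral>x. ?h (mix Pd) x \<partial>lborel) + KLd (mixk (Q n))" for n
      unfolding dec using True F[of n] by (simp add: KLd_def \<psi>_def)
    finally have "KL f (mix (Q n)) = ereal ((\<integral>x. ?h (mix Pd) x \<partial>lborel) + KLd (mixk (Q n)))" for n .
    moreover have "KL f (mix Pd) = ereal ((\<integral>x. ?h (mix Pd) x \<partial>lborel) + 0)"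
      using KL_eq_integral[OF True zd] by simp
    ultimately show ?thesis using lim by (simp only:) (intro tendsto_intros)
  next
    case False
    have "\<not> integrable lborel (?h (mix (Q n)))" for n
    proof
      assume "integrable lborel (?h (mix (Q n)))"
      then have "integrable lborel (\<lambda>x. ?h (mix (Q n)) x - f x * \<psi> n x)"
        using F(1)[of n] by (intro Bochner_Integration.integrable_diff) auto
      then show False using False by (simp add: dec)
    qed
    moreover have g: "mix R \<in> borel_measurable borel" "0 \<le> mix R x" "integrable lborel (mix R)"
      if R: "prob_on {l..L} R" for R x
    proof -
      have [measurable]: "mixk R \<in> borel_measurable borel" using R by (auto intro: mixk_measurable simp: prob_on_def)
      have eq: "mix R = (\<lambda>x. indicator {0..L} x * mixk R x)" by (rule ext) (rule mix_eq_mixk[OF R])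
      show "mix R \<in> borel_measurable borel" unfolding eq by measurable
      show "0 \<le> mix R x" unfolding eq by (simp add: mixk_nonneg)
      have "integrable leb (mixk R)"
        using R mixk_nonneg[of R] mixk_le[of R] by (intro integrable_leb_bounded[of _ "1 / l"]) (auto simp: prob_on_def)
      then show "integrable lborel (mix R)" unfolding eq by (subst (asm) integrable_leb_iff) auto
    qed
    moreover have "integrable lborel f"
      using f_one by (intro integrableI_nonneg) (auto simp: f_nonneg)
    ultimately have "KL f (mix (Q n)) = \<infinity>" "KL f (mix Pd) = \<infinity>" for n
      using z zd False Q Pd f_nonneg by (intro KL_eq_infinity; auto)+
    then show ?thesis by simp
  qed
qed

end

section \<open>The recursion with the uniform kernel\<close>

locale uniform_pr = uniform_obs + prob_space M for M :: "'a measure" +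
  fixes X :: "nat \<Rightarrow> 'a \<Rightarrow> real" and a :: real
  assumes X_indep: "indep_vars (\<lambda>_. borel) X {1..}"
    and X_law: "\<And>i. 1 \<le> i \<Longrightarrow> distributed M lborel (X i) (\<lambda>x. ennreal (f x))"
    and a_bounds: "0 < a" "a < 1 / 4"
begin

sublocale pr_iid kern base P\<^sub>0 "mixk Pd" "1 / l" "1 / L" L M "\<lambda>i \<omega>. max l (X i \<omega>)" a
proof
  show "indep_vars (\<lambda>_. borel) (\<lambda>i \<omega>. max l (X i \<omega>)) {1..}"
    by (rule indep_vars_compose2[OF X_indep]) measurable
  fix i :: nat assume i: "1 \<le> i"
  have "distr M borel (\<lambda>\<omega>. max l (X i \<omega>)) = distr (distr M lborel (X i)) borel (max l)"
    using distributed_measurable[OF X_law[OF i]] by (subst distr_distr) (auto simp: comp_def)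
  also have "\<dots> = density base (\<lambda>x. ennreal (mixk Pd x))"
    unfolding distributed_distr_eq_density[OF X_law[OF i]] by (rule distr_max)
  finally show "distr M borel (\<lambda>\<omega>. max l (X i \<omega>)) = density base (\<lambda>x. ennreal (mixk Pd x))" .
qed (rule a_bounds)+

lemma AE_X_range: "AE \<omega> in M. \<forall>i\<ge>1. X i \<omega> \<in> {0..L}"
proof -
  have "AE \<omega> in M. 1 \<le> i \<longrightarrow> X i \<omega> \<in> {0..L}" for i
  proof (cases "1 \<le> i")
    case True
    have "x \<in> {0..L}" if "0 < ennreal (f x)" for x
      using that f_zero[of x] by (cases "x \<in> {0..L}") auto
    then have "AE x in density lborel (\<lambda>x. ennreal (f x)). x \<in> {0..L}"
      by (subst AE_density) auto
    then have "AE \<omega> in M. X i \<omega> \<in> {0..L}"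
      using distributed_measurable[OF X_law[OF True]]
      unfolding distributed_distr_eq_density[OF X_law[OF True], symmetric] by (rule AE_distrD[rotated])
    then show ?thesis by simp
  qed simp
  then show ?thesis by (simp add: AE_all_countable)
qed

lemma density_dens:
  assumes d: "dens b d"
  shows "prob_on {l..L} (density P\<^sub>0 (\<lambda>u. ennreal (d u)))"
    "mixk (density P\<^sub>0 (\<lambda>u. ennreal (d u))) x = mixt d x"
proof -
  note [measurable] = d_meas[OF d]
  have E: "emeasure (density P\<^sub>0 (\<lambda>u. ennreal (d u))) A = 1" if "A \<in> sets borel" "{l..L} \<subseteq> A" for A
  proof -
    have "AE u in P\<^sub>0. ennreal (d u) * indicator A u = ennreal (d u)"
      using AE_prob_on[OF P0_on] by eventually_elim (use that in \<open>auto simp: indicator_def\<close>)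
    then have "emeasure (density P\<^sub>0 (\<lambda>u. ennreal (d u))) A = (\<integral>\<^sup>+u. ennreal (d u) \<partial>P\<^sub>0)"
      using that by (subst emeasure_density) (auto intro!: nn_integral_cong_AE)
    also have "\<dots> = 1"
      using integrable_d[OF d] by (subst nn_integral_eq_integral) (auto simp: d_nonneg[OF d] d_norm[OF d])
    finally show ?thesis .
  qed
  show "prob_on {l..L} (density P\<^sub>0 (\<lambda>u. ennreal (d u)))"
    unfolding prob_on_def by (auto intro!: prob_spaceI E)
  show "mixk (density P\<^sub>0 (\<lambda>u. ennreal (d u))) x = mixt d x"
    unfolding mixk_def mixt_def by (subst integral_density) (auto simp: d_nonneg[OF d] mult.commute)
qed

text \<open>The range condition matters because beyond \<open>L\<close> the kernel
  \<open>unif\<close> vanishes on the support of \<open>P\<^sub>0\<close>, whereas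
  \<open>kern\<close> treats such a point like \<open>L\<close>. Inside the range the kernels agree
  for parameters in \<open>{l..L}\<close>, and \<open>kern\<close> does not notice the maximum with
  \<open>l\<close>.\<close>

lemma PR_eq:
  assumes "\<And>i. 1 \<le> i \<Longrightarrow> x i \<in> {0..L}"
  shows "PR unif (\<lambda>i. a / real (i + 1)) P\<^sub>0 x n = density P\<^sub>0 (\<lambda>u. ennreal (pdens (\<lambda>i. max l (x i)) n u))"
proof (induction n)
  case 0
  show ?case by (simp add: density_1)
next
  case (Suc n)
  let ?d = "pdens (\<lambda>i. max l (x i)) n"
  have d: "dens (real (n + 1) powr - a) ?d" by (rule dens_pdens)
  note [measurable] = d_meas[OF d]
  have xn: "x (Suc n) \<in> {0..L}" by (rule assms) simp
  let ?w = "a / real (n + 2)"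
  let ?m = "mixt ?d (x (Suc n))"
  have m: "(\<integral>v. unif (x (Suc n)) v \<partial>density P\<^sub>0 (\<lambda>u. ennreal (?d u))) = ?m"
    using mix_eq_mixk[OF density_dens(1)[OF d], of "x (Suc n)"] density_dens(2)[OF d] xn by (simp add: mix_def)
  have mm: "mixt ?d (max l (x (Suc n))) = ?m" by (simp add: mixt_def kern_max)
  have e: "real (Suc n + 1) = real (n + 2)" by simp
  have um [measurable]: "(\<lambda>u. unif (x (Suc n)) u) \<in> borel_measurable P\<^sub>0" by (rule measurable_unif) simp
  have "PR unif (\<lambda>i. a / real (i + 1)) P\<^sub>0 x (Suc n)
      = density (density P\<^sub>0 (\<lambda>u. ennreal (?d u))) (\<lambda>u. ennreal (1 - ?w + ?w * unif (x (Suc n)) u / ?m))"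
    by (simp only: PR.simps Suc m e)
  also have "\<dots> = density P\<^sub>0 (\<lambda>u. ennreal (?d u) * ennreal (1 - ?w + ?w * unif (x (Suc n)) u / ?m))"
    by (rule density_density_eq) measurable
  also have "\<dots> = density P\<^sub>0 (\<lambda>u. ennreal (pdens (\<lambda>i. max l (x i)) (Suc n) u))"
  proof (rule density_cong)
    have "step ?w (max l (x (Suc n))) ?d \<in> borel_measurable borel"
      using dens_step[OF d weight_bounds(1,3)] by (rule d_meas)
    then show "(\<lambda>u. ennreal (pdens (\<lambda>i. max l (x i)) (Suc n) u)) \<in> borel_measurable P\<^sub>0" by simp
    show "AE u in P\<^sub>0. ennreal (?d u) * ennreal (1 - ?w + ?w * unif (x (Suc n)) u / ?m)
        = ennreal (pdens (\<lambda>i. max l (x i)) (Suc n) u)"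
      using AE_prob_on[OF P0_on]
    proof eventually_elim
      case (elim u)
      then show ?case
        using xn d_nonneg[OF d, of u]
        by (simp add: kern_unif[symmetric] step_def mm kern_max ennreal_mult'[symmetric])
    qed
  qed measurable
  finally show ?case .
qed

theorem PR_converges:
  defines "P \<equiv> \<lambda>\<omega>. PR unif (\<lambda>i. a / real (i + 1)) P\<^sub>0 (\<lambda>i. X i \<omega>)"
  shows "AE \<omega> in M. (\<lambda>n. KL f (mix (P \<omega> n))) \<longlonglongrightarrow> KL f (mix Pd)"
    "AE \<omega> in M. (\<lambda>n. tv_dist (mix (P \<omega> n)) (mix Pd)) \<longlonglongrightarrow> 0"
    "AE \<omega> in M. weak_conv_m (P \<omega>) Pd"
proof -
  let ?y = "\<lambda>\<omega> i. max l (X i \<omega>)"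
  have K0: "AE \<omega> in M. (\<lambda>n. KLd (mn (?y \<omega>) n)) \<longlonglongrightarrow> 0"
    by (rule AE_KLd_tendsto_0) (rule exists_minorant)
  have *: "AE \<omega> in M. (\<forall>n. prob_on {l..L} (P \<omega> n) \<and> mixk (P \<omega> n) = mn (?y \<omega>) n)
      \<and> (\<lambda>n. KLd (mn (?y \<omega>) n)) \<longlonglongrightarrow> 0"
    using AE_X_range K0
  proof eventually_elim
    case (elim \<omega>)
    have eq: "P \<omega> n = density P\<^sub>0 (\<lambda>u. ennreal (pdens (?y \<omega>) n u))" for n
      unfolding P_def by (rule PR_eq) (use elim(1) in blast)
    show ?case
      unfolding eq using density_dens[OF dens_pdens] elim(2) by blast
  qed
  have L1: "(\<lambda>n. \<integral>x. \<bar>mn y n x - mixk Pd x\<bar> \<partial>base) \<longlonglongrightarrow> 0"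
    if K: "(\<lambda>n. KLd (mn y n)) \<longlonglongrightarrow> 0" for y
  proof (rule tendstoI)
    fix \<epsilon> :: real assume \<epsilon>: "0 < \<epsilon>"
    \<comment> \<open>With \<open>e = \<epsilon> / 8\<close> in \<open>L1_dist_le\<close>, a
      divergence below \<open>\<epsilon> * (\<epsilon> / 8)\<close> contributes less than
      \<open>\<epsilon> / 2\<close>, and \<open>2 * e\<close> adds
      \<open>\<epsilon> / 4\<close>.\<close>
    have e: "0 < \<epsilon> / 8" "0 < \<epsilon> * (\<epsilon> / 8)" using \<epsilon> by simp_all
    show "\<forall>\<^sub>F n in sequentially. dist (\<integral>x. \<bar>mn y n x - mixk Pd x\<bar> \<partial>base) 0 < \<epsilon>"
      using order_tendstoD(2)[OF K e(2)]
    proof eventually_elim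
      case (elim n)
      then have "KLd (mn y n) / (2 * (\<epsilon> / 8)) < \<epsilon> * (\<epsilon> / 8) / (2 * (\<epsilon> / 8))"
        using \<epsilon> by (intro divide_strict_right_mono) auto
      also have "\<epsilon> * (\<epsilon> / 8) / (2 * (\<epsilon> / 8)) = \<epsilon> / 2" using \<epsilon> by simp
      finally have "(\<integral>x. \<bar>mn y n x - mixk Pd x\<bar> \<partial>base) < \<epsilon>"
        using L1_dist_le[OF dens_pdens e(1), of y n] \<epsilon> by linarith
      moreover have "0 \<le> (\<integral>x. \<bar>mn y n x - mixk Pd x\<bar> \<partial>base)"
        by (intro Bochner_Integration.integral_nonneg) auto
      ultimately show ?case by simp
    qed
  qed
  show "AE \<omega> in M. (\<lambda>n. KL f (mix (P \<omega> n))) \<longlonglongrightarrow> KL f (mix Pd)"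
    using *
  proof eventually_elim
    case (elim \<omega>)
    show ?case
      by (rule KL_tendsto[of "P \<omega>" "\<lambda>n. low (real (n + 1) powr - a)"])
         (use elim low_pos[OF dens_pdens] mixt_ge[OF dens_pdens] in auto)
  qed
  show "AE \<omega> in M. (\<lambda>n. tv_dist (mix (P \<omega> n)) (mix Pd)) \<longlonglongrightarrow> 0"
    using *
  proof eventually_elim
    case (elim \<omega>)
    then have Q: "prob_on {l..L} (P \<omega> n)" and eq: "mixk (P \<omega> n) = mn (?y \<omega>) n" for n by auto
    show ?case
    proof (rule tendsto_sandwich[OF always_eventually always_eventually tendsto_const])
      show "\<forall>n. 0 \<le> tv_dist (mix (P \<omega> n)) (mix Pd)" using tv_dist_le(1)[OF Q Pd] by blast
      show "\<forall>n. tv_dist (mix (P \<omega> n)) (mix Pd) \<le> (\<integral>x. \<bar>mn (?y \<omega>) n x - mixk Pd x\<bar> \<partial>base)"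
        using tv_dist_le(2)[OF Q Pd] by (simp add: eq)
    qed (use L1 elim in blast)
  qed
  show "AE \<omega> in M. weak_conv_m (P \<omega>) Pd"
    using *
  proof eventually_elim
    case (elim \<omega>)
    then have Q: "prob_on {l..L} (P \<omega> n)" and eq: "mixk (P \<omega> n) = mn (?y \<omega>) n" for n by auto
    have rd: "real_distribution R" if "prob_on {l..L} R" for R
      using that space_real[of R]
      by (auto simp: prob_on_def real_distribution_def real_distribution_axioms_def)
    show ?case
    proof (rule integral_cts_step_conv_imp_weak_conv[OF rd[OF Q] rd[OF Pd]])
      fix x y :: real assume xy: "x < y"
      have "(\<lambda>n. (1 + 3 * (\<bar>x\<bar> + \<bar>y\<bar>) / (y - x)) * (\<integral>x. \<bar>mn (?y \<omega>) n x - mixk Pd x\<bar> \<partial>base)) \<longlonglongrightarrow> 0"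
        using L1 elim by (intro tendsto_mult_right_zero) blast
      then have "(\<lambda>n. (\<integral>u. cts_step x y u \<partial>P \<omega> n) - (\<integral>u. cts_step x y u \<partial>Pd)) \<longlonglongrightarrow> 0"
        by (rule Lim_null_comparison[rotated])
           (use cts_step_diff_le[OF Q Pd xy] in \<open>auto simp: eq\<close>)
      then show "(\<lambda>n. \<integral>u. cts_step x y u \<partial>P \<omega> n) \<longlonglongrightarrow> (\<integral>u. cts_step x y u \<partial>Pd)"
        by (simp add: LIM_zero_iff)
    qed
  qed
qed

end


section \<open>The limit mixture\<close>

lemma nn_integral_add_measure:
  assumes s: "sets N = sets M" and "g \<in> borel_measurable M"
  shows "(\<integral>\<^sup>+x. g x \<partial>add_measure M N) = (\<integral>\<^sup>+x. g x \<partial>M) + (\<integral>\<^sup>+x. g x \<partial>N)"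
  using assms(2)
proof (induction rule: borel_measurable_induct)
  case (cong f g)
  have "(\<integral>\<^sup>+x. f x \<partial>R) = (\<integral>\<^sup>+x. g x \<partial>R)" if "space R = space M" for R
    using cong(3) that by (intro nn_integral_cong) simp
  with cong(4) sets_eq_imp_space_eq[OF s] show ?case by simp
next
  case (set A)
  then show ?case using s by (simp add: emeasure_add_measure)
next
  case (mult u c)
  then have "u \<in> borel_measurable N" "u \<in> borel_measurable (add_measure M N)"
    using s by (simp_all cong: measurable_cong_sets)
  with mult show ?case by (simp add: nn_integral_cmult distrib_left)
next
  case (add u v)
  then have "u \<in> borel_measurable N" "u \<in> borel_measurable (add_measure M N)"
    "v \<in> borel_measurable N" "v \<in> borel_measurable (add_measure M N)"
    using s by (simp_all cong: measurable_cong_sets)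
  with add show ?case by (simp add: nn_integral_add add_ac)
next
  case (seq U)
  then have U: "\<And>i. U i \<in> borel_measurable N" "\<And>i. U i \<in> borel_measurable (add_measure M N)"
    using s by (simp_all cong: measurable_cong_sets)
  have inc: "incseq (\<lambda>i. \<integral>\<^sup>+x. U i x \<partial>R)" for R
    using \<open>incseq U\<close> by (auto simp: incseq_def le_fun_def intro!: nn_integral_mono)
  have "(\<integral>\<^sup>+x. (SUP i. U i) x \<partial>R) = (SUP i. \<integral>\<^sup>+x. U i x \<partial>R)" if "\<And>i. U i \<in> borel_measurable R" for R
    unfolding SUP_apply using \<open>incseq U\<close> that by (rule nn_integral_monotone_convergence_SUP)
  then show ?case using seq U inc by (simp add: ennreal_SUP_add)
qed

lemma nn_integral_mix3:
  assumes s: "sets N = sets M" "sets R = sets M" and g [measurable]: "g \<in> borel_measurable M"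
  shows "(\<integral>\<^sup>+x. g x \<partial>mix3 a M b N c R)
    = ennreal a * (\<integral>\<^sup>+x. g x \<partial>M) + (ennreal b * (\<integral>\<^sup>+x. g x \<partial>N) + ennreal c * (\<integral>\<^sup>+x. g x \<partial>R))"
proof -
  have "g \<in> borel_measurable N" "g \<in> borel_measurable R"
    using g s by (simp_all cong: measurable_cong_sets)
  then show ?thesis
    using s g unfolding mix3_def by (simp add: nn_integral_add_measure nn_integral_scale_measure)
qed

text \<open>For \<open>x\<close> in the range, parameters up to \<open>l\<close> contribute nothing,
  and parameters from \<open>L\<close> on contribute as much as they do at \<open>L\<close>, in
  total \<open>mstar L\<close>. A constant in \<open>x\<close> is a multiple of the kernel at
  \<open>L\<close>, which explains the weight \<open>L * mstar L\<close> of that atom.\<close>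

lemma renorm_eq_mix_P_dagger:
  assumes m: "monotone_density mstar" and P: "prob_on {0..} Pstar"
    and rep: "\<forall>x>0. mstar x = mix Pstar x" and l_L: "0 < l" "l < L"
    and x: "l < x" "x \<le> L"
  shows "renorm mstar L x = mix (P_dagger Pstar mstar l L) x"
proof -
  let ?D = "dist_fun mstar L"
  interpret P: prob_space Pstar using P by (simp add: prob_on_def)
  have s [measurable_cong, simp]: "sets Pstar = sets borel" using P by (simp add: prob_on_def)
  interpret Q: prob_space "P_dagger Pstar mstar l L"
    using prob_on_P_dagger[OF m P rep l_L] by (simp add: prob_on_def)
  have D: "0 < ?D" using dist_fun_eq(2)[OF m P rep] l_L by simp
  have m0: "0 \<le> mstar y" for y using m by (simp add: monotone_density_def)
  have u0: "0 \<le> unif y u" for y u by (auto simp: unif_def split: split_indicator)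
  have ub: "unif y u \<le> 1 / y" if "0 < y" for y u
    using that by (auto simp: unif_def frac_le split: split_indicator)
  have um: "(\<lambda>u. unif y u) \<in> borel_measurable borel" for y by (rule measurable_unif) simp
  note [measurable] = um
  have nn: "(\<integral>\<^sup>+u. ennreal (unif y u) \<partial>R) = ennreal (mix R y)" if "prob_space R" "sets R = sets borel" "0 < y" for R y
  proof -
    interpret prob_space R by fact
    have "integrable R (\<lambda>u. unif y u)"
      using that by (intro integrable_const_bound[of _ "1 / y"]) (auto simp: u0 ub measurable_unif)
    then show ?thesis by (simp add: mix_def nn_integral_eq_integral u0)
  qed
  have sr: "sets (restr Pstar l L) = sets borel" by (simp add: restr_def)
  \<comment> \<open>The weight undoes the conditioning on \<open>{0..L}\<close>. If that interval
    has mass 0, both sides vanish.\<close>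
  have "scale_measure (ennreal (P.prob {0..L})) (restr Pstar l L) = density Pstar (indicator {l<..<L})"
  proof (rule measure_eqI)
    fix A assume "A \<in> sets (scale_measure (ennreal (P.prob {0..L})) (restr Pstar l L))"
    then have A [measurable]: "A \<in> sets borel" by (simp add: sr)
    have "emeasure (scale_measure (ennreal (P.prob {0..L})) (restr Pstar l L)) A = emeasure Pstar (A \<inter> {l<..<L})"
      using emeasure_restr[OF P l_L(1) A] by simp
    also have "\<dots> = (\<integral>\<^sup>+u. indicator (A \<inter> {l<..<L}) u \<partial>Pstar)" by (rule nn_integral_indicator[symmetric]) simp
    also have "\<dots> = emeasure (density Pstar (indicator {l<..<L})) A"
      by (subst emeasure_density)
         (auto simp del: nn_integral_indicator intro!: nn_integral_cong split: split_indicator)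
    finally show "emeasure (scale_measure (ennreal (P.prob {0..L})) (restr Pstar l L)) A
      = emeasure (density Pstar (indicator {l<..<L})) A" .
  qed (simp add: sr)
  then have "ennreal (P.prob {0..L}) * (\<integral>\<^sup>+u. ennreal (unif x u) \<partial>restr Pstar l L)
      = (\<integral>\<^sup>+u. ennreal (unif x u) \<partial>density Pstar (indicator {l<..<L}))"
    using sr by (subst nn_integral_scale_measure[symmetric]) (auto simp: measurable_unif)
  also have "\<dots> = (\<integral>\<^sup>+u. indicator {l<..<L} u * ennreal (unif x u) \<partial>Pstar)"
    by (subst nn_integral_density) auto
  finally have R: "ennreal (P.prob {0..L}) * (\<integral>\<^sup>+u. ennreal (unif x u) \<partial>restr Pstar l L)
      = (\<integral>\<^sup>+u. indicator {l<..<L} u * ennreal (unif x u) \<partial>Pstar)" .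
  have L0: "0 < L" "0 < x" using l_L x by auto
  \<comment> \<open>The parameters from \<open>L\<close> on: there
    \<open>unif x u = 1 / u = unif L u\<close>, including \<open>u = L\<close>.\<close>
  have pw: "ennreal (unif x u) = indicator {l<..<L} u * ennreal (unif x u) + ennreal (unif L u)" for u
    using x l_L by (auto simp: unif_def split: split_indicator)
  have "ennreal (mstar x) = (\<integral>\<^sup>+u. ennreal (unif x u) \<partial>Pstar)"
    using rep L0 nn[OF P.prob_space_axioms s] by simp
  also have "\<dots> = (\<integral>\<^sup>+u. indicator {l<..<L} u * ennreal (unif x u) + ennreal (unif L u) \<partial>Pstar)"
    using pw by (rule nn_integral_cong)
  also have "\<dots> = (\<integral>\<^sup>+u. indicator {l<..<L} u * ennreal (unif x u) \<partial>Pstar) + ennreal (mstar L)"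
    using rep L0 nn[OF P.prob_space_axioms s] by (subst nn_integral_add) auto
  finally have mx: "ennreal (mstar x) = (\<integral>\<^sup>+u. indicator {l<..<L} u * ennreal (unif x u) \<partial>Pstar) + ennreal (mstar L)" .
  have "ennreal (mix (P_dagger Pstar mstar l L) x) = (\<integral>\<^sup>+u. ennreal (unif x u) \<partial>P_dagger Pstar mstar l L)"
    using nn[OF Q.prob_space_axioms] L0 by simp
  also have "\<dots> = ennreal (P.prob {0..l} / ?D) * ennreal (unif x l)
      + (ennreal (P.prob {0..L} / ?D) * (\<integral>\<^sup>+u. ennreal (unif x u) \<partial>restr Pstar l L)
      + ennreal (L * mstar L / ?D) * ennreal (unif x L))"
    unfolding P_dagger_def by (subst nn_integral_mix3) (auto simp: sr nn_integral_return)
  also have "unif x l = 0" using x l_L by (simp add: unif_def)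
  also have "ennreal (L * mstar L / ?D) * ennreal (unif x L) = ennreal (1 / ?D) * ennreal (mstar L)"
    using x l_L D m0 by (simp add: unif_def ennreal_mult[symmetric])
  also have "ennreal (P.prob {0..L} / ?D) = ennreal (1 / ?D) * ennreal (P.prob {0..L})"
    using D by (simp add: ennreal_mult[symmetric])
  finally have "ennreal (mix (P_dagger Pstar mstar l L) x) = ennreal (1 / ?D) * ennreal (mstar x)"
    unfolding mx by (simp add: mult.assoc R distrib_left)
  also have "\<dots> = ennreal (mstar x / ?D)" using D m0 by (simp add: ennreal_mult[symmetric])
  finally have "mix (P_dagger Pstar mstar l L) x = mstar x / ?D"
    using D m0 u0 by (subst (asm) ennreal_inj) (auto simp: mix_def intro!: Bochner_Integration.integral_nonneg)
  then show ?thesis using x l_L by (simp add: renorm_def)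
qed

text \<open>The condition \<open>PU_support\<close> makes the limit reachable: every
  \<open>P \<omega> n\<close> vanishes where \<open>P\<^sub>0\<close> does, and a weak limit cannot
  charge an open interval that all of them miss.\<close>

theorem theorem2:
  fixes M :: "'a measure" and X :: "nat \<Rightarrow> 'a \<Rightarrow> real"
    and mstar :: "real \<Rightarrow> real" and Pstar PU :: "real measure"
    and l L a p\<^sub>l p\<^sub>L :: real
  defines "mstarL \<equiv> renorm mstar L"
    and "P\<^sub>0 \<equiv> mix3 p\<^sub>l (return borel l) (1 - p\<^sub>l - p\<^sub>L) PU p\<^sub>L (return borel L)"
    and "w \<equiv> (\<lambda>i. a / real (i + 1))"
  defines "P \<equiv> (\<lambda>\<omega> n. PR unif w P\<^sub>0 (\<lambda>i. X i \<omega>) n)"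
    and "Pdag \<equiv> P_dagger Pstar mstar l L"
  assumes mstar: "monotone_density mstar"
    and Pstar: "prob_on {0..} Pstar"
    and representation: "\<forall>x>0. mstar x = mix Pstar x"
    and l_L: "0 < l" "l < L"
    and finite_KL: "\<exists>Q. prob_on {l..L} Q \<and> KL mstarL (mix Q) < \<infinity>"
    and M: "prob_space M"
    and indep: "prob_space.indep_vars M (\<lambda>_. borel) X {1..}"
    and law: "\<forall>i\<ge>1. distributed M lborel (X i) (\<lambda>x. ennreal (mstarL x))"
    and weights: "0 < a" "a < 2 / 9"
    and atoms: "0 < p\<^sub>l" "0 < p\<^sub>L" "p\<^sub>l + p\<^sub>L < 1"
    and PU: "prob_on {l..L} PU"
    and PU_density: "\<exists>f\<in>borel_measurable borel. PU = density lborel f"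
    and PU_support: "\<forall>c d. l \<le> c \<and> c < d \<and> d \<le> L \<and> emeasure Pstar {c<..<d} > 0 \<longrightarrow> emeasure PU {c<..<d} > 0"
  shows "(AE \<omega> in M. (\<lambda>n. KL mstarL (mix (P \<omega> n))) \<longlonglongrightarrow> KL mstarL (mix Pdag)) \<and>
         (AE \<omega> in M. (\<lambda>n. tv_dist (mix (P \<omega> n)) (mix Pdag)) \<longlonglongrightarrow> 0) \<and>
         (AE \<omega> in M. weak_conv_m (P \<omega>) Pdag)"
proof -
  interpret M: prob_space M by fact
  interpret interval l L by unfold_locales (fact l_L)+
  interpret PU: prob_space PU using PU by (simp add: prob_on_def)
  interpret Pstar: prob_space Pstar using Pstar by (simp add: prob_on_def)
  have sU: "sets PU = sets borel" using PU by (simp add: prob_on_def)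
  have s: "sets Pstar = sets borel" using Pstar by (simp add: prob_on_def)
  have D: "0 < dist_fun mstar L" using dist_fun_eq(2)[OF mstar Pstar representation] l_L by simp
  have m0: "0 \<le> mstar x" for x using mstar by (simp add: monotone_density_def)
  have mm [measurable]: "mstar \<in> borel_measurable borel" using mstar by (simp add: monotone_density_def)
  have P0: "emeasure P\<^sub>0 A = ennreal (p\<^sub>l * indicator A l + (1 - p\<^sub>l - p\<^sub>L) * PU.prob A + p\<^sub>L * indicator A L)"
    if "A \<in> sets borel" for A
    using that atoms unfolding P\<^sub>0_def
    by (subst emeasure_mix3)
       (auto simp: sU PU.emeasure_eq_measure ennreal_mult[symmetric] ennreal_plus[symmetric] simp del: ennreal_plus
         split: split_indicator)
  have P0_pos: "0 < measure P\<^sub>0 A" if "A \<in> sets borel" "l \<in> A \<or> L \<in> A \<or> 0 < PU.prob A" for A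
  proof -
    have "0 < p\<^sub>l * indicator A l + (1 - p\<^sub>l - p\<^sub>L) * PU.prob A + p\<^sub>L * indicator A L"
      using that(2) atoms
      by (auto simp: add_nonneg_pos add_pos_nonneg mult_nonneg_nonneg split: split_indicator)
    then show ?thesis by (simp add: measure_def P0[OF that(1)])
  qed
  have P0_1: "emeasure P\<^sub>0 A = 1" if A: "A \<in> sets borel" "{l..L} \<subseteq> A" for A
  proof -
    have "emeasure PU {l..L} \<le> emeasure PU A" using A sU by (intro emeasure_mono) auto
    then have "PU.prob A = 1" using PU by (intro antisym PU.prob_le_1) (simp add: prob_on_def PU.emeasure_eq_measure)
    moreover have "l \<in> A" "L \<in> A" using A(2) l_L by auto
    ultimately show ?thesis by (simp add: P0[OF A(1)])
  qed
  have s0: "sets P\<^sub>0 = sets borel" by (simp add: P\<^sub>0_def)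
  have P0_on: "prob_on {l..L} P\<^sub>0"
    unfolding prob_on_def using space_real[OF s0] by (auto simp: s0 intro!: prob_spaceI P0_1)
  have Pdag: "prob_on {l..L} Pdag"
    unfolding Pdag_def by (rule prob_on_P_dagger[OF mstar Pstar representation l_L])
  \<comment> \<open>Such an interval contains neither \<open>l\<close> nor \<open>L\<close>, so only
    the part of \<open>Pdag\<close> inherited from \<open>Pstar\<close> can charge it, and
    \<open>PU_support\<close> transfers the charge to \<open>PU\<close>.\<close>
  have supp: "0 < measure P\<^sub>0 {c<..<d}" if cd: "l \<le> c" "c < d" "d \<le> L" "0 < measure Pdag {c<..<d}" for c d
  proof -
    have "emeasure Pdag {c<..<d} = ennreal (Pstar.prob ({c<..<d} \<inter> {l<..<L}) / dist_fun mstar L)"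
      unfolding Pdag_def using cd by (subst emeasure_P_dagger[OF mstar Pstar representation l_L]) auto
    also have "{c<..<d} \<inter> {l<..<L} = {c<..<d}" using cd by auto
    finally have "0 < Pstar.prob {c<..<d}"
      using cd(4) D by (simp add: measure_def zero_less_divide_iff)
    then have "0 < PU.prob {c<..<d}"
      using PU_support cd(1-3) by (simp add: Pstar.emeasure_eq_measure PU.emeasure_eq_measure)
    then show ?thesis by (intro P0_pos) auto
  qed
  \<comment> \<open>That \<open>mstarL\<close> has total mass 1 is read off from the law of
    \<open>X 1\<close>.\<close>
  have "(\<integral>\<^sup>+x. ennreal (mstarL x) \<partial>lborel) = emeasure (density lborel (\<lambda>x. ennreal (mstarL x))) UNIV"
    by (subst emeasure_density) (auto simp: mstarL_def renorm_def[abs_def])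
  also have "\<dots> = emeasure (distr M lborel (X 1)) UNIV"
    using law by (subst distributed_distr_eq_density[of M lborel "X 1"]) auto
  also have "\<dots> = 1"
    using law distributed_measurable[of M lborel "X 1"] by (subst emeasure_distr) (auto simp: M.emeasure_space_1)
  finally have one: "(\<integral>\<^sup>+x. ennreal (mstarL x) \<partial>lborel) = 1" .
  have "uniform_pr l L Pdag P\<^sub>0 mstarL M X a"
  proof (intro uniform_pr.intro uniform_obs.intro uniform_model.intro uniform_model_axioms.intro
      uniform_obs_axioms.intro uniform_pr_axioms.intro interval_axioms M)
    show "mstarL \<in> borel_measurable borel" unfolding mstarL_def renorm_def[abs_def] by measurable
    show "0 \<le> mstarL x" for x using m0 D by (simp add: mstarL_def renorm_def)
    show "x \<notin> {0..L} \<Longrightarrow> mstarL x = 0" for x by (simp add: mstarL_def renorm_def)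
    show "mstarL x = mixk Pdag x" if "l < x" "x \<le> L" for x
      using renorm_eq_mix_P_dagger[OF mstar Pstar representation l_L that] mix_eq_mixk[OF Pdag, of x] that l_L
      by (simp add: mstarL_def Pdag_def)
    show "0 < measure P\<^sub>0 {l}" "0 < measure P\<^sub>0 {L}" by (intro P0_pos; simp)+
    show "a < 1 / 4" using weights by simp
  qed (use Pdag P0_on supp one indep law weights in auto)
  then interpret uniform_pr l L Pdag P\<^sub>0 mstarL M X a .
  show ?thesis
    using PR_converges unfolding P_def w_def by blast
qed

end
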